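(* Let $1/2<\beta<2/3$ and let $F$ be the neighbor function on $[0,1)^3$ defined in the context. Then $F$ extends continuously to $[0,1]^3$, and for each $\ell\in\{1,2,3\}$ the restriction of this continuous extension to the side face $\{r\in[0,1]^3:r_\ell=1\}$ is given by $$F|_{r_\ell=1}=\frac{\Gamma(2\beta)\Gamma(3\beta-1)}{\Gamma(\beta)\Gamma(4\beta-1)}\prod_{j\in\{1,2,3\}\setminus\{\ell\}}f_\beta(r_j).$$
   Context: $\mathbb N_0=\{0,1,2,\dots\}$, $r^n=r_1^{n_1}r_2^{n_2}r_3^{n_3}$, $e_j$ is the $j$-th unit vector of $\mathbb Z^3$. $f_\beta(x)={}_2F_1(1-\beta,\beta;2\beta;x)$, which for $\beta>1/2$ is continuous on $[0,1]$. The neighbor function: for $\beta>0$, $A,B:\mathbb N_0^3\to\mathbb R$, extended by $0$ to $\mathbb Z^3$, are the unique pair with $A_{(0,0,0)}=1$ such that for all $n\in\mathbb Z^3$ and all $\{j,k,\ell\}=\{1,2,3\}$, $$(n_\ell+1)(n_\ell+2\beta)A_{n+e_\ell}-(n_\ell+\beta)(n_\ell+1-\beta)A_n=B_n-B_{n-e_j}-B_{n-e_k}+B_{n-e_j-e_k},$$ $$(2n_jn_k+\beta n_j+\beta n_k+\beta n_\ell+\beta^2)A_n=B_{n-e_\ell-e_j}+B_{n-e_\ell-e_k}-B_n-B_{n-e_j-e_k}.$$ The series $\sum A_nr^n$ converges absolutely for $r\in\mathbb C^3$ with all $|r_i|<1/10$, and its sum extends analytically to a domain in $\mathbb C^3$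 containing $[0,1)^3$; $F$ denotes this extension restricted to $[0,1)^3$. *)

theory Defs
  imports "HOL-Analysis.Analysis"
begin

text \<open>Indices and points live in \<open>int ^ 3\<close>, \<open>real ^ 3\<close> and \<open>complex ^ 3\<close>;
  the component index ranges over the three-element type \<open>3\<close>, so
  \<open>{j, k, l} = UNIV\<close> says that \<open>j\<close>, \<open>k\<close>, \<open>l\<close> are the three indices in some order.
  The \<open>j\<close>-th unit vector is \<open>axis j 1\<close>.\<close>

definition nat_index :: "(int ^ 3) set" where
  "nat_index = {n. \<forall>i. 0 \<le> n $ i}"

definition vmonom :: "int ^ 3 \<Rightarrow> complex ^ 3 \<Rightarrow> complex" where
  "vmonom n z = (\<Prod>i\<in>UNIV. (z $ i) ^ nat (n $ i))"

definition neighbor_coeffs :: "real \<Rightarrow> (int ^ 3 \<Rightarrow> real) \<Rightarrow> (int ^ 3 \<Rightarrow> real) \<Rightarrow> bool" where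
  "neighbor_coeffs \<beta> A B \<longleftrightarrow>
     (\<forall>n. n \<notin> nat_index \<longrightarrow> A n = 0 \<and> B n = 0) \<and>
     A 0 = 1 \<and>
     (\<forall>n. \<forall>j k l :: 3. {j, k, l} = UNIV \<longrightarrow>
        (of_int (n $ l) + 1) * (of_int (n $ l) + 2 * \<beta>) * A (n + axis l 1)
          - (of_int (n $ l) + \<beta>) * (of_int (n $ l) + 1 - \<beta>) * A n
        = B n - B (n - axis j 1) - B (n - axis k 1) + B (n - axis j 1 - axis k 1) \<and>
        (2 * of_int (n $ j) * of_int (n $ k)
           + \<beta> * of_int (n $ j) + \<beta> * of_int (n $ k) + \<beta> * of_int (n $ l) + \<beta>\<^sup>2) * A n
        = B (n - axis l 1 - axis j 1) + B (n - axis l 1 - axis k 1)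
          - B n - B (n - axis j 1 - axis k 1))"

text \<open>Analyticity in several complex variables as complex differentiability on an open set,
  i.e. a real Frechet derivative which is moreover complex linear.\<close>

definition analytic_on_vec :: "(complex ^ 'n \<Rightarrow> complex) \<Rightarrow> (complex ^ 'n) set \<Rightarrow> bool" where
  "analytic_on_vec G D \<longleftrightarrow> open D \<and>
     (\<forall>z\<in>D. \<exists>L. (G has_derivative L) (at z) \<and> (\<forall>c v. L (c *s v) = c * L v))"

definition small_polydisc :: "(complex ^ 3) set" where
  "small_polydisc = {z. \<forall>i. cmod (z $ i) < 1 / 10}"

definition half_open_cube :: "(real ^ 3) set" where
  "half_open_cube = {r. \<forall>i. 0 \<le> r $ i \<and> r $ i < 1}"

definition closed_cube :: "(real ^ 3) set" where
  "closed_cube = {r. \<forall>i. 0 \<le> r $ i \<and> r $ i \<le> 1}"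

definition cvec :: "real ^ 3 \<Rightarrow> complex ^ 3" where
  "cvec r = (\<chi> i. complex_of_real (r $ i))"

text \<open>\<open>F\<close> is the neighbor function on \<open>half_open_cube\<close> (its values elsewhere are
  irrelevant): the restriction of an analytic extension \<open>G\<close>, to a domain \<open>D\<close> containing the
  half-open cube, of the sum of the power series on the polydisc. For complex-valued families,
  \<open>has_sum\<close> is absolute convergence together with the value of the sum. The coefficients
  and the values of \<open>G\<close> on the half-open cube are uniquely determined.\<close>

definition is_neighbor_function :: "real \<Rightarrow> (real ^ 3 \<Rightarrow> complex) \<Rightarrow> bool" where
  "is_neighbor_function \<beta> F \<longleftrightarrow>
     (\<exists>A B G D. neighbor_coeffs \<beta> A B \<and>
        open D \<and> connected D \<and> small_polydisc \<subseteq> D \<and> cvec ` half_open_cube \<subseteq> D \<and>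
        analytic_on_vec G D \<and>
        (\<forall>z\<in>small_polydisc. ((\<lambda>n. complex_of_real (A n) * vmonom n z) has_sum G z) nat_index) \<and>
        (\<forall>r\<in>half_open_cube. F r = G (cvec r)))"

text \<open>The Gauss hypergeometric series. For \<open>f_beta\<close> with \<open>\<beta> > 1/2\<close> the excess
  \<open>2\<beta> - (1-\<beta>) - \<beta> = 2\<beta> - 1\<close> is positive, so the series also converges at \<open>x = 1\<close>, to the
  value making \<open>f_beta\<close> continuous on \<open>[0,1]\<close>.\<close>

definition hyp2F1 :: "real \<Rightarrow> real \<Rightarrow> real \<Rightarrow> real \<Rightarrow> real" where
  "hyp2F1 a b c x =
     (\<Sum>n. pochhammer a n * pochhammer b n / (pochhammer c n * fact n) * x ^ n)"

definition f_beta :: "real \<Rightarrow> real \<Rightarrow> real" where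
  "f_beta \<beta> x = hyp2F1 (1 - \<beta>) \<beta> (2 * \<beta>) x"

end

theory Submission
  imports Defs "HOL-Complex_Analysis.Complex_Analysis" "HOL-Real_Asymp.Real_Asymp" "HOL-Probability.Sinc_Integral"
begin

text \<open>
  Let \<open>P\<^sub>n\<close> be the continuous dual Hahn polynomials for which \<open>\<psi>(\<lambda>, x) = \<Sum> P\<^sub>n(\<lambda>) x^n\<close> solves the
  hypergeometric equation of \<open>f\<^sub>\<beta>\<close> with eigenvalue \<open>\<lambda>\<close> in place of \<open>0\<close>. The recurrences force
  \<open>A\<^sub>a\<^sub>b\<^sub>c = L[P\<^sub>a P\<^sub>b P\<^sub>c]\<close>, where the linear functional \<open>L\<close> takes the Newton basis
  \<open>\<Prod>i<k. (i (i + 1 - 2\<beta>) - \<lambda>)\<close> to \<open>(\<beta>)\<^sub>k\<^sup>2\<close>. Shifting a contour in an integral of Gamma functions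
  shows that \<open>L\<close> is integration against a point mass \<open>c\<close> at \<open>\<lambda> = 0\<close> plus an explicit positive
  density on \<open>\<lambda> = -(t\<^sup>2 + (\<beta> - 1/2)\<^sup>2)\<close>. Since \<open>\<psi>(0, x) = f\<^sub>\<beta>(x)\<close>, this gives
  \<open>F(x, y, z) = c f\<^sub>\<beta>(x) f\<^sub>\<beta>(y) f\<^sub>\<beta>(z) + \<integral> \<psi>\<^sub>t(x) \<psi>\<^sub>t(y) \<psi>\<^sub>t(z) dm(t)\<close>.
  A Laplace type integral for \<open>\<psi>\<^sub>t\<close> bounds it by \<open>C (1 - x)^\<epsilon>\<close> uniformly in \<open>t\<close>, so the integral
  extends continuously to the closed cube and vanishes on the faces \<open>r\<^sub>l = 1\<close>. The constant
  \<open>c f\<^sub>\<beta>(1) = F(0, 0, 1)\<close> is the Gauss sum \<open>\<Sum> A\<^sub>0\<^sub>0\<^sub>n\<close>, which a Beta integral evaluates.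
\<close>

section \<open>Continuous dual Hahn polynomials\<close>

text \<open>The two recurrences have different uses. Differencing the first one in direction l
  leaves on the right the mixed third difference of B, the same for every l. So three second-order
  operators agree on A, the variables separate, and A is determined by its values on one axis; the
  second recurrence, read on that axis, supplies them. In \<lambda> = -(t^2 + (\<beta> - 1/2)^2) the
  P_n are continuous dual Hahn polynomials with parameters 1/2 - \<beta>, 2\<beta> - 1/2, 1/2, while
  L is the functional with parameters 1/2 - \<beta>, 2\<beta> - 1/2, 2\<beta> - 1/2; the P_n are not
  orthogonal for L. The negative parameter 1/2 - \<beta> is what creates the point mass at \<lambda>
  = 0. At x = 1 the equation for \<psi> has exponents \<beta> - 1/2 + it and \<beta> - 1/2 - it on
  the continuous spectrum, but 0 and 2\<beta> - 1 at \<lambda> = 0, so only the point mass can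
  survive on a face. The obstacle is growth in t: off [0,1) the functions \<psi> may grow
  exponentially in |t|, against a density of decay rate pi; on [0,1) the Laplace integral carries t
  only as a phase.\<close>

definition newton_poly :: "real \<Rightarrow> nat \<Rightarrow> real \<Rightarrow> real" where
  "newton_poly \<beta> k l = (\<Prod>i<k. real i * (real i + 1 - 2 * \<beta>) - l)"

definition hyp_coeff :: "real \<Rightarrow> nat \<Rightarrow> real" where
  "hyp_coeff \<beta> n = pochhammer (1 - \<beta>) n * pochhammer \<beta> n / (pochhammer (2 * \<beta>) n * fact n)"

text \<open>At \<lambda> = -(t^2 + (\<beta> - 1/2)^2) the Newton product is (b + it)_k (b - it)_k
  with b = 1/2 - \<beta>, so the sum is the terminating series 3F2(-n, b + it, b - it; \<beta>, 1 -
  \<beta>; 1). The prefactor makes the value at 0 the Taylor coefficient of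
  \<open>f_beta\<close>.\<close>

definition hahn_poly :: "real \<Rightarrow> nat \<Rightarrow> real \<Rightarrow> real" where
  "hahn_poly \<beta> n l = hyp_coeff \<beta> n *
     (\<Sum>k\<le>n. pochhammer (- real n) k / (pochhammer \<beta> k * pochhammer (1 - \<beta>) k * fact k)
        * newton_poly \<beta> k l)"

lemma newton_poly_0 [simp]: "newton_poly \<beta> 0 l = 1"
  by (simp add: newton_poly_def)

lemma newton_poly_Suc:
  "newton_poly \<beta> (Suc k) l = (real k * (real k + 1 - 2 * \<beta>) - l) * newton_poly \<beta> k l"
  by (simp add: newton_poly_def)

lemma newton_poly_at_0: "newton_poly \<beta> k 0 = (if k = 0 then 1 else 0)"
  by (auto simp: newton_poly_def intro!: prod_zero bexI[of _ 0])

lemma hahn_poly_at_0: "hahn_poly \<beta> n 0 = hyp_coeff \<beta> n"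
  by (simp add: hahn_poly_def newton_poly_at_0 if_distrib sum.delta cong: if_cong)

lemma hahn_poly_n0 [simp]: "hahn_poly \<beta> 0 l = 1"
  by (simp add: hahn_poly_def hyp_coeff_def)

text \<open>Terms with k > n vanish because (-n)_k does. A common upper limit lets the sums for n
  and n + 1 be subtracted term by term.\<close>

lemma hahn_poly_altdef:
  assumes "n < N"
  shows "hahn_poly \<beta> n l = hyp_coeff \<beta> n *
     (\<Sum>k<N. pochhammer (- real n) k / (pochhammer \<beta> k * pochhammer (1 - \<beta>) k * fact k)
        * newton_poly \<beta> k l)"
proof -
  have "(\<Sum>k\<le>n. pochhammer (- real n) k / (pochhammer \<beta> k * pochhammer (1 - \<beta>) k * fact k)
        * newton_poly \<beta> k l) = (\<Sum>k<N. pochhammer (- real n) k / (pochhammer \<beta> k * pochhammer (1 - \<beta>) k * fact k)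
        * newton_poly \<beta> k l)"
    using assms by (intro sum.mono_neutral_left) (auto simp: pochhammer_of_nat_eq_0_iff)
  thus ?thesis by (simp add: hahn_poly_def)
qed

lemma hyp_coeff_Suc:
  assumes "\<beta> > 0"
  shows "(real n + 1) * (real n + 2 * \<beta>) * hyp_coeff \<beta> (Suc n) =
         (real n + \<beta>) * (real n + 1 - \<beta>) * hyp_coeff \<beta> n"
proof -
  have nz: "pochhammer (2*\<beta>) n \<noteq> 0" "2 * \<beta> + real n \<noteq> 0" "1 + real n \<noteq> 0"
    using assms pochhammer_pos[of "2*\<beta>" n] by auto
  have "hyp_coeff \<beta> (Suc n) = hyp_coeff \<beta> n * ((1 - \<beta> + real n) * (\<beta> + real n) / ((2 * \<beta> + real n) * (1 + real n)))"
    using nz by (simp add: hyp_coeff_def pochhammer_Suc) (simp add: mult_ac)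
  thus ?thesis
    using nz by (simp add: divide_simps) (simp add: algebra_simps)
qed

text \<open>The left-hand operator of the first recurrence, applied in the index n. It annihilates
  \<open>hyp_coeff\<close>, which is the case \<lambda> = 0.\<close>

definition hahn_ladder :: "real \<Rightarrow> nat \<Rightarrow> real \<Rightarrow> real" where
  "hahn_ladder \<beta> n l = (real n + 1) * (real n + 2 * \<beta>) * hahn_poly \<beta> (Suc n) l -
         (real n + \<beta>) * (real n + 1 - \<beta>) * hahn_poly \<beta> n l"

lemma hahn_ladder_0: "0 < \<beta> \<Longrightarrow> \<beta> < 1 \<Longrightarrow> hahn_ladder \<beta> 0 l = l"
  by (simp add: hahn_ladder_def hahn_poly_def hyp_coeff_def newton_poly_def field_simps)

lemma pochhammer_neg_shift:
  "pochhammer (- real (Suc n)) (Suc k) - pochhammer (- real n) (Suc k)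
     = - (real k + 1) * pochhammer (- real n) k"
proof -
  have "pochhammer (- real (Suc n)) (Suc k) = - real (Suc n) * pochhammer (- real n) k"
    by (simp add: pochhammer_rec del: of_nat_Suc) (simp add: add.commute)
  moreover have "pochhammer (- real n) (Suc k) = pochhammer (- real n) k * (real k - real n)"
    by (simp add: pochhammer_Suc)
  ultimately show ?thesis by (simp add: algebra_simps)
qed

text \<open>By \<open>hyp_coeff_Suc\<close> both terms of the ladder share one prefactor, so the
  operator becomes a forward difference in n of the sum. \<open>pochhammer_neg_shift\<close> then
  lowers the index of the Pochhammer symbol by one against that of the Newton product.\<close>

lemma hahn_ladder_altdef:
  assumes "0 < \<beta>" "\<beta> < 1" "Suc n < N"
  shows "hahn_ladder \<beta> n l = - ((real n + \<beta>) * (real n + 1 - \<beta>) * hyp_coeff \<beta> n *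
    (\<Sum>k<N. pochhammer (- real n) k / (pochhammer \<beta> (Suc k) * pochhammer (1 - \<beta>) (Suc k) * fact k)
        * newton_poly \<beta> (Suc k) l))"
proof -
  let ?g = "\<lambda>n k. pochhammer (- real n) k / (pochhammer \<beta> k * pochhammer (1 - \<beta>) k * fact k)
        * newton_poly \<beta> k l"
  let ?h = "\<lambda>k. pochhammer (- real n) k / (pochhammer \<beta> (Suc k) * pochhammer (1 - \<beta>) (Suc k) * fact k)
        * newton_poly \<beta> (Suc k) l"
  have pos: "pochhammer \<beta> k > 0" "pochhammer (1 - \<beta>) k > 0" for k
    using assms by (auto intro!: pochhammer_pos)
  have *: "?g (Suc n) (Suc k) - ?g n (Suc k) = - ?h k" for k
  proof -
    have "?g (Suc n) (Suc k) - ?g n (Suc k) =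
       (pochhammer (- real (Suc n)) (Suc k) - pochhammer (- real n) (Suc k)) /
         (pochhammer \<beta> (Suc k) * pochhammer (1 - \<beta>) (Suc k) * fact (Suc k)) * newton_poly \<beta> (Suc k) l"
      by (simp add: diff_divide_distrib left_diff_distrib)
    also have "\<dots> = - ?h k"
    proof -
      have "1 + real k \<noteq> 0" by linarith
      thus ?thesis
        unfolding pochhammer_neg_shift using pos[of "Suc k"]
        by (simp add: divide_simps) (simp add: algebra_simps)?
    qed
    finally show ?thesis .
  qed
  have P1: "hahn_poly \<beta> (Suc n) l = hyp_coeff \<beta> (Suc n) * (\<Sum>k<Suc N. ?g (Suc n) k)"
    using assms by (intro hahn_poly_altdef) auto
  have P2: "hahn_poly \<beta> n l = hyp_coeff \<beta> n * (\<Sum>k<Suc N. ?g n k)"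
    using assms by (intro hahn_poly_altdef) auto
  have "hahn_ladder \<beta> n l = (real n + \<beta>) * (real n + 1 - \<beta>) * hyp_coeff \<beta> n *
      ((\<Sum>k<Suc N. ?g (Suc n) k) - (\<Sum>k<Suc N. ?g n k))"
    unfolding hahn_ladder_def P1 P2 using hyp_coeff_Suc[OF assms(1), of n]
    by (simp only: right_diff_distrib mult.assoc[symmetric])
  \<comment> \<open>The k = 0 terms are both 1 and cancel; the remaining indices are shifted down by
    one.\<close>
  also have "(\<Sum>k<Suc N. ?g (Suc n) k) - (\<Sum>k<Suc N. ?g n k) = (\<Sum>k<N. - ?h k)"
    unfolding sum.lessThan_Suc_shift using * by (simp add: sum_subtractf[symmetric])
  finally show ?thesis by (simp add: sum_negf)
qed

text \<open>The three-term recurrence of the P_n in factored form. Multiplication by l acts on the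
  Newton basis as a diagonal term plus a shift, and the shift is absorbed by (-m)_(k+1) = (-m)_k (k
  - m).\<close>

lemma hahn_ladder_Suc:
  assumes "0 < \<beta>" "\<beta> < 1"
  shows "hahn_ladder \<beta> (Suc n) l - hahn_ladder \<beta> n l = l * hahn_poly \<beta> (Suc n) l"
proof -
  \<comment> \<open>Large enough for \<open>hahn_ladder_altdef\<close> at m = n + 1 and for (-m)_N
    to vanish.\<close>
  define N where "N = n + 5"
  define m where "m = Suc n"
  define e where "e = (\<lambda>k. newton_poly \<beta> k l / (pochhammer \<beta> k * pochhammer (1 - \<beta>) k * fact k))"
  define X where "X = (\<lambda>k. e (Suc k) * (real k + 1))"
  have pos: "pochhammer \<beta> k > 0" "pochhammer (1 - \<beta>) k > 0" for k
    using assms by (auto intro!: pochhammer_pos)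
  have X: "newton_poly \<beta> (Suc k) l / (pochhammer \<beta> (Suc k) * pochhammer (1 - \<beta>) (Suc k) * fact k) = X k" for k
    using pos[of "Suc k"] by (simp add: X_def e_def divide_simps del: of_nat_Suc)
  \<comment> \<open>Multiplication by l in the Newton basis: X k is a multiple of the basis element
    of index k + 1.\<close>
  have eX: "l * e k = real k * (real k + 1 - 2 * \<beta>) * e k - (\<beta> + k) * (1 - \<beta> + k) * X k" for k
  proof -
    have nz: "real k + \<beta> \<noteq> 0" "real k + (1 - \<beta>) \<noteq> 0" using assms by auto
    have "(\<beta> + k) * (1 - \<beta> + k) * X k = (real k * (real k + 1 - 2 * \<beta>) - l) * e k"
      unfolding X_def e_def newton_poly_Suc pochhammer_Suc
      using nz pos[of k] by (simp add: divide_simps)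
    thus ?thesis by (simp add: algebra_simps)
  qed
  have L1: "hahn_ladder \<beta> m l = - ((real m + \<beta>) * (real m + 1 - \<beta>) * hyp_coeff \<beta> m *
      (\<Sum>k<N. pochhammer (- real m) k * X k))"
    by (subst hahn_ladder_altdef[OF assms, of m N]) (simp_all add: N_def m_def flip: X)
  have L0: "hahn_ladder \<beta> n l = - ((real n + \<beta>) * (real n + 1 - \<beta>) * hyp_coeff \<beta> n *
      (\<Sum>k<N. pochhammer (- real n) k * X k))"
    by (subst hahn_ladder_altdef[OF assms, of n N]) (simp_all add: N_def flip: X)
  also have "(real n + \<beta>) * (real n + 1 - \<beta>) * hyp_coeff \<beta> n = real m * (real m - 1 + 2 * \<beta>) * hyp_coeff \<beta> m"
    using hyp_coeff_Suc[OF assms(1), of n] by (simp add: m_def algebra_simps)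
  finally have L0: "hahn_ladder \<beta> n l = - (hyp_coeff \<beta> m *
      (\<Sum>k<N. real m * (real m - 1 + 2 * \<beta>) * pochhammer (- real n) k * X k))"
    by (simp add: sum_distrib_left mult_ac)
  have shift: "real m * pochhammer (- real n) k = (real m - real k) * pochhammer (- real m) k" for k
  proof -
    have "pochhammer (- real m) (Suc k) = - real m * pochhammer (- real n) k"
      by (simp add: pochhammer_rec m_def del: of_nat_Suc) (simp add: add.commute)
    moreover have "pochhammer (- real m) (Suc k) = pochhammer (- real m) k * (real k - real m)"
      by (simp add: pochhammer_Suc)
    ultimately show ?thesis by (simp add: algebra_simps)
  qed
  have shift2: "real m * (real m - 1 + 2 * \<beta>) * pochhammer (- real n) k * X k =
      (real m - 1 + 2 * \<beta>) * (real m - real k) * pochhammer (- real m) k * X k" for k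
    using arg_cong[OF shift[of k], of "\<lambda>u. u * ((real m - 1 + 2 * \<beta>) * X k)"] by (simp only: mult_ac)
  have L0: "hahn_ladder \<beta> n l = - (hyp_coeff \<beta> m *
      (\<Sum>k<N. (real m - 1 + 2 * \<beta>) * (real m - real k) * pochhammer (- real m) k * X k))"
    unfolding L0 shift2 ..
  have "hahn_ladder \<beta> m l - hahn_ladder \<beta> n l =
      - (hyp_coeff \<beta> m * (\<Sum>k<N. ((real m + \<beta>) * (real m + 1 - \<beta>) -
          (real m - 1 + 2 * \<beta>) * (real m - real k)) * pochhammer (- real m) k * X k))"
    unfolding L0 L1 by (simp add: sum_distrib_left algebra_simps sum_subtractf sum.distrib)
  \<comment> \<open>The quadratic weight is split so that its first part matches the X term of
    \<open>eX\<close> and its second part, after replacing k by k + 1, the diagonal term.\<close>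
  also have "(\<Sum>k<N. ((real m + \<beta>) * (real m + 1 - \<beta>) -
          (real m - 1 + 2 * \<beta>) * (real m - real k)) * pochhammer (- real m) k * X k) =
       (\<Sum>k<N. (\<beta> + k) * (1 - \<beta> + k) * pochhammer (- real m) k * X k) -
       (\<Sum>k<N. (real k - real m) * (real k + 2 - 2 * \<beta>) * pochhammer (- real m) k * X k)"
    unfolding sum_subtractf[symmetric] by (intro sum.cong refl) (simp add: algebra_simps)
  also have "(\<Sum>k<N. (real k - real m) * (real k + 2 - 2 * \<beta>) * pochhammer (- real m) k * X k) =
       (\<Sum>k<N. real (Suc k) * (real (Suc k) + 1 - 2 * \<beta>) * pochhammer (- real m) (Suc k) * e (Suc k))"
    by (intro sum.cong refl) (simp add: X_def pochhammer_Suc algebra_simps)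
  also have "\<dots> = (\<Sum>k<Suc N. real k * (real k + 1 - 2 * \<beta>) * pochhammer (- real m) k * e k)"
    unfolding sum.lessThan_Suc_shift by simp
  also have "\<dots> = (\<Sum>k<N. real k * (real k + 1 - 2 * \<beta>) * pochhammer (- real m) k * e k)"
  proof -
    have "pochhammer (- real m) N = 0"
      unfolding pochhammer_of_nat_eq_0_iff by (simp add: N_def m_def)
    thus ?thesis by simp
  qed
  also have "(\<Sum>k<N. (\<beta> + k) * (1 - \<beta> + k) * pochhammer (- real m) k * X k) - \<dots> =
       - (\<Sum>k<N. pochhammer (- real m) k * (l * e k))"
    unfolding eX sum_subtractf[symmetric] sum_negf[symmetric]
    by (intro sum.cong refl) (simp add: algebra_simps)
  also have "- (hyp_coeff \<beta> m * \<dots>) = l * hahn_poly \<beta> m l"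
    by (subst hahn_poly_altdef[of m N])
      (auto simp: N_def m_def e_def sum_distrib_left mult_ac)
  finally show ?thesis by (simp add: m_def)
qed

text \<open>On generating functions, partial sums are multiplication by 1/(1 - x). In this form the
  relation can be compared with the first recurrence, whose right-hand side is itself a partial sum
  of mixed differences of B.\<close>

lemma hahn_ladder_sum:
  assumes "0 < \<beta>" "\<beta> < 1"
  shows "hahn_ladder \<beta> n l = l * (\<Sum>k\<le>n. hahn_poly \<beta> k l)"
proof (induction n)
  case (Suc n)
  thus ?case using hahn_ladder_Suc[OF assms, of n l] by (simp add: algebra_simps)
qed (simp add: hahn_ladder_0 assms)

text \<open>One factor (\<beta>)_k of the squared moment cancels a denominator, leaving the series
  2F1(-n, \<beta>; 1 - \<beta>; 1), which Chu-Vandermonde sums. The right-hand side is the value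
  that the recurrences give to A on an axis.\<close>

lemma hahn_poly_moment:
  assumes "0 < \<beta>" "\<beta> < 1"
  shows "hyp_coeff \<beta> n *
     (\<Sum>k\<le>n. pochhammer (- real n) k / (pochhammer \<beta> k * pochhammer (1 - \<beta>) k * fact k)
        * (pochhammer \<beta> k)\<^sup>2) = pochhammer \<beta> n * pochhammer (1 - 2 * \<beta>) n / (pochhammer (2 * \<beta>) n * fact n)"
proof -
  have pos: "pochhammer \<beta> k > 0" "pochhammer (1 - \<beta>) k > 0" for k
    using assms by (auto intro!: pochhammer_pos)
  have "(\<Sum>k\<le>n. pochhammer (- real n) k / (pochhammer \<beta> k * pochhammer (1 - \<beta>) k * fact k)
        * (pochhammer \<beta> k)\<^sup>2) =
     (\<Sum>k = 0..n. pochhammer \<beta> k * pochhammer (- real n) k / (real (fact k) * pochhammer (1 - \<beta>) k))"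
  proof (intro sum.cong)
    fix k
    show "pochhammer (- real n) k / (pochhammer \<beta> k * pochhammer (1 - \<beta>) k * fact k)
        * (pochhammer \<beta> k)\<^sup>2 = pochhammer \<beta> k * pochhammer (- real n) k / (real (fact k) * pochhammer (1 - \<beta>) k)"
      using pos[of k] by (simp add: power2_eq_square field_simps)
  qed auto
  also have "\<dots> = pochhammer (1 - 2 * \<beta>) n / pochhammer (1 - \<beta>) n"
    using assms Vandermonde_pochhammer[of n "1 - \<beta>" \<beta>]
    by (force simp: algebra_simps)
  finally show ?thesis using pos[of n] by (simp add: hyp_coeff_def field_simps)
qed

section \<open>A Laplace type integral\<close>

definition cayley :: "complex \<Rightarrow> complex" where
  "cayley r = (1 + r) / (1 - r)"

text \<open>Re (cayley r) = (1 - |r|^2)/|1 - r|^2 is the Poisson kernel, and Im/Re = 2 Im r/(1 -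
  |r|^2). The second bound confines the values to a sector of half-angle arctan (2R/(1 - R^2)),
  which is smaller than pi/2.\<close>

lemma cayley_bounds:
  assumes "norm r \<le> R" "R < 1"
  shows "(1 - R) / (1 + R) \<le> Re (cayley r)" "\<bar>Im (cayley r)\<bar> \<le> 2 * R / (1 - R\<^sup>2) * Re (cayley r)"
proof -
  define s where "s = norm r"
  have s: "0 \<le> s" "s \<le> R" "R < 1" using assms by (auto simp: s_def)
  define d where "d = (norm (1 - r))\<^sup>2"
  have ne: "1 - r \<noteq> 0" using assms by auto
  hence d: "d > 0" by (simp add: d_def)
  have d_le: "d \<le> (1 + s)\<^sup>2" unfolding d_def s_def
    by (intro power_mono order_trans[OF norm_triangle_ineq4]) auto
  have s2: "s\<^sup>2 = (Re r)\<^sup>2 + (Im r)\<^sup>2" by (simp add: s_def cmod_power2)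
  have d2: "d = (1 - Re r)\<^sup>2 + (Im r)\<^sup>2" by (simp add: d_def cmod_power2)
  have Re: "Re (cayley r) = (1 - s\<^sup>2) / d"
    by (simp add: cayley_def Re_divide d2 s2) (simp add: power2_eq_square algebra_simps)
  have Im: "Im (cayley r) = 2 * Im r / d"
    by (simp add: cayley_def Im_divide d2) (simp add: power2_eq_square algebra_simps)
  have s1: "1 - s\<^sup>2 \<ge> 1 - R\<^sup>2" using s by (simp add: power_mono)
  have R1: "1 - R\<^sup>2 > 0" using s by (simp add: power_less_one_iff abs_square_less_1)
  have "(1 - R) / (1 + R) \<le> (1 - s) / (1 + s)" using s by (simp add: field_simps)
  also have "\<dots> = (1 - s\<^sup>2) / (1 + s)\<^sup>2" using s by (simp add: divide_simps) (simp add: power2_eq_square algebra_simps)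
  also have "\<dots> \<le> (1 - s\<^sup>2) / d"
  proof (rule divide_left_mono)
    show "0 \<le> 1 - s\<^sup>2" using s1 R1 by linarith
    show "0 < (1 + s)\<^sup>2 * d" using s d by (intro mult_pos_pos zero_less_power) auto
  qed (rule d_le)
  finally show "(1 - R) / (1 + R) \<le> Re (cayley r)" by (simp add: Re)
  have "\<bar>Im r\<bar> \<le> s" by (simp add: s_def abs_Im_le_cmod)
  also have "s \<le> R" by (rule s)
  also have "R * 1 \<le> R * ((1 - s\<^sup>2) / (1 - R\<^sup>2))"
    using s s1 R1 by (intro mult_left_mono) auto
  finally have "\<bar>Im r\<bar> \<le> R * ((1 - s\<^sup>2) / (1 - R\<^sup>2))" by simp
  hence "2 * \<bar>Im r\<bar> / d \<le> 2 * (R * ((1 - s\<^sup>2) / (1 - R\<^sup>2))) / d" using d by (intro divide_right_mono) auto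
  thus "\<bar>Im (cayley r)\<bar> \<le> 2 * R / (1 - R\<^sup>2) * Re (cayley r)"
    using d by (simp add: Re Im abs_mult)
qed

text \<open>For r = tanh(\<theta>/2) this is cosh \<theta> + sinh \<theta> cos p, the kernel of the
  classical Laplace integral. \<open>lap_W'\<close> is its \<theta>-derivative sinh \<theta> + cosh
  \<theta> cos p, and the factor 2/(1 - r^2) in the derivative lemmas is d\<theta>/dr.\<close>

definition lap_W :: "complex \<Rightarrow> real \<Rightarrow> complex" where
  "lap_W r p = (1 + r\<^sup>2 + 2 * r * of_real (cos p)) / (1 - r\<^sup>2)"

definition lap_W' :: "complex \<Rightarrow> real \<Rightarrow> complex" where
  "lap_W' r p = (2 * r + (1 + r\<^sup>2) * of_real (cos p)) / (1 - r\<^sup>2)"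

lemma one_minus_square_nonzero: "norm (r :: complex) < 1 \<Longrightarrow> 1 - r\<^sup>2 \<noteq> 0"
  by (metis norm_one norm_power eq_iff_diff_eq_0 power_one abs_norm_cancel abs_square_less_1 less_irrefl)

text \<open>The weights are nonnegative with sum 1, so half-plane and sector bounds pass from
  \<open>cayley\<close> at r and -r to every p by convexity.\<close>

lemma lap_W_conv_cayley:
  assumes "norm r < 1"
  shows "lap_W r p = of_real ((1 + cos p) / 2) * cayley r + of_real ((1 - cos p) / 2) * cayley (- r)"
proof -
  have ne: "1 - r \<noteq> 0" "1 + r \<noteq> 0" using assms by (auto simp: add_eq_0_iff)
  moreover have "2 + r * 2 \<noteq> 0" using ne(2) by (simp add: add_eq_0_iff) (metis mult_cancel_right1 mult_minus_right neg_equal_iff_equal mult.commute zero_neq_numeral)?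
  moreover have "1 - r\<^sup>2 = (1 - r) * (1 + r)" by (simp add: power2_eq_square algebra_simps)
  ultimately show ?thesis
    by (simp add: lap_W_def cayley_def divide_simps) (simp add: power2_eq_square algebra_simps)
qed

lemma lap_W_bounds:
  assumes "norm r \<le> R" "R < 1"
  shows "(1 - R) / (1 + R) \<le> Re (lap_W r p)" "\<bar>Im (lap_W r p)\<bar> \<le> 2 * R / (1 - R\<^sup>2) * Re (lap_W r p)"
proof -
  define c d where "c = (1 + cos p) / 2" and "d = (1 - cos p) / 2"
  have cd: "c \<ge> 0" "d \<ge> 0" "c + d = 1"
    using cos_ge_minus_one[of p] cos_le_one[of p] unfolding c_def d_def
    by (simp_all add: field_simps del: cos_ge_minus_one cos_le_one)
  have W: "lap_W r p = of_real c * cayley r + of_real d * cayley (- r)"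
    unfolding c_def d_def using assms by (intro lap_W_conv_cayley) auto
  note 1 = cayley_bounds[OF assms]
  have 2: "(1 - R) / (1 + R) \<le> Re (cayley (- r))" "\<bar>Im (cayley (- r))\<bar> \<le> 2 * R / (1 - R\<^sup>2) * Re (cayley (- r))"
    using cayley_bounds[of "- r" R] assms by auto
  have "c * ((1 - R) / (1 + R)) + d * ((1 - R) / (1 + R)) \<le> c * Re (cayley r) + d * Re (cayley (- r))"
    using 1 2 cd by (intro add_mono mult_left_mono) auto
  hence "(1 - R) / (1 + R) \<le> c * Re (cayley r) + d * Re (cayley (- r))"
    by (simp only: cd flip: distrib_right)
  thus "(1 - R) / (1 + R) \<le> Re (lap_W r p)" by (simp add: W)
  have "\<bar>Im (lap_W r p)\<bar> \<le> c * \<bar>Im (cayley r)\<bar> + d * \<bar>Im (cayley (- r))\<bar>"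
    using cd by (simp add: W) (metis abs_mult abs_of_nonneg abs_triangle_ineq)
  also have "\<dots> \<le> c * (2 * R / (1 - R\<^sup>2) * Re (cayley r)) + d * (2 * R / (1 - R\<^sup>2) * Re (cayley (- r)))"
    using 1 2 cd by (intro add_mono mult_left_mono) auto
  also have "\<dots> = 2 * R / (1 - R\<^sup>2) * Re (lap_W r p)" by (simp add: W algebra_simps add_divide_distrib)
  finally show "\<bar>Im (lap_W r p)\<bar> \<le> 2 * R / (1 - R\<^sup>2) * Re (lap_W r p)" .
qed

lemma Re_lap_W_pos: "norm r < 1 \<Longrightarrow> Re (lap_W r p) > 0"
  by (rule less_le_trans[OF _ lap_W_bounds(1)[of r "norm r" p]]) (auto simp: add_pos_nonneg)

lemma lap_W_notin [simp]: "norm r < 1 \<Longrightarrow> lap_W r p \<notin> \<real>\<^sub>\<le>\<^sub>0" "norm r < 1 \<Longrightarrow> lap_W r p \<noteq> 0"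
  using Re_lap_W_pos[of r p] by (auto simp: complex_nonpos_Reals_iff)

text \<open>|w^(-a - it)| = |w|^(-a) exp(t Arg w), and Arg w is at most the half-angle of the
  sector. Because that angle is below pi/2, the growth in t can later be beaten by the decay of
  \<open>dens\<close>.\<close>

lemma norm_lap_W_powr_le:
  assumes "norm r \<le> R" "R < 1" "a \<ge> 0"
  shows "norm (lap_W r p powr (- Complex a t)) \<le>
    ((1 - R) / (1 + R)) powr (- a) * exp (arctan (2 * R / (1 - R\<^sup>2)) * \<bar>t\<bar>)"
proof -
  define w where "w = lap_W r p"
  have R: "0 \<le> R" using assms norm_ge_zero order_trans by blast
  have w: "(1 - R) / (1 + R) \<le> Re w" "\<bar>Im w\<bar> \<le> 2 * R / (1 - R\<^sup>2) * Re w"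
    unfolding w_def by (rule lap_W_bounds[OF assms(1,2)])+
  have pos: "0 < (1 - R) / (1 + R)" using R assms by simp
  have Re: "Re w > 0" using w pos by linarith
  have "\<bar>Im w / Re w\<bar> \<le> 2 * R / (1 - R\<^sup>2)" using w Re by (simp add: abs_divide pos_divide_le_eq)
  hence "\<bar>Arg w\<bar> \<le> arctan (2 * R / (1 - R\<^sup>2))"
    by (simp add: arg_conv_arctan Re abs_arctan arctan_le_iff)
  hence "\<bar>t * Arg w\<bar> \<le> \<bar>t\<bar> * arctan (2 * R / (1 - R\<^sup>2))" by (simp add: abs_mult mult_left_mono)
  hence "exp (t * Arg w) \<le> exp (arctan (2 * R / (1 - R\<^sup>2)) * \<bar>t\<bar>)" by (simp add: mult.commute)
  moreover have "norm w powr (- a) \<le> ((1 - R) / (1 + R)) powr (- a)"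
    using pos w assms order_trans[OF w(1) complex_Re_le_cmod] by (intro powr_mono2') auto
  ultimately show ?thesis
    unfolding norm_powr_complex w_def[symmetric] by (auto intro!: mult_mono)
qed

lemma lap_W_deriv:
  assumes "norm r < 1"
  shows "((\<lambda>r. lap_W r p) has_field_derivative (2 / (1 - r\<^sup>2) * lap_W' r p)) (at r)"
  unfolding lap_W_def[abs_def] lap_W'_def using one_minus_square_nonzero[OF assms]
  by (auto intro!: derivative_eq_intros simp: power2_eq_square field_simps)

lemma lap_W'_deriv:
  assumes "norm r < 1"
  shows "((\<lambda>r. lap_W' r p) has_field_derivative (2 / (1 - r\<^sup>2) * lap_W r p)) (at r)"
  unfolding lap_W'_def[abs_def] lap_W_def using one_minus_square_nonzero[OF assms]
  by (auto intro!: derivative_eq_intros simp: power2_eq_square field_simps)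

lemma lap_W_square_diff:
  assumes "norm r < 1"
  shows "(lap_W r p)\<^sup>2 - (lap_W' r p)\<^sup>2 = of_real (sin p ^ 2)"
proof -
  define c where "c = complex_of_real (cos p)"
  have "of_real (sin p ^ 2) = 1 - c\<^sup>2"
    by (simp add: c_def sin_squared_eq flip: of_real_power)
  thus ?thesis using one_minus_square_nonzero[OF assms]
    unfolding lap_W_def lap_W'_def c_def[symmetric]
    by (simp add: power_divide diff_divide_distrib[symmetric] divide_eq_eq) (simp add: power2_eq_square algebra_simps)
qed

lemma lap_W_lin:
  assumes "norm r < 1"
  shows "(1 + r\<^sup>2) * lap_W' r p - 2 * r * lap_W r p = (1 - r\<^sup>2) * of_real (cos p)"
  using one_minus_square_nonzero[OF assms]
  by (simp add: lap_W_def lap_W'_def divide_simps) (simp add: power2_eq_square algebra_simps)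

lemma continuous_on_lap_W [continuous_intros]:
  "continuous_on (ball 0 1 \<times> A) (\<lambda>x. lap_W (fst x) (snd x))"
  "continuous_on (ball 0 1 \<times> A) (\<lambda>x. lap_W' (fst x) (snd x))"
  unfolding lap_W_def lap_W'_def
proof -
  have *: "1 - (fst x)\<^sup>2 \<noteq> 0" if "x \<in> ball 0 1 \<times> A" for x :: "complex \<times> real"
    using that one_minus_square_nonzero[of "fst x"] by auto
  show "continuous_on (ball 0 1 \<times> A) (\<lambda>x. (1 + (fst x)\<^sup>2 + 2 * fst x * complex_of_real (cos (snd x))) / (1 - (fst x)\<^sup>2))"
    using * by (intro continuous_intros) auto
  show "continuous_on (ball 0 1 \<times> A) (\<lambda>x. (2 * fst x + (1 + (fst x)\<^sup>2) * complex_of_real (cos (snd x))) / (1 - (fst x)\<^sup>2))"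
    using * by (intro continuous_intros) auto
qed

lemma continuous_on_lap_W_powr [continuous_intros]:
  "continuous_on (ball 0 1 \<times> A) (\<lambda>x. lap_W (fst x) (snd x) powr s)"
  by (intro continuous_on_powr_complex continuous_intros) (auto simp: less_imp_le[OF Re_lap_W_pos])

lemma continuous_on_lap_slice:
  assumes "norm r < 1"
  shows "continuous_on A (\<lambda>p. lap_W r p)" "continuous_on A (\<lambda>p. lap_W' r p)"
    "continuous_on A (\<lambda>p. lap_W r p powr s)"
proof -
  have *: "continuous_on A (Pair r)" "Pair r ` A \<subseteq> ball 0 1 \<times> A" using assms by (auto intro!: continuous_intros)
  show "continuous_on A (\<lambda>p. lap_W r p)" "continuous_on A (\<lambda>p. lap_W' r p)"
    "continuous_on A (\<lambda>p. lap_W r p powr s)"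
    using continuous_on_compose2[OF continuous_on_lap_W(1) *] continuous_on_compose2[OF continuous_on_lap_W(2) *]
      continuous_on_compose2[OF continuous_on_lap_W_powr *] by auto
qed

lemma lap_W_powr_deriv:
  assumes "norm r < 1"
  shows "((\<lambda>r. lap_W r p powr s) has_field_derivative (s * lap_W r p powr (s - 1) * (2 / (1 - r\<^sup>2) * lap_W' r p))) (at r)"
  by (rule DERIV_chain2[where f = "\<lambda>z. z powr s" and g = "\<lambda>r. lap_W r p", OF has_field_derivative_powr lap_W_deriv])
     (use assms in auto)

lemma lap_W_mult_powr: "norm r < 1 \<Longrightarrow> lap_W r p * lap_W r p powr (s - 1) = lap_W r p powr s"
  by (simp add: powr_diff)

section \<open>The Laplace integral and its first-order system\<close>

definition lap_weight :: "real \<Rightarrow> real \<Rightarrow> real" where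
  "lap_weight \<beta> p = sin p powr (4 * \<beta> - 2)"

definition lap_exp :: "real \<Rightarrow> real \<Rightarrow> complex" where
  "lap_exp \<beta> t = Complex (2 * \<beta> - 1 / 2) t"

text \<open>With \<rho> = 2\<beta> - 1/2 the exponent is -\<rho> - it and the weight sin^(2\<rho> -
  1): up to normalisation this is the zonal spherical function of hyperbolic space of formal
  dimension 4\<beta>, at distance \<theta>. \<open>lap_int'\<close> is its \<theta>-derivative
  divided by -\<open>lap_exp \<beta> t\<close>.\<close>

definition lap_int :: "real \<Rightarrow> real \<Rightarrow> complex \<Rightarrow> complex" where
  "lap_int \<beta> t r = integral (cbox 0 pi) (\<lambda>p. of_real (lap_weight \<beta> p) * lap_W r p powr (- lap_exp \<beta> t))"

definition lap_int' :: "real \<Rightarrow> real \<Rightarrow> complex \<Rightarrow> complex" where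
  "lap_int' \<beta> t r = integral (cbox 0 pi) (\<lambda>p. of_real (lap_weight \<beta> p) * (lap_W' r p * lap_W r p powr (- lap_exp \<beta> t - 1)))"

lemma continuous_on_lap_weight:
  assumes "1 / 2 < \<beta>"
  shows "continuous_on (cbox 0 pi) (lap_weight \<beta>)"
  unfolding lap_weight_def using assms
  by (intro continuous_on_powr' continuous_intros) (auto intro: sin_ge_zero)

lemma lap_weight_nonneg [simp]: "lap_weight \<beta> p \<ge> 0"
  by (simp add: lap_weight_def)

lemma continuous_on_lap_weight' [continuous_intros]:
  assumes "1 / 2 < \<beta>"
  shows "continuous_on (A \<times> cbox 0 pi) (\<lambda>x. complex_of_real (lap_weight \<beta> (snd x)))"
    "continuous_on (cbox 0 pi) (\<lambda>p. complex_of_real (lap_weight \<beta> p))"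
  by (auto intro!: continuous_intros continuous_on_compose2[OF continuous_on_lap_weight[OF assms]])

lemma integrable_lap_weight_mult:
  fixes h :: "real \<Rightarrow> complex"
  assumes "1 / 2 < \<beta>" "continuous_on (cbox 0 pi) h"
  shows "(\<lambda>p. of_real (lap_weight \<beta> p) * h p) integrable_on cbox 0 pi"
  by (intro integrable_continuous continuous_on_mult continuous_on_lap_weight'(2) assms)

lemma lap_int_deriv:
  assumes "1 / 2 < \<beta>" "norm r < 1"
  shows "(lap_int \<beta> t has_field_derivative (- 2 * lap_exp \<beta> t / (1 - r\<^sup>2) * lap_int' \<beta> t r)) (at r)"
proof -
  define \<mu> where "\<mu> = lap_exp \<beta> t"
  define f' where "f' = (\<lambda>r p. of_real (lap_weight \<beta> p) * (- \<mu> * lap_W r p powr (- \<mu> - 1) * (2 / (1 - r\<^sup>2) * lap_W' r p)))"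
  have "((\<lambda>r. integral (cbox 0 pi) (\<lambda>p. of_real (lap_weight \<beta> p) * lap_W r p powr (- \<mu>))) has_field_derivative
     integral (cbox 0 pi) (f' r)) (at r within ball 0 1)"
  proof (rule leibniz_rule_field_derivative)
    fix x p assume "x \<in> ball (0 :: complex) 1"
    thus "((\<lambda>r. of_real (lap_weight \<beta> p) * lap_W r p powr (- \<mu>)) has_field_derivative f' x p) (at x within ball 0 1)"
      unfolding f'_def by (intro DERIV_cmult has_field_derivative_at_within[OF lap_W_powr_deriv]) auto
  next
    fix x assume "x \<in> ball (0 :: complex) 1"
    thus "(\<lambda>p. of_real (lap_weight \<beta> p) * lap_W x p powr (- \<mu>)) integrable_on cbox 0 pi"
      using assms by (intro integrable_continuous continuous_intros continuous_on_lap_slice) auto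
  next
    have *: "1 - (fst x)\<^sup>2 \<noteq> 0" if "x \<in> ball 0 1 \<times> cbox 0 pi" for x :: "complex \<times> real"
      using that one_minus_square_nonzero[of "fst x"] by auto
    hence "continuous_on (ball 0 1 \<times> cbox 0 pi) (\<lambda>x :: complex \<times> real. 2 / (1 - (fst x)\<^sup>2))"
      by (intro continuous_on_divide continuous_on_diff continuous_on_power continuous_on_const continuous_on_fst continuous_on_id) auto
    thus "continuous_on (ball 0 1 \<times> cbox 0 pi) (\<lambda>(x, p). f' x p)"
      unfolding f'_def split_beta
      by (intro continuous_on_add continuous_on_mult continuous_on_lap_weight'(1) continuous_on_lap_W
          continuous_on_lap_W_powr continuous_on_const assms(1))
  qed (use assms in auto)
  moreover have "lap_int \<beta> t = (\<lambda>r. integral (cbox 0 pi) (\<lambda>p. of_real (lap_weight \<beta> p) * lap_W r p powr (- \<mu>)))"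
    by (intro ext) (simp only: lap_int_def \<mu>_def)
  moreover have "at r within ball 0 1 = at r" using assms by (intro at_within_open) auto
  ultimately have "(lap_int \<beta> t has_field_derivative integral (cbox 0 pi) (f' r)) (at r)"
    by (simp only:)
  also have "f' r = (\<lambda>p. (- 2 * \<mu> / (1 - r\<^sup>2)) * (of_real (lap_weight \<beta> p) * (lap_W' r p * lap_W r p powr (- \<mu> - 1))))"
    by (auto simp: f'_def fun_eq_iff)
  also have "integral (cbox 0 pi) \<dots> = - 2 * \<mu> / (1 - r\<^sup>2) * lap_int' \<beta> t r"
    unfolding integral_mult_right lap_int'_def \<mu>_def ..
  finally show ?thesis by (simp add: \<mu>_def)
qed

text \<open>Integrate the p-derivative of sin^(4\<beta> - 1) p times W^(-\<mu> - 1) over [0, pi],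
  where W is \<open>lap_W r p\<close>; the sine kills both boundary terms. \<open>lap_W_lin\<close>
  then trades cos p for W and \<open>lap_W'\<close>. The identity serves to eliminate the integral
  with W^(-\<mu> - 2) from the derivative of \<open>lap_int'\<close>.\<close>

lemma lap_int_by_parts:
  fixes t :: real
  assumes "1 / 2 < \<beta>" "norm r < 1"
  defines "\<mu> \<equiv> lap_exp \<beta> t"
  shows "2 * r * (\<mu> + 1) * integral (cbox 0 pi) (\<lambda>p. of_real (lap_weight \<beta> p) * (of_real ((sin p)\<^sup>2) * lap_W r p powr (- \<mu> - 2)))
     + of_real (4 * \<beta> - 1) * ((1 + r\<^sup>2) * lap_int' \<beta> t r - 2 * r * lap_int \<beta> t r) = 0"
proof -
  define u where "u = 1 - r\<^sup>2"
  have u: "u \<noteq> 0" using assms one_minus_square_nonzero by (simp add: u_def)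
  define g where "g = (\<lambda>p. complex_of_real (sin p powr (4 * \<beta> - 1)) * lap_W r p powr (- \<mu> - 1))"
  define g' where "g' = (\<lambda>p. of_real ((4 * \<beta> - 1)) * (of_real (lap_weight \<beta> p) * (of_real (cos p) * lap_W r p powr (- \<mu> - 1)))
      + 2 * r / u * (\<mu> + 1) * (of_real (lap_weight \<beta> p) * (of_real ((sin p)\<^sup>2) * lap_W r p powr (- \<mu> - 2))))"
  note cont = continuous_on_lap_slice[OF assms(2)]
  have "(g' has_integral (g pi - g 0)) {0..pi}"
  proof (rule fundamental_theorem_of_calculus_interior)
    have "continuous_on {0..pi} (\<lambda>p. sin p powr (4 * \<beta> - 1))"
      using assms(1) by (intro continuous_on_powr' continuous_on_sin continuous_on_id continuous_on_const) (auto intro: sin_ge_zero)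
    thus "continuous_on {0..pi} g"
      unfolding g_def by (intro continuous_on_mult continuous_on_of_real cont)
  next
    fix p assume p: "p \<in> {0<..<pi}"
    hence sin: "sin p > 0" by (auto intro: sin_gt_zero)
    have "((\<lambda>p. sin p powr (4 * \<beta> - 1)) has_real_derivative (4 * \<beta> - 1) * (lap_weight \<beta> p * cos p)) (at p)"
      using DERIV_chain2[OF has_real_derivative_powr[OF sin] DERIV_sin, of "4 * \<beta> - 1"]
      by (simp add: lap_weight_def mult_ac)
    hence 1: "((\<lambda>p. complex_of_real (sin p powr (4 * \<beta> - 1))) has_vector_derivative of_real ((4 * \<beta> - 1) * (lap_weight \<beta> p * cos p))) (at p)"
      by (intro has_vector_derivative_of_real) (simp add: has_real_derivative_iff_has_vector_derivative)
    have "((\<lambda>p. complex_of_real (cos p)) has_vector_derivative of_real (- sin p)) (at p)"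
      by (intro has_vector_derivative_of_real) (auto intro!: derivative_eq_intros simp flip: has_real_derivative_iff_has_vector_derivative)
    hence "((\<lambda>p. (1 + r\<^sup>2 + 2 * r * complex_of_real (cos p)) / u) has_vector_derivative (2 * r * of_real (- sin p) / u)) (at p)"
      by (auto intro!: derivative_eq_intros)
    hence W: "(lap_W r has_vector_derivative (2 * r * of_real (- sin p) / u)) (at p)"
      by (simp add: lap_W_def[abs_def] u_def)
    have "((\<lambda>z. z powr (- \<mu> - 1)) \<circ> lap_W r has_vector_derivative (2 * r * of_real (- sin p) / u) * ((- \<mu> - 1) * lap_W r p powr (- \<mu> - 1 - 1))) (at p)"
      by (intro field_vector_diff_chain_at W has_field_derivative_powr) (use assms in auto)
    hence 2: "((\<lambda>p. lap_W r p powr (- \<mu> - 1)) has_vector_derivative (2 * r * of_real (- sin p) / u) * ((- \<mu> - 1) * lap_W r p powr (- \<mu> - 1 - 1))) (at p)"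
      by (simp add: o_def)
    have "(g has_vector_derivative of_real (sin p powr (4 * \<beta> - 1)) * ((2 * r * of_real (- sin p) / u) * ((- \<mu> - 1) * lap_W r p powr (- \<mu> - 1 - 1)))
       + of_real ((4 * \<beta> - 1) * (lap_weight \<beta> p * cos p)) * lap_W r p powr (- \<mu> - 1)) (at p)"
      unfolding g_def by (rule has_vector_derivative_mult[OF 1 2])
    also have "sin p powr (4 * \<beta> - 1) = lap_weight \<beta> p * sin p"
      using sin by (simp add: lap_weight_def powr_diff eval_nat_numeral)
    also have "of_real (lap_weight \<beta> p * sin p) * ((2 * r * of_real (- sin p) / u) * ((- \<mu> - 1) * lap_W r p powr (- \<mu> - 1 - 1)))
       + of_real ((4 * \<beta> - 1) * (lap_weight \<beta> p * cos p)) * lap_W r p powr (- \<mu> - 1) = g' p"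
      using u by (simp add: g'_def power2_eq_square field_simps)
    finally show "(g has_vector_derivative g' p) (at p)" .
  qed auto
  moreover have "g pi = 0" "g 0 = 0" by (auto simp: g_def)
  ultimately have "integral (cbox 0 pi) g' = 0" by (simp add: integral_unique)
  have int: "(\<lambda>p. of_real (lap_weight \<beta> p) * (of_real (cos p) * lap_W r p powr (- \<mu> - 1))) integrable_on cbox 0 pi"
    "(\<lambda>p. of_real (lap_weight \<beta> p) * (of_real ((sin p)\<^sup>2) * lap_W r p powr (- \<mu> - 2))) integrable_on cbox 0 pi"
    "(\<lambda>p. of_real (lap_weight \<beta> p) * (lap_W' r p * lap_W r p powr (- \<mu> - 1))) integrable_on cbox 0 pi"
    "(\<lambda>p. of_real (lap_weight \<beta> p) * lap_W r p powr (- \<mu>)) integrable_on cbox 0 pi"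
    by (intro integrable_lap_weight_mult[OF assms(1)] continuous_intros cont)+
  have "0 = of_real (4 * \<beta> - 1) * integral (cbox 0 pi) (\<lambda>p. of_real (lap_weight \<beta> p) * (of_real (cos p) * lap_W r p powr (- \<mu> - 1)))
     + 2 * r / u * (\<mu> + 1) * integral (cbox 0 pi) (\<lambda>p. of_real (lap_weight \<beta> p) * (of_real ((sin p)\<^sup>2) * lap_W r p powr (- \<mu> - 2)))"
    (is "_ = _ * ?Ic + _ * ?Is")
    unfolding \<open>integral (cbox 0 pi) g' = 0\<close>[symmetric] g'_def integral_mult_right[symmetric]
    using int by (intro integral_add integrable_on_mult_right) auto
  note zero = this
  have key: "0 = q * (u * I) + 2 * r * m * J" if "0 = q * I + 2 * r / u * m * J" for q I m J
  proof -
    have "q * (u * I) + 2 * r * m * J = (q * I + 2 * r / u * m * J) * u" using u by (simp add: field_simps)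
    thus ?thesis by (simp only: that[symmetric] mult_zero_left)
  qed
  have "0 = of_real (4 * \<beta> - 1) * (u * ?Ic) + 2 * r * (\<mu> + 1) * ?Is"
    by (rule key[OF zero])
  also have "u * ?Ic = integral (cbox 0 pi) (\<lambda>p. (1 + r\<^sup>2) * (of_real (lap_weight \<beta> p) * (lap_W' r p * lap_W r p powr (- \<mu> - 1)))
      - 2 * r * (of_real (lap_weight \<beta> p) * lap_W r p powr (- \<mu>)))"
    unfolding integral_mult_right[symmetric]
  proof (intro integral_cong)
    fix p
    have "(1 + r\<^sup>2) * (of_real (lap_weight \<beta> p) * (lap_W' r p * lap_W r p powr (- \<mu> - 1)))
      - 2 * r * (of_real (lap_weight \<beta> p) * (lap_W r p * lap_W r p powr (- \<mu> - 1))) =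
      of_real (lap_weight \<beta> p) * lap_W r p powr (- \<mu> - 1) * ((1 + r\<^sup>2) * lap_W' r p - 2 * r * lap_W r p)"
      by (simp add: algebra_simps)
    thus "u * (of_real (lap_weight \<beta> p) * (of_real (cos p) * lap_W r p powr (- \<mu> - 1))) =
      (1 + r\<^sup>2) * (of_real (lap_weight \<beta> p) * (lap_W' r p * lap_W r p powr (- \<mu> - 1)))
      - 2 * r * (of_real (lap_weight \<beta> p) * lap_W r p powr (- \<mu>))"
      unfolding lap_W_mult_powr[OF assms(2)] lap_W_lin[OF assms(2)] u_def by (simp add: mult_ac)
  qed
  also have "\<dots> = (1 + r\<^sup>2) * lap_int' \<beta> t r - 2 * r * lap_int \<beta> t r"
    unfolding lap_int_def lap_int'_def \<mu>_def[symmetric] integral_mult_right[symmetric]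
    using int by (intro integral_diff integrable_on_mult_right)
  finally show ?thesis by (simp add: add.commute)
qed

text \<open>Differentiation under the integral produces the square of \<open>lap_W'\<close>, which
  \<open>lap_W_square_diff\<close> replaces by the square of \<open>lap_W\<close> minus sin^2;
  integration by parts removes the sin^2 term. The factor r is kept on the left so that the relation
  also covers the singular point r = 0.\<close>

lemma lap_int'_deriv:
  assumes "1 / 2 < \<beta>" "norm r < 1"
  obtains D where "(lap_int' \<beta> t has_field_derivative D) (at r)"
    "r * (1 - r\<^sup>2) * D = 2 * (of_real (4 * \<beta> - 1) - lap_exp \<beta> t) * r * lap_int \<beta> t r
       - of_real (4 * \<beta> - 1) * (1 + r\<^sup>2) * lap_int' \<beta> t r"
proof -
  define \<mu> where "\<mu> = lap_exp \<beta> t"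
  define f' where "f' = (\<lambda>r p. of_real (lap_weight \<beta> p) *
     (lap_W' r p * ((- \<mu> - 1) * lap_W r p powr (- \<mu> - 1 - 1) * (2 / (1 - r\<^sup>2) * lap_W' r p)) +
      (2 / (1 - r\<^sup>2) * lap_W r p) * lap_W r p powr (- \<mu> - 1)))"
  define I2 where "I2 = integral (cbox 0 pi) (\<lambda>p. of_real (lap_weight \<beta> p) * (of_real ((sin p)\<^sup>2) * lap_W r p powr (- \<mu> - 2)))"
  note cont = continuous_on_lap_slice[OF assms(2)]
  define D where "D = integral (cbox 0 pi) (f' r)"
  have "((\<lambda>r. integral (cbox 0 pi) (\<lambda>p. of_real (lap_weight \<beta> p) * (lap_W' r p * lap_W r p powr (- \<mu> - 1)))) has_field_derivative
     integral (cbox 0 pi) (f' r)) (at r within ball 0 1)"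
  proof (rule leibniz_rule_field_derivative)
    fix x p assume "x \<in> ball (0 :: complex) 1"
    thus "((\<lambda>r. of_real (lap_weight \<beta> p) * (lap_W' r p * lap_W r p powr (- \<mu> - 1))) has_field_derivative f' x p) (at x within ball 0 1)"
      unfolding f'_def by (intro DERIV_cmult DERIV_mult' has_field_derivative_at_within[OF lap_W_powr_deriv]
          has_field_derivative_at_within[OF lap_W'_deriv]) auto
  next
    fix x assume "x \<in> ball (0 :: complex) 1"
    thus "(\<lambda>p. of_real (lap_weight \<beta> p) * (lap_W' x p * lap_W x p powr (- \<mu> - 1))) integrable_on cbox 0 pi"
      using assms by (intro integrable_continuous continuous_intros continuous_on_lap_slice) auto
  next
    have *: "1 - (fst x)\<^sup>2 \<noteq> 0" if "x \<in> ball 0 1 \<times> cbox 0 pi" for x :: "complex \<times> real"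
      using that one_minus_square_nonzero[of "fst x"] by auto
    hence "continuous_on (ball 0 1 \<times> cbox 0 pi) (\<lambda>x :: complex \<times> real. 2 / (1 - (fst x)\<^sup>2))"
      by (intro continuous_on_divide continuous_on_diff continuous_on_power continuous_on_const continuous_on_fst continuous_on_id) auto
    thus "continuous_on (ball 0 1 \<times> cbox 0 pi) (\<lambda>(x, p). f' x p)"
      unfolding f'_def split_beta
      by (intro continuous_on_add continuous_on_mult continuous_on_lap_weight'(1) continuous_on_lap_W
          continuous_on_lap_W_powr continuous_on_const assms(1))
  qed (use assms in auto)
  moreover have "lap_int' \<beta> t = (\<lambda>r. integral (cbox 0 pi) (\<lambda>p. of_real (lap_weight \<beta> p) * (lap_W' r p * lap_W r p powr (- \<mu> - 1))))"
    by (intro ext) (simp only: lap_int'_def \<mu>_def)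
  moreover have "at r within ball 0 1 = at r" using assms by (intro at_within_open) auto
  ultimately have D: "(lap_int' \<beta> t has_field_derivative D) (at r)"
    by (simp only: D_def)
  have f': "f' r p = 2 / (1 - r\<^sup>2) * (- \<mu> * (of_real (lap_weight \<beta> p) * lap_W r p powr (- \<mu>))
         + (\<mu> + 1) * (of_real (lap_weight \<beta> p) * (of_real ((sin p)\<^sup>2) * lap_W r p powr (- \<mu> - 2))))" for p
  proof -
    have sq: "(lap_W' r p)\<^sup>2 = (lap_W r p)\<^sup>2 - of_real ((sin p)\<^sup>2)"
      using lap_W_square_diff[OF assms(2), of p] by (simp add: algebra_simps)
    define w where "w = lap_W r p powr (- \<mu> - 2)"
    have w: "lap_W r p powr (- \<mu> - 1) = lap_W r p * w" "lap_W r p powr (- \<mu>) = (lap_W r p)\<^sup>2 * w"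
      "lap_W r p powr (- \<mu> - 1 - 1) = w"
      using lap_W_mult_powr[OF assms(2), of p "- \<mu> - 1"] lap_W_mult_powr[OF assms(2), of p "- \<mu>"]
      by (auto simp: w_def power2_eq_square algebra_simps)
    define k where "k = 2 / (1 - r\<^sup>2)"
    have "f' r p = k * of_real (lap_weight \<beta> p) * w * ((- \<mu> - 1) * (lap_W' r p)\<^sup>2 + (lap_W r p)\<^sup>2)"
      unfolding f'_def w k_def[symmetric] by (simp add: power2_eq_square algebra_simps)
    thus ?thesis unfolding sq w w_def[symmetric] k_def[symmetric] by (simp add: algebra_simps)
  qed
  have "D = integral (cbox 0 pi) (\<lambda>p. 2 / (1 - r\<^sup>2) * (- \<mu> * (of_real (lap_weight \<beta> p) * lap_W r p powr (- \<mu>))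
         + (\<mu> + 1) * (of_real (lap_weight \<beta> p) * (of_real ((sin p)\<^sup>2) * lap_W r p powr (- \<mu> - 2)))))"
    unfolding D_def by (intro integral_cong f')
  also have "\<dots> = 2 / (1 - r\<^sup>2) * integral (cbox 0 pi) (\<lambda>p. - \<mu> * (of_real (lap_weight \<beta> p) * lap_W r p powr (- \<mu>))
         + (\<mu> + 1) * (of_real (lap_weight \<beta> p) * (of_real ((sin p)\<^sup>2) * lap_W r p powr (- \<mu> - 2))))"
    by (rule integral_mult_right)
  also have "\<dots> = 2 / (1 - r\<^sup>2) * (- \<mu> * lap_int \<beta> t r + (\<mu> + 1) * I2)"
  proof -
    have "(\<lambda>p. - \<mu> * (of_real (lap_weight \<beta> p) * lap_W r p powr (- \<mu>))) integrable_on cbox 0 pi"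
      "(\<lambda>p. (\<mu> + 1) * (of_real (lap_weight \<beta> p) * (of_real ((sin p)\<^sup>2) * lap_W r p powr (- \<mu> - 2)))) integrable_on cbox 0 pi"
      by (intro integrable_on_mult_right integrable_lap_weight_mult[OF assms(1)] continuous_intros cont)+
    note integral_add[OF this]
    thus ?thesis unfolding lap_int_def I2_def \<mu>_def[symmetric] by (simp only: integral_mult_right)
  qed
  finally have "(1 - r\<^sup>2) * D = 2 * (- \<mu> * lap_int \<beta> t r + (\<mu> + 1) * I2)"
    using one_minus_square_nonzero[OF assms(2)] by (simp add: field_simps)
  hence "r * (1 - r\<^sup>2) * D = r * (2 * (- \<mu> * lap_int \<beta> t r + (\<mu> + 1) * I2))"
    by (simp only: mult.assoc)
  also have "\<dots> = - 2 * \<mu> * r * lap_int \<beta> t r + 2 * r * (\<mu> + 1) * I2"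
    by (simp add: algebra_simps)
  also have "2 * r * (\<mu> + 1) * I2 = - (of_real (4 * \<beta> - 1) * ((1 + r\<^sup>2) * lap_int' \<beta> t r - 2 * r * lap_int \<beta> t r))"
    using lap_int_by_parts[OF assms, of t] unfolding I2_def \<mu>_def by (simp add: eq_neg_iff_add_eq_0)
  finally have "r * (1 - r\<^sup>2) * D = 2 * (of_real (4 * \<beta> - 1) - lap_exp \<beta> t) * r * lap_int \<beta> t r
       - of_real (4 * \<beta> - 1) * (1 + r\<^sup>2) * lap_int' \<beta> t r"
    by (simp add: \<mu>_def algebra_simps)
  with D show ?thesis by (rule that)
qed

section \<open>The generating function\<close>

lemma Re_one_minus_square_pos:
  fixes r :: complex
  assumes "norm r < 1" shows "Re (1 - r\<^sup>2) > 0"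
proof -
  have "Re (r\<^sup>2) \<le> norm (r\<^sup>2)" by (rule complex_Re_le_cmod)
  also have "\<dots> < 1" using assms by (simp add: norm_power power_less_one_iff)
  finally show ?thesis by simp
qed

lemma one_minus_square_notin: "norm (r :: complex) < 1 \<Longrightarrow> 1 - r\<^sup>2 \<notin> \<real>\<^sub>\<le>\<^sub>0"
  using Re_one_minus_square_pos[of r] by (simp add: complex_nonpos_Reals_iff)

text \<open>Up to the factor \<open>lap_norm \<beta>\<close> this is \<psi> at x = r^2: the
  quadratic substitution and the power of 1 - x turn the spherical function into the generating
  function of the P_n.\<close>

definition hahn_gf :: "real \<Rightarrow> real \<Rightarrow> complex \<Rightarrow> complex" where
  "hahn_gf \<beta> t r = (1 - r\<^sup>2) powr (- of_real \<beta>) * lap_int \<beta> t r"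

definition hahn_gf' :: "real \<Rightarrow> real \<Rightarrow> complex \<Rightarrow> complex" where
  "hahn_gf' \<beta> t r = (1 - r\<^sup>2) powr (- of_real \<beta>) * lap_int' \<beta> t r"

lemma one_minus_square_powr_deriv:
  fixes r :: complex
  assumes "norm r < 1"
  shows "((\<lambda>r. (1 - r\<^sup>2) powr s) has_field_derivative (s * (1 - r\<^sup>2) powr (s - 1) * (- 2 * r))) (at r)"
proof (rule DERIV_chain2[where f = "\<lambda>z. z powr s" and g = "\<lambda>r. 1 - r\<^sup>2"])
  show "((\<lambda>z. z powr s) has_field_derivative s * (1 - r\<^sup>2) powr (s - 1)) (at (1 - r\<^sup>2))"
    by (intro has_field_derivative_powr one_minus_square_notin assms)
  show "((\<lambda>r. 1 - r\<^sup>2) has_field_derivative - 2 * r) (at r)"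
    by (auto intro!: derivative_eq_intros)
qed

lemma hahn_gf_deriv:
  assumes "1 / 2 < \<beta>" "norm r < 1"
  obtains D where "(hahn_gf \<beta> t has_field_derivative D) (at r)"
    "(1 - r\<^sup>2) * D = - 2 * lap_exp \<beta> t * hahn_gf' \<beta> t r + 2 * of_real \<beta> * (r * hahn_gf \<beta> t r)"
proof -
  define u where "u = 1 - r\<^sup>2"
  have u: "u \<noteq> 0" using one_minus_square_nonzero[OF assms(2)] by (simp add: u_def)
  define p where "p = u powr (- of_real \<beta>)"
  define D where "D = - of_real \<beta> * u powr (- of_real \<beta> - 1) * (- 2 * r) * lap_int \<beta> t r +
     p * (- 2 * lap_exp \<beta> t / u * lap_int' \<beta> t r)"
  have "(hahn_gf \<beta> t has_field_derivative D) (at r)"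
    using DERIV_mult'[OF one_minus_square_powr_deriv[OF assms(2), of "- of_real \<beta>"] lap_int_deriv[OF assms, of t]]
    unfolding hahn_gf_def[abs_def] by (simp add: D_def u_def p_def add.commute)
  moreover have "u powr (- of_real \<beta> - 1) = p / u" using u by (simp add: powr_diff p_def)
  hence "u * D = - 2 * lap_exp \<beta> t * (p * lap_int' \<beta> t r) + 2 * of_real \<beta> * (r * (p * lap_int \<beta> t r))"
    using u by (simp add: D_def right_diff_distrib)
  ultimately show ?thesis
    by (intro that[of D]) (simp_all add: hahn_gf_def hahn_gf'_def u_def p_def)
qed

lemma hahn_gf'_deriv:
  assumes "1 / 2 < \<beta>" "norm r < 1"
  obtains D where "(hahn_gf' \<beta> t has_field_derivative D) (at r)"
    "r * ((1 - r\<^sup>2) * D) = 2 * (of_real (4 * \<beta> - 1) - lap_exp \<beta> t) * (r * hahn_gf \<beta> t r)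
       - of_real (4 * \<beta> - 1) * ((1 + r\<^sup>2) * hahn_gf' \<beta> t r) + 2 * of_real \<beta> * (r\<^sup>2 * hahn_gf' \<beta> t r)"
proof -
  define u where "u = 1 - r\<^sup>2"
  have u: "u \<noteq> 0" using one_minus_square_nonzero[OF assms(2)] by (simp add: u_def)
  define p where "p = u powr (- of_real \<beta>)"
  obtain d where d: "(lap_int' \<beta> t has_field_derivative d) (at r)"
    "r * (1 - r\<^sup>2) * d = 2 * (of_real (4 * \<beta> - 1) - lap_exp \<beta> t) * r * lap_int \<beta> t r
       - of_real (4 * \<beta> - 1) * (1 + r\<^sup>2) * lap_int' \<beta> t r"
    using lap_int'_deriv[OF assms] .
  define D where "D = - of_real \<beta> * u powr (- of_real \<beta> - 1) * (- 2 * r) * lap_int' \<beta> t r + p * d"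
  have "(hahn_gf' \<beta> t has_field_derivative D) (at r)"
    using DERIV_mult'[OF one_minus_square_powr_deriv[OF assms(2), of "- of_real \<beta>"] d(1)]
    unfolding hahn_gf'_def[abs_def] by (simp add: D_def u_def p_def add.commute)
  moreover have "u powr (- of_real \<beta> - 1) = p / u" using u by (simp add: powr_diff p_def)
  hence "r * (u * D) = 2 * of_real \<beta> * (r\<^sup>2 * (p * lap_int' \<beta> t r)) + p * (r * u * d)"
    using u by (simp add: D_def distrib_left power2_eq_square)
  hence "r * (u * D) = 2 * (of_real (4 * \<beta> - 1) - lap_exp \<beta> t) * (r * (p * lap_int \<beta> t r))
       - of_real (4 * \<beta> - 1) * ((1 + r\<^sup>2) * (p * lap_int' \<beta> t r)) + 2 * of_real \<beta> * (r\<^sup>2 * (p * lap_int' \<beta> t r))"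
    unfolding d(2)[folded u_def] by (simp add: right_diff_distrib mult_ac)
  ultimately show ?thesis
    by (intro that[of D]) (simp_all add: hahn_gf_def hahn_gf'_def u_def p_def)
qed

lemma hahn_gf_holomorphic:
  assumes "1 / 2 < \<beta>"
  shows "hahn_gf \<beta> t holomorphic_on ball 0 1" "hahn_gf' \<beta> t holomorphic_on ball 0 1"
proof -
  show "hahn_gf \<beta> t holomorphic_on ball 0 1"
    by (rule holomorphic_onI, rule field_differentiable_at_within, unfold field_differentiable_def)
       (metis assms hahn_gf_deriv mem_ball_0)
  show "hahn_gf' \<beta> t holomorphic_on ball 0 1"
    by (rule holomorphic_onI, rule field_differentiable_at_within, unfold field_differentiable_def)
       (metis assms hahn_gf'_deriv mem_ball_0)
qed

definition lap_norm :: "real \<Rightarrow> real" where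
  "lap_norm \<beta> = integral (cbox 0 pi) (lap_weight \<beta>)"

lemma lap_weight_integrable: "1 / 2 < \<beta> \<Longrightarrow> lap_weight \<beta> integrable_on cbox 0 pi"
  by (intro integrable_continuous continuous_on_lap_weight)

lemma lap_norm_pos:
  assumes "1 / 2 < \<beta>"
  shows "lap_norm \<beta> > 0"
proof -
  have "lap_norm \<beta> \<ge> 0" unfolding lap_norm_def by (intro integral_nonneg lap_weight_integrable assms) auto
  moreover have "lap_norm \<beta> \<noteq> 0"
  proof
    assume "lap_norm \<beta> = 0"
    hence "\<forall>p\<in>{0..pi}. lap_weight \<beta> p = 0"
      using integral_eq_0_iff[of 0 pi "lap_weight \<beta>"] continuous_on_lap_weight[OF assms]
      by (auto simp: lap_norm_def)
    from this[rule_format, of "pi / 2"] show False by (simp add: lap_weight_def)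
  qed
  ultimately show ?thesis by linarith
qed

lemma hahn_gf_0:
  assumes "1 / 2 < \<beta>"
  shows "hahn_gf \<beta> t 0 = of_real (lap_norm \<beta>)"
proof -
  have "hahn_gf \<beta> t 0 = integral (cbox 0 pi) (\<lambda>p. of_real (lap_weight \<beta> p))"
    by (simp add: hahn_gf_def lap_int_def lap_W_def)
  also have "\<dots> = of_real (lap_norm \<beta>)"
    using has_integral_of_real[OF integrable_integral[OF lap_weight_integrable[OF assms]]]
    unfolding lap_norm_def by (rule integral_unique)
  finally show ?thesis .
qed

text \<open>The first-order system for \<^const>\<open>hahn_gf\<close> and \<^const>\<open>hahn_gf'\<close> becomes a recurrence for
  the Taylor coefficients, which is that of the polynomials \<^const>\<open>hahn_poly\<close>.\<close>

lemma hahn_gf_coeffs: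
  fixes t :: real
  assumes \<beta>: "1 / 2 < \<beta>" "\<beta> < 1"
  defines "l \<equiv> - (t\<^sup>2 + (\<beta> - 1 / 2)\<^sup>2)"
  defines "F0 \<equiv> fps_expansion (hahn_gf \<beta> t) 0"
  shows "fps_nth F0 (2 * m) = of_real (lap_norm \<beta> * hahn_poly \<beta> m l)" "fps_nth F0 (2 * m + 1) = 0"
proof -
  define F1 where "F1 = fps_expansion (hahn_gf' \<beta> t) 0"
  define \<mu> q b where "\<mu> = lap_exp \<beta> t" and "q = complex_of_real (4 * \<beta> - 1)" and "b = complex_of_real \<beta>"
  define N where "N = complex_of_real (lap_norm \<beta>)"
  have F0: "hahn_gf \<beta> t has_fps_expansion F0"
    unfolding F0_def by (rule has_fps_expansion_fps_expansion[of "ball 0 1"]) (auto intro: hahn_gf_holomorphic \<beta>)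
  have F1: "hahn_gf' \<beta> t has_fps_expansion F1"
    unfolding F1_def by (rule has_fps_expansion_fps_expansion[of "ball 0 1"]) (auto intro: hahn_gf_holomorphic \<beta>)
  have nhds: "eventually (\<lambda>r :: complex. r \<in> ball 0 1) (nhds 0)"
    by (intro eventually_nhds_in_open) auto
  have eq1: "(1 - fps_X ^ 2) * fps_deriv F0 = fps_const (- 2 * \<mu>) * F1 + fps_const (2 * b) * (fps_X * F0)"
  proof (rule fps_expansion_unique_complex)
    show "(\<lambda>r. (1 - r ^ 2) * deriv (hahn_gf \<beta> t) r) has_fps_expansion (1 - fps_X ^ 2) * fps_deriv F0"
      by (intro fps_expansion_intros F0)
    have "(\<lambda>r. (- 2 * \<mu>) * hahn_gf' \<beta> t r + 2 * b * (r * hahn_gf \<beta> t r)) has_fps_expansion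
       fps_const (- 2 * \<mu>) * F1 + fps_const (2 * b) * (fps_X * F0)"
      by (intro fps_expansion_intros F0 F1)
    also have "?this \<longleftrightarrow> (\<lambda>r. (1 - r ^ 2) * deriv (hahn_gf \<beta> t) r) has_fps_expansion
       fps_const (- 2 * \<mu>) * F1 + fps_const (2 * b) * (fps_X * F0)"
    proof (rule has_fps_expansion_cong)
      show "eventually (\<lambda>r. (- 2 * \<mu>) * hahn_gf' \<beta> t r + 2 * b * (r * hahn_gf \<beta> t r) =
           (1 - r ^ 2) * deriv (hahn_gf \<beta> t) r) (nhds 0)"
        using nhds
      proof eventually_elim
        case (elim r)
        then obtain D where "(hahn_gf \<beta> t has_field_derivative D) (at r)"
          "(1 - r\<^sup>2) * D = - 2 * lap_exp \<beta> t * hahn_gf' \<beta> t r + 2 * of_real \<beta> * (r * hahn_gf \<beta> t r)"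
          using hahn_gf_deriv[OF \<beta>(1), of r t] by auto
        thus ?case by (simp add: DERIV_imp_deriv \<mu>_def b_def)
      qed
    qed auto
    finally show "(\<lambda>r. (1 - r ^ 2) * deriv (hahn_gf \<beta> t) r) has_fps_expansion
       fps_const (- 2 * \<mu>) * F1 + fps_const (2 * b) * (fps_X * F0)" .
  qed
  have eq2: "fps_X * ((1 - fps_X ^ 2) * fps_deriv F1) = fps_const (2 * (q - \<mu>)) * (fps_X * F0)
     - fps_const q * ((1 + fps_X ^ 2) * F1) + fps_const (2 * b) * (fps_X ^ 2 * F1)"
  proof (rule fps_expansion_unique_complex)
    show "(\<lambda>r. r * ((1 - r ^ 2) * deriv (hahn_gf' \<beta> t) r)) has_fps_expansion fps_X * ((1 - fps_X ^ 2) * fps_deriv F1)"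
      by (intro fps_expansion_intros F1)
    have "(\<lambda>r. 2 * (q - \<mu>) * (r * hahn_gf \<beta> t r) - q * ((1 + r ^ 2) * hahn_gf' \<beta> t r) + 2 * b * (r ^ 2 * hahn_gf' \<beta> t r)) has_fps_expansion
       fps_const (2 * (q - \<mu>)) * (fps_X * F0) - fps_const q * ((1 + fps_X ^ 2) * F1) + fps_const (2 * b) * (fps_X ^ 2 * F1)"
      by (intro fps_expansion_intros F0 F1)
    also have "?this \<longleftrightarrow> (\<lambda>r. r * ((1 - r ^ 2) * deriv (hahn_gf' \<beta> t) r)) has_fps_expansion
       fps_const (2 * (q - \<mu>)) * (fps_X * F0) - fps_const q * ((1 + fps_X ^ 2) * F1) + fps_const (2 * b) * (fps_X ^ 2 * F1)"
    proof (rule has_fps_expansion_cong)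
      show "eventually (\<lambda>r. 2 * (q - \<mu>) * (r * hahn_gf \<beta> t r) - q * ((1 + r ^ 2) * hahn_gf' \<beta> t r) + 2 * b * (r ^ 2 * hahn_gf' \<beta> t r) =
           r * ((1 - r ^ 2) * deriv (hahn_gf' \<beta> t) r)) (nhds 0)"
        using nhds
      proof eventually_elim
        case (elim r)
        then obtain D where "(hahn_gf' \<beta> t has_field_derivative D) (at r)"
          "r * ((1 - r\<^sup>2) * D) = 2 * (of_real (4 * \<beta> - 1) - lap_exp \<beta> t) * (r * hahn_gf \<beta> t r)
       - of_real (4 * \<beta> - 1) * ((1 + r\<^sup>2) * hahn_gf' \<beta> t r) + 2 * of_real \<beta> * (r\<^sup>2 * hahn_gf' \<beta> t r)"
          using hahn_gf'_deriv[OF \<beta>(1), of r t] by auto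
        thus ?case by (simp only: DERIV_imp_deriv \<mu>_def b_def q_def)
      qed
    qed auto
    finally show "(\<lambda>r. r * ((1 - r ^ 2) * deriv (hahn_gf' \<beta> t) r)) has_fps_expansion
       fps_const (2 * (q - \<mu>)) * (fps_X * F0) - fps_const q * ((1 + fps_X ^ 2) * F1) + fps_const (2 * b) * (fps_X ^ 2 * F1)" .
  qed
  define e g where "e = fps_nth F0" and "g = fps_nth F1"
  have X2: "fps_nth (fps_X ^ 2 * f) n = (if n < 2 then 0 else fps_nth f (n - 2))" for f :: "complex fps" and n
    by (rule fps_X_power_mult_nth)
  have "fps_nth ((1 - fps_X ^ 2) * fps_deriv F0) n = fps_nth (fps_const (- 2 * \<mu>) * F1 + fps_const (2 * b) * (fps_X * F0)) n" for n
    by (simp only: eq1)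
  hence eq1n: "of_nat (n + 1) * e (n + 1) - (if n < 2 then 0 else of_nat (n - 2 + 1) * e (n - 2 + 1)) =
      - 2 * \<mu> * g n + 2 * b * (if n = 0 then 0 else e (n - 1))" for n
    unfolding left_diff_distrib mult_1_left fps_sub_nth fps_add_nth fps_mult_left_const_nth X2 fps_X_mult_nth fps_deriv_nth
    by (simp only: e_def g_def) 
  have "fps_nth (fps_X * ((1 - fps_X ^ 2) * fps_deriv F1)) n = fps_nth (fps_const (2 * (q - \<mu>)) * (fps_X * F0)
     - fps_const q * ((1 + fps_X ^ 2) * F1) + fps_const (2 * b) * (fps_X ^ 2 * F1)) n" for n
    by (simp only: eq2)
  hence eq2n: "(if n = 0 then 0 else of_nat (n - 1 + 1) * g (n - 1 + 1) - (if n - 1 < 2 then 0 else of_nat (n - 1 - 2 + 1) * g (n - 1 - 2 + 1))) =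
      2 * (q - \<mu>) * (if n = 0 then 0 else e (n - 1)) - q * (g n + (if n < 2 then 0 else g (n - 2)))
      + 2 * b * (if n < 2 then 0 else g (n - 2))" for n
    unfolding left_diff_distrib distrib_right mult_1_left fps_sub_nth fps_add_nth fps_mult_left_const_nth X2 fps_X_mult_nth fps_deriv_nth
    by (simp only: e_def g_def)
  have q: "q = 4 * b - 1" by (simp add: q_def b_def)
  have e1: "e 1 = - 2 * \<mu> * g 0" using eq1n[of 0] by simp
  have eS: "of_nat (n + 2) * e (n + 2) = (of_nat n + 2 * b) * e n - 2 * \<mu> * g (n + 1)" for n
    using eq1n[of "n + 1"] by (cases n) (simp_all add: algebra_simps)
  have qn: "of_nat n + q \<noteq> 0" for n
  proof -
    have "Re (of_nat n + q) > 0" using \<beta> by (simp add: q_def)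
    thus ?thesis by (metis less_irrefl zero_complex.sel(1))
  qed
  have g0: "g 0 = 0"
    using eq2n[of 0] qn[of 0] by simp
  have g1: "(1 + q) * g 1 = 2 * (q - \<mu>) * e 0"
    using eq2n[of 1] by (simp add: algebra_simps)
  have gS: "(of_nat (n + 2) + q) * g (n + 2) = (of_nat n + 2 * b - q) * g n + 2 * (q - \<mu>) * e (n + 1)" for n
    using eq2n[of "n + 2"] by (cases n) (simp_all add: algebra_simps)
  \<comment> \<open>Each relation links e and g at indices of opposite parity, so e at odd and g at
    even indices form a closed system, started by g 0 = 0: \<open>hahn_gf\<close> is even and
    \<open>hahn_gf'\<close> odd.\<close>
  have parity: "e (2 * m + 1) = 0 \<and> g (2 * m) = 0" for m
  proof (induction m)
    case 0
    show ?case using e1 g0 by simp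
  next
    case (Suc m)
    have "(of_nat (2 * m + 2) + q) * g (2 * m + 2) = 0" using gS[of "2 * m"] Suc by simp
    hence g: "g (2 * m + 2) = 0" using qn[of "2 * m + 2"] by (simp only: mult_eq_0_iff) blast
    have "of_nat (2 * m + 1 + 2) * e (2 * m + 1 + 2) = 0"
      using eS[of "2 * m + 1"] Suc g by (simp add: add.assoc del: of_nat_add)
    moreover have "(of_nat (2 * m + 1 + 2) :: complex) \<noteq> 0" by (simp only: of_nat_eq_0_iff)
    ultimately have "e (2 * m + 1 + 2) = 0" by (metis mult_eq_0_iff)
    thus ?case using g by (simp add: add_ac numeral_eq_Suc)
  qed
  \<comment> \<open>Since q - \<mu> is the conjugate of \<mu>, the product \<mu> (q - \<mu>) is the
    real number t^2 + (2\<beta> - 1/2)^2. This is where the spectral parameter t becomes the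
    eigenvalue l.\<close>
  have lam: "complex_of_real l = - \<mu> * (q - \<mu>) + b * (3 * b - 1)"
    by (simp add: l_def \<mu>_def q_def b_def lap_exp_def complex_eq_iff power2_eq_square algebra_simps)
  define P where "P = (\<lambda>m. complex_of_real (hahn_poly \<beta> m l))"
  have ladder_Suc: "(of_nat m + 2) * (of_nat m + 1 + 2 * b) * P (Suc (Suc m)) - (of_nat m + 1 + b) * (of_nat m + 2 - b) * P (Suc m)
      - ((of_nat m + 1) * (of_nat m + 2 * b) * P (Suc m) - (of_nat m + b) * (of_nat m + 1 - b) * P m) = of_real l * P (Suc m)" for m
    using arg_cong[OF hahn_ladder_Suc[of \<beta> m l], of complex_of_real] \<beta>
    unfolding hahn_ladder_def P_def b_def by (simp add: algebra_simps)
  have P1: "2 * b * P 1 = b * (1 - b) + of_real l"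
    using arg_cong[OF hahn_ladder_0[of \<beta> l], of complex_of_real] \<beta>
    unfolding hahn_ladder_def P_def b_def by (simp add: algebra_simps)
  have b0: "b \<noteq> 0" using \<beta> by (simp add: b_def)
  have e0: "e 0 = N"
    using hahn_gf_0[OF \<beta>(1), of t] has_fps_expansion_imp_0_eq_fps_nth_0[OF F0] by (simp add: e_def N_def)
  \<comment> \<open>Solving the first relation for g eliminates it from the second and leaves a
    recurrence in the even coefficients alone.\<close>
  have mug: "\<mu> * g (2 * m + 1) = (of_nat m + b) * e (2 * m) - (of_nat m + 1) * e (2 * m + 2)" for m
  proof -
    have "2 * (\<mu> * g (2 * m + 1)) = 2 * ((of_nat m + b) * e (2 * m) - (of_nat m + 1) * e (2 * m + 2))"
      using eS[of "2 * m"] by (simp add: algebra_simps)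
    thus ?thesis by (simp only: mult_cancel_left) simp
  qed
  \<comment> \<open>That recurrence is of second order, hence two consecutive values in the
    induction.\<close>
  have main: "e (2 * m) = N * P m \<and> e (2 * m + 2) = N * P (Suc m)" for m
  proof (induction m)
    case 0
    have "4 * b * g 1 = 2 * (q - \<mu>) * N" using g1 e0 by (simp add: q)
    from arg_cong[OF this, of "\<lambda>x. \<mu> * x"]
    have "2 * (2 * b * (\<mu> * g 1)) = 2 * (\<mu> * (q - \<mu>) * N)" by (simp add: mult_ac)
    hence "2 * b * (\<mu> * g 1) = \<mu> * (q - \<mu>) * N" by (simp only: mult_cancel_left) simp
    moreover have "\<mu> * g 1 = b * N - e 2" using mug[of 0] e0 by (simp add: numeral_2_eq_2)
    ultimately have "2 * b * (b * N - e 2) = \<mu> * (q - \<mu>) * N" by (simp only:)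
    hence "2 * b * e 2 = N * (2 * b * b - \<mu> * (q - \<mu>))" by (simp add: algebra_simps)
    also have "\<dots> = 2 * b * (N * P 1)"
    proof -
      have "2 * b * b - \<mu> * (q - \<mu>) = 2 * b * P 1" using P1 unfolding lam by (simp add: algebra_simps)
      thus ?thesis by (simp only: mult_ac)
    qed
    finally have "e 2 = N * P 1" using b0 by simp
    moreover have "N * P 0 = e (2 * 0)" using e0 by (simp add: P_def)
    ultimately show ?case by (simp add: numeral_2_eq_2)
  next
    case (Suc m)
    have g3: "(of_nat (2 * m + 3) + q) * (\<mu> * g (2 * m + 3)) = (of_nat (2 * m + 1) + 2 * b - q) * (\<mu> * g (2 * m + 1)) + 2 * (\<mu> * (q - \<mu>)) * e (2 * m + 2)"
      using arg_cong[OF gS[of "2 * m + 1"], of "\<lambda>x. \<mu> * x"] by (simp add: algebra_simps eval_nat_numeral)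
    have m3: "\<mu> * g (2 * m + 3) = (of_nat m + 1 + b) * e (2 * m + 2) - (of_nat m + 2) * e (2 * m + 4)"
      using mug[of "Suc m"] by (simp add: algebra_simps eval_nat_numeral)
    have IH: "e (2 * m) = N * P m" "e (2 * m + 2) = N * P (Suc m)" using Suc by auto
    have "(2 * of_nat m + 2 + 4 * b) * ((of_nat m + 2) * e (2 * m + 4)) =
      (2 * of_nat m + 2 + 4 * b) * ((of_nat m + 1 + b) * (N * P (Suc m)))
      - (2 * of_nat m + 2 - 2 * b) * ((of_nat m + b) * (N * P m) - (of_nat m + 1) * (N * P (Suc m)))
      - 2 * (\<mu> * (q - \<mu>)) * (N * P (Suc m))"
      using g3 unfolding m3 mug IH by (simp add: q algebra_simps)
    also have "\<mu> * (q - \<mu>) = b * (3 * b - 1) - of_real l" using lam by (simp add: algebra_simps)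
    also have "(2 * of_nat m + 2 + 4 * b) * ((of_nat m + 1 + b) * (N * P (Suc m)))
      - (2 * of_nat m + 2 - 2 * b) * ((of_nat m + b) * (N * P m) - (of_nat m + 1) * (N * P (Suc m)))
      - 2 * (b * (3 * b - 1) - of_real l) * (N * P (Suc m)) =
      2 * N * ((of_nat m + 1 + b) * (of_nat m + 2 - b) * P (Suc m) + ((of_nat m + 1) * (of_nat m + 2 * b) * P (Suc m) - (of_nat m + b) * (of_nat m + 1 - b) * P m)
        + of_real l * P (Suc m))"
      by (simp add: algebra_simps)
    also have "\<dots> = 2 * N * ((of_nat m + 2) * (of_nat m + 1 + 2 * b) * P (Suc (Suc m)))"
      unfolding ladder_Suc[symmetric] by (simp add: algebra_simps)
    also have "\<dots> = (2 * of_nat m + 2 + 4 * b) * ((of_nat m + 2) * (N * P (Suc (Suc m))))"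
      by (simp add: algebra_simps)
    finally have eq: "(2 * of_nat m + 2 + 4 * b) * ((of_nat m + 2) * e (2 * m + 4)) =
      (2 * of_nat m + 2 + 4 * b) * ((of_nat m + 2) * (N * P (Suc (Suc m))))" .
    have "Re (2 * of_nat m + 2 + 4 * b) > 0" "Re (of_nat m + 2 :: complex) > 0" using \<beta> by (auto simp: b_def add_pos_pos)
    hence "2 * of_nat m + 2 + 4 * b \<noteq> 0" "(of_nat m + 2 :: complex) \<noteq> 0" by (metis less_irrefl zero_complex.sel(1))+
    hence "e (2 * m + 4) = N * P (Suc (Suc m))" using eq by (metis mult_left_cancel)
    thus ?case using IH by (simp add: eval_nat_numeral)
  qed
  show "fps_nth F0 (2 * m) = of_real (lap_norm \<beta> * hahn_poly \<beta> m l)" using main[of m] by (simp add: e_def N_def P_def)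
  show "fps_nth F0 (2 * m + 1) = 0" using parity[of m] by (simp add: e_def)
qed

section \<open>Bounds on the generating function\<close>

lemma norm_lap_int_le:
  assumes "1 / 2 < \<beta>" "norm r \<le> R" "R < 1"
  shows "norm (lap_int \<beta> t r) \<le> lap_norm \<beta> * (((1 - R) / (1 + R)) powr (- (2 * \<beta> - 1 / 2)) * exp (arctan (2 * R / (1 - R\<^sup>2)) * \<bar>t\<bar>))"
    (is "_ \<le> _ * ?K")
proof -
  have r: "norm r < 1" using assms by linarith
  have "norm (lap_int \<beta> t r) \<le> integral (cbox 0 pi) (\<lambda>p. lap_weight \<beta> p * ?K)"
    unfolding lap_int_def
  proof (rule integral_norm_bound_integral)
    show "(\<lambda>p. of_real (lap_weight \<beta> p) * lap_W r p powr - lap_exp \<beta> t) integrable_on cbox 0 pi"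
      by (intro integrable_lap_weight_mult continuous_on_lap_slice assms r)
    show "(\<lambda>p. lap_weight \<beta> p * ?K) integrable_on cbox 0 pi"
      by (intro integrable_on_mult_left lap_weight_integrable assms)
  next
    fix p
    have "norm (lap_W r p powr - lap_exp \<beta> t) \<le> ?K"
      unfolding lap_exp_def using assms by (intro norm_lap_W_powr_le) auto
    thus "norm (of_real (lap_weight \<beta> p) * lap_W r p powr - lap_exp \<beta> t) \<le> lap_weight \<beta> p * ?K"
      by (simp add: norm_mult mult_left_mono)
  qed
  also have "\<dots> = lap_norm \<beta> * ?K" unfolding lap_norm_def by (rule integral_mult_left)
  finally show ?thesis .
qed

definition spec :: "real \<Rightarrow> real \<Rightarrow> real" where
  "spec \<beta> t = - (t\<^sup>2 + (\<beta> - 1 / 2)\<^sup>2)"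

text \<open>Cauchy's estimate for \<open>hahn_gf\<close> on the circle |r| = sqrt R, where r^2 has
  modulus R. The rate \<kappa> = arctan (2S/(1 - S^2)) with S = sqrt R depends on R but stays below
  pi/2 for every R < 1.\<close>

lemma hahn_poly_bound:
  assumes \<beta>: "1 / 2 < \<beta>" "\<beta> < 1" and R: "0 < R" "R < 1"
  shows "\<exists>C>0. \<exists>\<kappa>. 0 \<le> \<kappa> \<and> \<kappa> < pi / 2 \<and> (\<forall>t n. \<bar>hahn_poly \<beta> n (spec \<beta> t)\<bar> * R ^ n \<le> C * exp (\<kappa> * \<bar>t\<bar>))"
proof -
  define S where "S = sqrt R"
  have S: "0 < S" "S < 1" "S\<^sup>2 = R" using R by (auto simp: S_def)
  have S2: "0 < 1 - S\<^sup>2" using R S by simp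
  define N where "N = lap_norm \<beta>"
  have N: "N > 0" unfolding N_def by (rule lap_norm_pos[OF \<beta>(1)])
  define K where "K = ((1 - S) / (1 + S)) powr (- (2 * \<beta> - 1 / 2))"
  define \<kappa> where "\<kappa> = arctan (2 * S / (1 - S\<^sup>2))"
  define C where "C = (1 - S\<^sup>2) powr (- \<beta>) * K"
  have C: "C > 0" using S R by (simp add: C_def K_def)
  have \<kappa>: "0 \<le> \<kappa>" "\<kappa> < pi / 2"
    using S S2 arctan_ubound by (auto simp: \<kappa>_def)
  have "\<bar>hahn_poly \<beta> n (spec \<beta> t)\<bar> * R ^ n \<le> C * exp (\<kappa> * \<bar>t\<bar>)" for t n
  proof -
    have "norm ((deriv ^^ (2 * n)) (hahn_gf \<beta> t) 0) \<le> fact (2 * n) * (N * (C * exp (\<kappa> * \<bar>t\<bar>))) / S ^ (2 * n)"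
    proof (rule Cauchy_inequality)
      show "hahn_gf \<beta> t holomorphic_on ball 0 S"
        by (rule holomorphic_on_subset[OF hahn_gf_holomorphic(1)[OF \<beta>(1)]]) (use S in auto)
      show "continuous_on (cball 0 S) (hahn_gf \<beta> t)"
        by (rule continuous_on_subset[OF holomorphic_on_imp_continuous_on[OF hahn_gf_holomorphic(1)[OF \<beta>(1)]]])
           (use S in auto)
    next
      fix r :: complex assume "norm (0 - r) = S"
      hence r: "norm r = S" by simp
      have "1 - S\<^sup>2 \<le> norm (1 - r\<^sup>2)"
        using norm_triangle_ineq2[of 1 "r\<^sup>2"] r by (simp add: norm_power)
      hence "norm (1 - r\<^sup>2) powr (- \<beta>) \<le> (1 - S\<^sup>2) powr (- \<beta>)"
        using S2 \<beta> by (intro powr_mono2') auto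
      hence "norm ((1 - r\<^sup>2) powr (- of_real \<beta>)) \<le> (1 - S\<^sup>2) powr (- \<beta>)"
        by (subst norm_powr_real_powr') auto
      moreover have "norm (lap_int \<beta> t r) \<le> N * (K * exp (\<kappa> * \<bar>t\<bar>))"
        unfolding N_def K_def \<kappa>_def using r S \<beta> by (intro norm_lap_int_le) auto
      ultimately have "norm (hahn_gf \<beta> t r) \<le> (1 - S\<^sup>2) powr (- \<beta>) * (N * (K * exp (\<kappa> * \<bar>t\<bar>)))"
        unfolding hahn_gf_def norm_mult by (intro mult_mono) auto
      thus "norm (hahn_gf \<beta> t r) \<le> N * (C * exp (\<kappa> * \<bar>t\<bar>))" by (simp add: C_def mult_ac)
    qed (use S in auto)
    moreover have "(deriv ^^ (2 * n)) (hahn_gf \<beta> t) 0 = fact (2 * n) * of_real (N * hahn_poly \<beta> n (spec \<beta> t))"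
      using hahn_gf_coeffs(1)[OF \<beta>, of t n] by (simp add: fps_expansion_def N_def spec_def field_simps)
    ultimately have "fact (2 * n) * (N * \<bar>hahn_poly \<beta> n (spec \<beta> t)\<bar>) \<le> fact (2 * n) * (N * (C * exp (\<kappa> * \<bar>t\<bar>))) / S ^ (2 * n)"
      using N by (simp add: norm_mult abs_mult)
    also have "\<dots> = fact (2 * n) * (N * (C * exp (\<kappa> * \<bar>t\<bar>) / R ^ n))"
      by (simp add: power_mult S)
    finally have "N * \<bar>hahn_poly \<beta> n (spec \<beta> t)\<bar> \<le> N * (C * exp (\<kappa> * \<bar>t\<bar>) / R ^ n)"
      by (rule mult_left_le_imp_le) simp
    hence "\<bar>hahn_poly \<beta> n (spec \<beta> t)\<bar> \<le> C * exp (\<kappa> * \<bar>t\<bar>) / R ^ n"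
      by (rule mult_left_le_imp_le) (rule N)
    thus ?thesis using R by (simp add: field_simps)
  qed
  thus ?thesis using C \<kappa> by blast
qed

definition hahn_fun :: "real \<Rightarrow> real \<Rightarrow> real \<Rightarrow> real" where
  "hahn_fun \<beta> t x = (\<Sum>n. hahn_poly \<beta> n (spec \<beta> t) * x ^ n)"

lemma hahn_gf_sums:
  assumes \<beta>: "1 / 2 < \<beta>" "\<beta> < 1" and r: "norm r < 1"
  shows "(\<lambda>n. of_real (lap_norm \<beta> * hahn_poly \<beta> n (spec \<beta> t)) * (r\<^sup>2) ^ n) sums hahn_gf \<beta> t r"
proof -
  define e where "e = (\<lambda>n. (deriv ^^ n) (hahn_gf \<beta> t) 0 / fact n)"
  have e: "e (2 * n) = of_real (lap_norm \<beta> * hahn_poly \<beta> n (spec \<beta> t))" "e (2 * n + 1) = 0" for n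
    using hahn_gf_coeffs[OF \<beta>, of t n] by (simp_all add: e_def fps_expansion_def spec_def)
  have "(\<lambda>n. e n * (r - 0) ^ n) sums hahn_gf \<beta> t r"
    unfolding e_def by (rule holomorphic_power_series[OF hahn_gf_holomorphic(1)[OF \<beta>(1)]]) (use r in auto)
  also have "?this \<longleftrightarrow> (\<lambda>n. e (2 * n) * r ^ (2 * n)) sums hahn_gf \<beta> t r"
  proof -
    have "(\<lambda>n. e (2 * n) * (r - 0) ^ (2 * n)) sums hahn_gf \<beta> t r \<longleftrightarrow> (\<lambda>n. e n * (r - 0) ^ n) sums hahn_gf \<beta> t r"
    proof (rule sums_mono_reindex)
      show "strict_mono (\<lambda>n::nat. 2 * n)" by (auto simp: strict_mono_def)
      fix n :: nat assume "n \<notin> range (\<lambda>n. 2 * n)"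
      hence "odd n" by (auto elim!: evenE)
      then obtain m where "n = 2 * m + 1" by (elim oddE)
      thus "e n * (r - 0) ^ n = 0" using e(2)[of m] by simp
    qed
    thus ?thesis by simp
  qed
  finally show ?thesis by (simp add: e power_mult)
qed

lemma hahn_fun_sums:
  assumes \<beta>: "1 / 2 < \<beta>" "\<beta> < 1" and x: "0 \<le> x" "x < 1"
  shows "(\<lambda>n. hahn_poly \<beta> n (spec \<beta> t) * x ^ n) sums hahn_fun \<beta> t x"
    "of_real (lap_norm \<beta> * hahn_fun \<beta> t x) = hahn_gf \<beta> t (of_real (sqrt x))"
proof -
  have N: "lap_norm \<beta> > 0" by (rule lap_norm_pos[OF \<beta>(1)])
  define r where "r = complex_of_real (sqrt x)"
  have r: "norm r < 1" "r\<^sup>2 = of_real x" using x by (auto simp: r_def simp flip: of_real_power)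
  have "(\<lambda>n. of_real (lap_norm \<beta> * hahn_poly \<beta> n (spec \<beta> t) * x ^ n)) sums hahn_gf \<beta> t r"
    using hahn_gf_sums[OF \<beta> r(1), of t] by (simp add: r)
  note s = this
  have "(\<lambda>n. lap_norm \<beta> * (hahn_poly \<beta> n (spec \<beta> t) * x ^ n)) sums Re (hahn_gf \<beta> t r)"
    using sums_Re[OF s] by (simp add: mult.assoc)
  hence "(\<lambda>n. hahn_poly \<beta> n (spec \<beta> t) * x ^ n) sums (Re (hahn_gf \<beta> t r) / lap_norm \<beta>)"
    using N sums_mult[of _ _ "inverse (lap_norm \<beta>)"] by (fastforce simp: field_simps)
  thus *: "(\<lambda>n. hahn_poly \<beta> n (spec \<beta> t) * x ^ n) sums hahn_fun \<beta> t x"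
    unfolding hahn_fun_def by (simp add: sums_iff)
  have "(\<lambda>n. of_real (lap_norm \<beta> * (hahn_poly \<beta> n (spec \<beta> t) * x ^ n)) :: complex) sums of_real (lap_norm \<beta> * hahn_fun \<beta> t x)"
    by (intro sums_of_real sums_mult *)
  with s show "of_real (lap_norm \<beta> * hahn_fun \<beta> t x) = hahn_gf \<beta> t (of_real (sqrt x))"
    unfolding r_def[symmetric] by (simp add: sums_iff mult.assoc)
qed

section \<open>Decay at x = 1, uniformly in t\<close>

lemma sin_ge_half:
  assumes "0 \<le> p" "p \<le> pi / 2"
  shows "p / 2 \<le> sin p"
proof (cases "p \<le> pi / 3")
  case True
  show ?thesis
  proof (cases "p = 0")
    case False
    hence "0 < p" using assms by simp
    then obtain z where z: "0 < z" "z < p" "sin p - sin 0 = (p - 0) * cos z"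
      using MVT2[of 0 p sin cos] by (auto intro: DERIV_sin)
    have "cos (pi / 3) \<le> cos z" using z True by (intro cos_monotone_0_pi_le) auto
    hence "p * (1 / 2) \<le> p * cos z" using \<open>0 < p\<close> by (intro mult_left_mono) (auto simp: cos_60)
    thus ?thesis using z by simp
  qed auto
next
  case False
  have "sin (pi / 3) \<le> sin p" using False assms by (intro sin_monotone_2pi_le) auto
  moreover have "17 / 10 \<le> sqrt 3" by (rule real_le_rsqrt) (simp add: power2_eq_square)
  moreover have "pi \<le> 32 / 10" by (rule order_trans[OF pi_approx(2)]) simp
  hence "p / 2 \<le> 17 / 20" using assms by linarith
  ultimately show ?thesis by (simp add: sin_60)
qed

text \<open>The power of the sine is singular at both ends of [0, pi]; the majorant has the same
  singularities and an explicit antiderivative.\<close>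

lemma sin_powr_bound:
  assumes "0 < e" "e < 1" "0 < p" "p < pi"
  shows "sin p powr (e - 1) \<le> 2 powr (1 - e) * (p powr (e - 1) + (pi - p) powr (e - 1))"
proof -
  have key: "sin q powr (e - 1) \<le> 2 powr (1 - e) * q powr (e - 1)" if "0 < q" "q \<le> pi / 2" for q
  proof -
    have "sin q powr (e - 1) \<le> (q / 2) powr (e - 1)"
      using that assms sin_ge_half[of q] by (intro powr_mono2') auto
    also have "\<dots> = 2 powr (1 - e) * q powr (e - 1)"
      using that by (simp add: powr_divide powr_diff field_simps)
    finally show ?thesis .
  qed
  show ?thesis
  proof (cases "p \<le> pi / 2")
    case True
    thus ?thesis using key[of p] assms by (simp add: distrib_left add_increasing2)
  next
    case False
    have "sin (pi - p) = sin p" by simp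
    thus ?thesis using key[of "pi - p"] assms False by (simp add: distrib_left add_increasing)
  qed
qed

lemma powr_ends_integrable:
  assumes "0 < e"
  shows "(\<lambda>p. K * (p powr (e - 1) + (pi - p) powr (e - 1))) integrable_on cbox 0 pi"
proof -
  have "((\<lambda>p. K * (p powr (e - 1) + (pi - p) powr (e - 1))) has_integral
     (K * (pi powr e / e - (pi - pi) powr e / e) - K * (0 powr e / e - (pi - 0) powr e / e))) {0..pi}"
  proof (rule fundamental_theorem_of_calculus_interior)
    show "continuous_on {0..pi} (\<lambda>p. K * (p powr e / e - (pi - p) powr e / e))"
      using assms by (intro continuous_on_mult continuous_on_diff continuous_on_divide continuous_on_powr' continuous_on_const continuous_on_id) auto
    fix p assume p: "p \<in> {0<..<pi}"
    have "((\<lambda>p. K * (p powr e / e - (pi - p) powr e / e)) has_real_derivative K * (p powr (e - 1) + (pi - p) powr (e - 1))) (at p)"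
      using p assms by (auto intro!: derivative_eq_intros simp: powr_diff field_simps)
    thus "((\<lambda>p. K * (p powr e / e - (pi - p) powr e / e)) has_vector_derivative K * (p powr (e - 1) + (pi - p) powr (e - 1))) (at p)"
      by (simp add: has_real_derivative_iff_has_vector_derivative)
  qed auto
  thus ?thesis by (auto intro: has_integral_integrable)
qed

text \<open>For real r = sqrt x the kernel \<open>lap_W\<close> is positive, so t contributes only a
  phase and the bound is uniform in t. The exponent is half of \<beta> - 1/2, the real part of both
  local exponents at x = 1; the other half is spent on making the majorant integrable.\<close>

lemma hahn_fun_bound:
  assumes \<beta>: "1 / 2 < \<beta>" "\<beta> < 1"
  shows "\<exists>C>0. \<forall>t. \<forall>x\<in>{0..<1}. \<bar>hahn_fun \<beta> t x\<bar> \<le> C * (1 - x) powr ((\<beta> - 1 / 2) / 2)"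
proof -
  define e where "e = (\<beta> - 1 / 2) / 2"
  define a where "a = 2 * \<beta> - 1 / 2"
  have e: "0 < e" "e < 1" "e / 2 < a" using \<beta> by (auto simp: e_def a_def)
  define N where "N = lap_norm \<beta>"
  have N: "N > 0" unfolding N_def by (rule lap_norm_pos[OF \<beta>(1)])
  define g where "g = (\<lambda>p. 2 powr (1 - e) * (p powr (e - 1) + (pi - p) powr (e - 1)))"
  define M where "M = integral (cbox 0 pi) g"
  have g_int: "g integrable_on cbox 0 pi" unfolding g_def by (intro powr_ends_integrable e)
  have M: "M \<ge> 0" unfolding M_def by (intro integral_nonneg g_int) (auto simp: g_def)
  define C where "C = 2 powr (2 * e) * (M + 1) / N"
  have C: "C > 0" using M N by (auto simp: C_def intro!: divide_pos_pos mult_pos_pos)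
  have "\<bar>hahn_fun \<beta> t x\<bar> \<le> C * (1 - x) powr e" if x: "x \<in> {0..<1}" for t x
  proof -
    define s where "s = sqrt x"
    have s: "0 \<le> s" "s < 1" "s\<^sup>2 = x" using x by (auto simp: s_def)
    define u where "u = 1 - s\<^sup>2"
    have u: "u > 0" "u = 1 - x" using x s by (auto simp: u_def)
    have nr: "norm (complex_of_real s) < 1" using s by simp
    have "norm (lap_int \<beta> t (of_real s)) \<le> integral (cbox 0 pi) (\<lambda>p. u powr a * (1 - s) powr (- e) * g p)"
      unfolding lap_int_def
    proof (rule integral_norm_bound_integral)
      show "(\<lambda>p. of_real (lap_weight \<beta> p) * lap_W (of_real s) p powr - lap_exp \<beta> t) integrable_on cbox 0 pi"
        by (intro integrable_lap_weight_mult continuous_on_lap_slice nr \<beta>)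
      show "(\<lambda>p. u powr a * (1 - s) powr (- e) * g p) integrable_on cbox 0 pi"
        by (intro integrable_on_mult_right g_int)
    next
      fix p assume p: "p \<in> cbox 0 pi"
      show "norm (of_real (lap_weight \<beta> p) * lap_W (of_real s) p powr - lap_exp \<beta> t) \<le> u powr a * (1 - s) powr (- e) * g p"
      proof (cases "p = 0 \<or> p = pi")
        case True
        hence "lap_weight \<beta> p = 0" by (auto simp: lap_weight_def)
        thus ?thesis by (simp add: g_def)
      next
        case False
        hence p: "0 < p" "p < pi" using p by auto
        have sinp: "0 < sin p" using p by (intro sin_gt_zero)
        define Q where "Q = 1 + s\<^sup>2 + 2 * s * cos p"
        have Q_sin: "(sin p)\<^sup>2 \<le> Q"
        proof -
          have "Q - (sin p)\<^sup>2 = (s + cos p)\<^sup>2" by (simp add: Q_def sin_squared_eq power2_eq_square algebra_simps)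
          thus ?thesis using zero_le_power2[of "s + cos p"] by linarith
        qed
        have Q_s: "(1 - s)\<^sup>2 \<le> Q"
        proof -
          have "Q - (1 - s)\<^sup>2 = 2 * s * (1 + cos p)" by (simp add: Q_def power2_eq_square algebra_simps)
          moreover have "1 + cos p \<ge> 0" using cos_ge_minus_one[of p] by linarith
          ultimately show ?thesis using s mult_nonneg_nonneg[of "2 * s" "1 + cos p"] by linarith
        qed
        have Q: "Q > 0" using Q_sin sinp by (meson less_le_trans zero_less_power)
        have W: "lap_W (of_real s) p = of_real (Q / u)"
          by (simp add: lap_W_def Q_def u_def)
        have "norm (lap_W (of_real s) p powr - lap_exp \<beta> t) = (Q / u) powr (- a)"
          unfolding W using Q u by (subst norm_powr_real_powr) (auto simp: lap_exp_def a_def)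
        also have "\<dots> = u powr a * Q powr (- a)"
          using Q u by (simp add: powr_divide powr_minus field_simps)
        \<comment> \<open>If Q were bounded below by sin^2 p alone, the integrand would become 1/sin
          p, which is not integrable. Giving the share e/2 of the power to the bound (1 - s)^2
          leaves the integrable sin^(e - 1) p at the cost of (1 - s)^(-e), which the factor u^(2e)
          more than repays.\<close>
        also have "Q powr (- a) = Q powr (- (a - e / 2)) * Q powr (- (e / 2))"
          using Q by (simp flip: powr_add)
        also have "\<dots> \<le> ((sin p)\<^sup>2) powr (- (a - e / 2)) * ((1 - s)\<^sup>2) powr (- (e / 2))"
          using Q_sin Q_s sinp s e by (intro mult_mono powr_mono2') auto
        also have "((sin p)\<^sup>2) powr (- (a - e / 2)) = sin p powr (e - 2 * a)"
          using sinp by (simp add: powr_powr flip: powr_numeral)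
        also have "((1 - s)\<^sup>2) powr (- (e / 2)) = (1 - s) powr (- e)"
          using s by (simp add: powr_powr flip: powr_numeral)
        finally have "norm (lap_W (of_real s) p powr - lap_exp \<beta> t) \<le> u powr a * (sin p powr (e - 2 * a) * (1 - s) powr (- e))"
          using u by (simp add: mult_left_mono)
        hence "lap_weight \<beta> p * norm (lap_W (of_real s) p powr - lap_exp \<beta> t) \<le>
           lap_weight \<beta> p * (u powr a * (sin p powr (e - 2 * a) * (1 - s) powr (- e)))"
          by (intro mult_left_mono) auto
        also have "\<dots> = u powr a * (1 - s) powr (- e) * (sin p powr (4 * \<beta> - 2) * sin p powr (e - 2 * a))"
          by (simp add: lap_weight_def mult_ac)
        also have "sin p powr (4 * \<beta> - 2) * sin p powr (e - 2 * a) = sin p powr (e - 1)"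
          by (simp add: a_def flip: powr_add)
        also have "\<dots> \<le> g p" unfolding g_def using e p by (intro sin_powr_bound) auto
        finally show ?thesis by (simp add: norm_mult mult_left_mono)
      qed
    qed
    also have "\<dots> = u powr a * (1 - s) powr (- e) * M" unfolding M_def by (rule integral_mult_right)
    finally have 1: "norm (lap_int \<beta> t (of_real s)) \<le> u powr a * (1 - s) powr (- e) * M" .
    have "(1 - (complex_of_real s)\<^sup>2) = of_real u" by (simp add: u_def)
    hence "norm ((1 - (complex_of_real s)\<^sup>2) powr (- of_real \<beta>)) = u powr (- \<beta>)"
      using u by (simp add: norm_powr_real_powr)
    hence "norm (hahn_gf \<beta> t (of_real s)) \<le> u powr (- \<beta>) * (u powr a * (1 - s) powr (- e) * M)"
      unfolding hahn_gf_def norm_mult using 1 by (simp add: mult_left_mono)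
    also have "\<dots> = u powr (2 * e) * (1 - s) powr (- e) * M"
    proof -
      have "- \<beta> + a = 2 * e" by (simp add: e_def a_def field_simps)
      hence "u powr (- \<beta>) * u powr a = u powr (2 * e)" by (simp only: powr_add[symmetric])
      thus ?thesis by (simp only: mult.assoc[symmetric])
    qed
    also have "u powr (2 * e) \<le> (2 * (1 - s)) powr (2 * e)"
    proof (intro powr_mono2)
      have "u = (1 + s) * (1 - s)" by (simp add: u_def power2_eq_square algebra_simps)
      also have "\<dots> \<le> 2 * (1 - s)" using s by (intro mult_right_mono) auto
      finally show "u \<le> 2 * (1 - s)" .
    qed (use u e in auto)
    also have "(2 * (1 - s)) powr (2 * e) = 2 powr (2 * e) * (1 - s) powr (2 * e)"
      by (rule powr_mult)
    also have "2 powr (2 * e) * (1 - s) powr (2 * e) * (1 - s) powr (- e) * M = 2 powr (2 * e) * M * (1 - s) powr e"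
    proof -
      have "(1 - s) powr (2 * e) * (1 - s) powr (- e) = (1 - s) powr e" by (simp flip: powr_add)
      thus ?thesis by (metis mult.assoc mult.commute)
    qed
    also have "\<dots> \<le> 2 powr (2 * e) * (M + 1) * (1 - x) powr e"
    proof (intro mult_mono powr_mono2)
      have "s * s \<le> s * 1" using s by (intro mult_left_mono) auto
      thus "1 - s \<le> 1 - x" using s(3) by (simp add: power2_eq_square)
    qed (use s e M in auto)
    finally have "norm (hahn_gf \<beta> t (of_real s)) \<le> 2 powr (2 * e) * (M + 1) * (1 - x) powr e"
      using M by (simp add: mult_right_mono)
    moreover have "norm (hahn_gf \<beta> t (of_real s)) = N * \<bar>hahn_fun \<beta> t x\<bar>"
    proof -
      have "hahn_gf \<beta> t (of_real s) = of_real (N * hahn_fun \<beta> t x)"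
        unfolding s_def N_def using x by (intro hahn_fun_sums(2)[OF \<beta>, symmetric]) auto
      thus ?thesis using N by (simp add: norm_mult abs_mult)
    qed
    ultimately show ?thesis using N by (simp add: C_def field_simps)
  qed
  thus ?thesis using C unfolding e_def by blast
qed

section \<open>Moments of Gamma weights\<close>

lemma sin_i_times_of_real: "sin (\<i> * of_real y) = \<i> * of_real (sinh y)"
  by (simp add: sin_i_times sinh_field_def exp_of_real[symmetric] exp_minus)

lemma exp_le_sinh:
  assumes "3 \<le> (x :: real)"
  shows "exp x / 4 \<le> sinh x"
proof -
  have *: "f / 4 \<le> (f - e) / 2" if "e \<le> 1" "1 + x \<le> f" for e f
    using that assms by simp
  show ?thesis unfolding sinh_field_def
    by (rule *) (use assms exp_ge_add_one_self in auto)
qed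

text \<open>Euler's limit isolates the dependence on t in factors x/|x + it| with x = c + j. The
  estimates that follow compare these factors one by one.\<close>

lemma norm_Gamma_series:
  assumes "c > 0" "n > 0"
  shows "norm (Gamma_series (Complex c t) n) = Gamma_series c n * (\<Prod>i\<le>n. (c + real i) / norm (Complex (c + real i) t))"
proof -
    have "norm (pochhammer (Complex c t) (Suc n)) = (\<Prod>i\<le>n. norm (Complex (c + real i) t))"
      (is "?l = ?r") unfolding pochhammer_Suc_prod prod_norm[symmetric] by (intro prod.cong) (auto simp: complex_eq_iff intro!: arg_cong[where f = norm])
    moreover have "pochhammer c (Suc n) = (\<Prod>i\<le>n. c + real i)"
      unfolding pochhammer_Suc_prod by (intro prod.cong) auto
    moreover have "(\<Prod>i\<le>n. c + real i) > 0" using assms by (intro prod_pos) auto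
    moreover have "norm (exp (Complex c t * ln (of_nat n))) = exp (c * ln (real n))"
      using Ln_of_nat[OF \<open>n > 0\<close>] by simp
    moreover have "(\<Prod>i\<le>n. norm (Complex (c + real i) t)) > 0"
      using assms by (intro prod_pos) (auto simp: complex_eq_iff)
    ultimately show ?thesis
      by (simp add: Gamma_series_def norm_divide norm_mult prod_dividef less_imp_neq[symmetric] del: prod_zero_iff)
qed

lemma norm_Gamma_le:
  assumes "0 < c"
  shows "norm (Gamma (Complex c t)) \<le> Gamma c"
proof (rule LIMSEQ_le)
  show "(\<lambda>n. norm (Gamma_series (Complex c t) n)) \<longlonglongrightarrow> norm (Gamma (Complex c t))"
    by (intro tendsto_intros)
  show "Gamma_series c \<longlonglongrightarrow> Gamma c"
    by (intro tendsto_intros)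
  have "norm (Gamma_series (Complex c t) n) \<le> Gamma_series c n" if "n \<ge> 1" for n
  proof -
    have "Gamma_series c n \<ge> 0"
      using assms that pochhammer_pos[of c "Suc n"] by (simp add: Gamma_series_def)
    moreover have "(\<Prod>i\<le>n. (c + real i) / norm (Complex (c + real i) t)) \<le> 1"
    proof (rule prod_le_1, safe)
      fix i
      have "c + real i \<le> norm (Complex (c + real i) t)"
        using abs_Re_le_cmod[of "Complex (c + real i) t"] by simp
      thus "(c + real i) / norm (Complex (c + real i) t) \<le> 1"
        using assms by (simp add: divide_le_eq_1)
    qed (use assms in auto)
    ultimately show ?thesis
      using assms that by (simp add: norm_Gamma_series mult_left_le)
  qed
  thus "\<exists>N. \<forall>n\<ge>N. norm (Gamma_series (Complex c t) n) \<le> Gamma_series c n" by blast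
qed

text \<open>Each factor x/|x + it| of Euler's product increases with x. This carries the decay known
  on a line to all parallel lines on its left.\<close>

lemma norm_Gamma_ratio_mono:
  assumes "0 < a" "a \<le> b"
  shows "norm (Gamma (Complex a t)) / Gamma a \<le> norm (Gamma (Complex b t)) / Gamma b"
proof -
  have lim: "(\<lambda>n. norm (Gamma_series (Complex c t) n) / Gamma_series c n) \<longlonglongrightarrow> norm (Gamma (Complex c t)) / Gamma c"
    if "c > 0" for c :: real
    using less_imp_neq[OF Gamma_real_pos[OF that], symmetric] by (intro tendsto_intros)
  have pos: "eventually (\<lambda>n. Gamma_series c n > 0) sequentially" if "c > 0" for c :: real
    using order_tendstoD(1)[OF Gamma_series_LIMSEQ[of c], of 0] Gamma_real_pos[OF that] by auto
  show ?thesis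
  proof (rule LIMSEQ_le[OF lim lim])
    have "eventually (\<lambda>n. norm (Gamma_series (Complex a t) n) / Gamma_series a n \<le>
      norm (Gamma_series (Complex b t) n) / Gamma_series b n) sequentially"
      using eventually_conj[OF eventually_gt_at_top[of 0] eventually_conj[OF pos[of a] pos[of b]]] assms
    proof (auto elim!: eventually_mono)
      fix n :: nat assume n: "0 < Gamma_series a n" "0 < Gamma_series b n" "n > 0"
      have "(\<Prod>i\<le>n. (a + real i) / norm (Complex (a + real i) t)) \<le> (\<Prod>i\<le>n. (b + real i) / norm (Complex (b + real i) t))"
      proof (rule prod_mono, safe)
        fix i
        define x y where "x = a + real i" and "y = b + real i"
        have xy: "0 < x" "x \<le> y" using assms by (auto simp: x_def y_def)
        have "(x * norm (Complex y t))\<^sup>2 \<le> (y * norm (Complex x t))\<^sup>2"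
        proof -
          have "x\<^sup>2 * t\<^sup>2 \<le> y\<^sup>2 * t\<^sup>2" using xy by (intro mult_right_mono power_mono) auto
          thus ?thesis by (simp add: power_mult_distrib cmod_def algebra_simps)
        qed
        hence "x * norm (Complex y t) \<le> y * norm (Complex x t)"
          by (rule power2_le_imp_le) (use xy in auto)
        moreover have "norm (Complex x t) > 0" "norm (Complex y t) > 0"
          using xy by (auto simp: complex_eq_iff)
        ultimately show "(a + real i) / norm (Complex (a + real i) t) \<le> (b + real i) / norm (Complex (b + real i) t)"
          by (simp add: field_simps flip: x_def y_def)
      qed (use assms in auto)
      thus "norm (Gamma_series (Complex a t) n) / Gamma_series a n \<le> norm (Gamma_series (Complex b t) n) / Gamma_series b n"
        using assms n by (simp add: norm_Gamma_series)
    qed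
    thus "\<exists>N. \<forall>n\<ge>N. norm (Gamma_series (Complex a t) n) / Gamma_series a n \<le>
      norm (Gamma_series (Complex b t) n) / Gamma_series b n" by (simp add: eventually_sequentially)
  qed (use assms in auto)
qed

text \<open>The reflection formula gives |Gamma(1 + it)|^2 = pi t / sinh(pi t), used for |t| at
  least 1; for smaller t the bound by Gamma 1 = 1 suffices. The constant is the sum of those of the
  two cases.\<close>

lemma norm_Gamma_1_bound:
  "\<exists>C>0. \<forall>t. norm (Gamma (Complex 1 t)) \<le> C * (1 + \<bar>t\<bar>) * exp (- (pi / 2) * \<bar>t\<bar>)"
proof (intro exI conjI allI)
  let ?C = "2 * sqrt pi + exp (pi / 2)"
  fix t :: real
  show "norm (Gamma (Complex 1 t)) \<le> ?C * (1 + \<bar>t\<bar>) * exp (- (pi / 2) * \<bar>t\<bar>)"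
  proof (cases "\<bar>t\<bar> \<ge> 1")
    case True
    hence t: "t \<noteq> 0" by auto
    define z where "z = Complex 0 t"
    have "Gamma z * Gamma (1 - z) = of_real pi / sin (of_real pi * z)"
      by (rule Gamma_reflection_complex)
    moreover have "Gamma (z + 1) = z * Gamma z"
      using t by (intro Gamma_plus1) (auto simp: z_def elim!: nonpos_Ints_cases simp: complex_eq_iff)
    ultimately have *: "Gamma (1 + z) * Gamma (1 - z) = of_real pi * z / sin (of_real pi * z)"
      by (simp add: add.commute mult_ac)
    have "1 - z = cnj (1 + z)" by (simp add: z_def complex_eq_iff)
    hence "Gamma (1 - z) = cnj (Gamma (1 + z))"
      by (simp only: cnj_Gamma)
    moreover have "norm z = \<bar>t\<bar>" by (simp add: z_def cmod_def)
    ultimately have "(norm (Gamma (1 + z)))\<^sup>2 = pi * \<bar>t\<bar> / norm (sin (of_real pi * z))"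
      using arg_cong[OF *, of norm] by (simp add: norm_mult norm_divide power2_eq_square)
    also have "norm (sin (of_real pi * z)) = sinh (pi * \<bar>t\<bar>)"
    proof -
      have "of_real pi * z = \<i> * of_real (pi * t)" by (simp add: z_def complex_eq_iff)
      moreover have "sin (\<i> * of_real (pi * t)) = \<i> * of_real (sinh (pi * t))"
        by (rule sin_i_times_of_real)
      ultimately have "norm (sin (of_real pi * z)) = \<bar>sinh (pi * t)\<bar>"
        by (simp only:) (simp add: norm_mult)
      also have "\<dots> = sinh (pi * \<bar>t\<bar>)"
        by (cases "t \<ge> 0") (auto simp: abs_if mult_less_0_iff zero_le_mult_iff)
      finally show ?thesis .
    qed
    also have "pi * \<bar>t\<bar> / sinh (pi * \<bar>t\<bar>) \<le> pi * \<bar>t\<bar> / (exp (pi * \<bar>t\<bar>) / 4)"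
    proof (rule divide_left_mono)
      have "3 * 1 \<le> pi * \<bar>t\<bar>" using True pi_gt3 by (intro mult_mono) auto
      thus "exp (pi * \<bar>t\<bar>) / 4 \<le> sinh (pi * \<bar>t\<bar>)" by (intro exp_le_sinh) simp
    next
      show "0 < sinh (pi * \<bar>t\<bar>) * (exp (pi * \<bar>t\<bar>) / 4)" using t by simp
    qed (use t in auto)
    also have "\<dots> = 4 * (pi * \<bar>t\<bar>) * (exp (- (pi / 2) * \<bar>t\<bar>))\<^sup>2"
      by (simp add: exp_minus field_simps flip: exp_double)
    also have "\<dots> \<le> 4 * (pi * (1 + \<bar>t\<bar>)\<^sup>2) * (exp (- (pi / 2) * \<bar>t\<bar>))\<^sup>2"
      by (intro mult_right_mono mult_left_mono) (auto simp: power2_eq_square algebra_simps)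
    also have "\<dots> = (2 * sqrt pi * (1 + \<bar>t\<bar>) * exp (- (pi / 2) * \<bar>t\<bar>))\<^sup>2"
      by (simp add: power_mult_distrib)
    finally have "norm (Gamma (1 + z)) \<le> 2 * sqrt pi * (1 + \<bar>t\<bar>) * exp (- (pi / 2) * \<bar>t\<bar>)"
      by (rule power2_le_imp_le) auto
    moreover have "1 + z = Complex 1 t" by (simp add: z_def complex_eq_iff)
    moreover have "2 * sqrt pi * (1 + \<bar>t\<bar>) * exp (- (pi / 2) * \<bar>t\<bar>) \<le> ?C * (1 + \<bar>t\<bar>) * exp (- (pi / 2) * \<bar>t\<bar>)"
      by (intro mult_right_mono) auto
    ultimately show ?thesis by simp
  next
    case False
    have "norm (Gamma (Complex 1 t)) \<le> 1" using norm_Gamma_le[of 1 t] by simp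
    also have "1 \<le> exp (pi / 2) * 1 * exp (- (pi / 2) * \<bar>t\<bar>)"
      using False by (simp add: mult_left_le flip: exp_add)
    also have "\<dots> \<le> ?C * (1 + \<bar>t\<bar>) * exp (- (pi / 2) * \<bar>t\<bar>)"
      by (intro mult_right_mono mult_mono) auto
    finally show ?thesis .
  qed
qed (auto intro!: add_pos_pos)

lemma norm_Gamma_nat_bound:
  "\<exists>C>0. \<forall>t. norm (Gamma (Complex (1 + real n) t)) \<le> C * (1 + \<bar>t\<bar>) ^ Suc n * exp (- (pi / 2) * \<bar>t\<bar>)"
proof (induction n)
  case 0
  show ?case using norm_Gamma_1_bound by simp
next
  case (Suc n)
  then obtain C where C: "C > 0" "\<And>t. norm (Gamma (Complex (1 + real n) t)) \<le> C * (1 + \<bar>t\<bar>) ^ Suc n * exp (- (pi / 2) * \<bar>t\<bar>)"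
    by blast
  show ?case
  proof (intro exI[of _ "(1 + real n) * C"] conjI allI)
    fix t :: real
    have "Complex (1 + real n) t \<notin> \<int>\<^sub>\<le>\<^sub>0" by (auto elim!: nonpos_Ints_cases simp: complex_eq_iff)
    from Gamma_plus1[OF this] have "Gamma (Complex (1 + real (Suc n)) t) = Complex (1 + real n) t * Gamma (Complex (1 + real n) t)"
      by (simp add: complex_eq_iff Complex_eq add_ac)
    hence "norm (Gamma (Complex (1 + real (Suc n)) t)) = norm (Complex (1 + real n) t) * norm (Gamma (Complex (1 + real n) t))"
      by (simp add: norm_mult)
    also have "norm (Complex (1 + real n) t) \<le> (1 + real n) + \<bar>t\<bar>"
      using cmod_le[of "Complex (1 + real n) t"] by simp
    also have "\<dots> \<le> (1 + real n) * (1 + \<bar>t\<bar>)" by (simp add: algebra_simps)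
    also note C(2)[of t]
    finally show "norm (Gamma (Complex (1 + real (Suc n)) t)) \<le> (1 + real n) * C * (1 + \<bar>t\<bar>) ^ Suc (Suc n) * exp (- (pi / 2) * \<bar>t\<bar>)"
      using C(1) by (simp add: mult_ac mult_left_mono mult_right_mono)
  qed (use C in auto)
qed

text \<open>Compare with the line Re = 1 + n to the right of the strip, where the functional
  equation has propagated the bound from Re = 1; the real Gamma function is bounded on
  [a, b].\<close>

lemma norm_Gamma_strip_bound:
  assumes "0 < a"
  shows "\<exists>C>0. \<exists>n::nat. \<forall>x\<in>{a..b}. \<forall>t. norm (Gamma (Complex x t)) \<le> C * (1 + \<bar>t\<bar>) ^ n * exp (- (pi / 2) * \<bar>t\<bar>)"
proof -
  obtain n :: nat where n: "real n \<ge> b" using real_arch_simple by blast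
  obtain C where C: "C > 0" "\<And>t. norm (Gamma (Complex (1 + real n) t)) \<le> C * (1 + \<bar>t\<bar>) ^ Suc n * exp (- (pi / 2) * \<bar>t\<bar>)"
    using norm_Gamma_nat_bound by blast
  have "continuous_on {a..b} (Gamma :: real \<Rightarrow> real)"
    using assms by (intro continuous_on_Gamma) (auto elim!: nonpos_Ints_cases)
  hence "bounded (Gamma ` {a..b})" by (intro compact_imp_bounded compact_continuous_image) auto
  then obtain K where K: "K > 0" "\<And>x. x \<in> {a..b} \<Longrightarrow> Gamma x \<le> K"
    unfolding bounded_pos by (force dest!: abs_le_D1)
  define G where "G = Gamma (1 + real n)"
  have G: "G > 0" by (simp add: G_def)
  show ?thesis
  proof (intro exI[of _ "K / G * C"] conjI exI[of _ "Suc n"] ballI allI)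
    fix x t :: real assume x: "x \<in> {a..b}"
    have "norm (Gamma (Complex x t)) / Gamma x \<le> norm (Gamma (Complex (1 + real n) t)) / G"
      unfolding G_def using x assms n by (intro norm_Gamma_ratio_mono) auto
    hence "norm (Gamma (Complex x t)) \<le> Gamma x / G * norm (Gamma (Complex (1 + real n) t))"
      using x assms G Gamma_real_pos[of x] by (simp add: field_simps)
    also have "\<dots> \<le> K / G * (C * (1 + \<bar>t\<bar>) ^ Suc n * exp (- (pi / 2) * \<bar>t\<bar>))"
      using K G x assms Gamma_real_pos[of x] by (intro mult_mono divide_right_mono K C) auto
    finally show "norm (Gamma (Complex x t)) \<le> K / G * C * (1 + \<bar>t\<bar>) ^ Suc n * exp (- (pi / 2) * \<bar>t\<bar>)"
      by (simp add: mult_ac)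
  qed (use K G C in auto)
qed


section \<open>Integrability of the Gamma weights\<close>

lemma poly_le_exp:
  assumes "0 < \<delta>"
  shows "\<exists>K>0. \<forall>t::real. (1 + \<bar>t\<bar>) ^ m \<le> K * exp (\<delta> * \<bar>t\<bar>)"
proof (cases "m = 0")
  case True
  thus ?thesis using assms by (intro exI[of _ 1]) auto
next
  case False
  \<comment> \<open>Chosen so that 1 + |t| is at most c (1 + \<delta> |t| / m), whose m-th power is
    controlled by the exponential.\<close>
  define c where "c = max 1 (real m / \<delta>)"
  have c: "c \<ge> 1" "c \<ge> real m / \<delta>" by (auto simp: c_def)
  show ?thesis
  proof (intro exI[of _ "c ^ m"] conjI allI)
    fix t :: real
    have "1 + \<bar>t\<bar> \<le> c * (1 + \<delta> * \<bar>t\<bar> / real m)"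
    proof -
      have "real m / \<delta> * (\<delta> * \<bar>t\<bar> / real m) \<le> c * (\<delta> * \<bar>t\<bar> / real m)"
        using c assms by (intro mult_right_mono) auto
      thus ?thesis using False assms c by (simp add: algebra_simps)
    qed
    hence "(1 + \<bar>t\<bar>) ^ m \<le> (c * (1 + \<delta> * \<bar>t\<bar> / real m)) ^ m" by (intro power_mono) auto
    also have "\<dots> = c ^ m * (1 + \<delta> * \<bar>t\<bar> / real m) ^ m" by (simp add: power_mult_distrib)
    also have "\<dots> \<le> c ^ m * exp (\<delta> * \<bar>t\<bar>)"
      using assms False c
      by (intro mult_left_mono exp_ge_one_plus_x_over_n_power_n) (auto intro: order_trans[of _ 0])
    finally show "(1 + \<bar>t\<bar>) ^ m \<le> c ^ m * exp (\<delta> * \<bar>t\<bar>)" .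
  qed (use c in auto)
qed

lemma integrable_exp_abs:
  assumes "0 < \<delta>"
  shows "integrable lborel (\<lambda>t::real. exp (- \<delta> * \<bar>t\<bar>))"
proof -
  obtain K where K: "K > 0" "\<And>t::real. (1 + \<bar>t\<bar>) ^ 2 \<le> K * exp (\<delta> * \<bar>t\<bar>)"
    using poly_le_exp[OF assms] by blast
  have "integrable lborel (\<lambda>t::real. inverse (1 + t\<^sup>2))"
    using integrable_inverse_1_plus_square by (simp add: set_integrable_def einterval_eq_UNIV)
  hence "integrable lborel (\<lambda>t::real. K * inverse (1 + t\<^sup>2))" by simp
  thus ?thesis
  proof (rule Bochner_Integration.integrable_bound, measurable, intro AE_I2)
    fix t :: real
    have "(1 + t\<^sup>2) \<le> (1 + \<bar>t\<bar>) ^ 2" by (simp add: power2_eq_square algebra_simps)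
    also have "\<dots> \<le> K * exp (\<delta> * \<bar>t\<bar>)" by (rule K)
    finally have "1 + t\<^sup>2 \<le> K * exp (\<delta> * \<bar>t\<bar>)" .
    moreover have "1 + t\<^sup>2 > 0" by (intro add_pos_nonneg) auto
    ultimately show "norm (exp (- \<delta> * \<bar>t\<bar>)) \<le> norm (K * inverse (1 + t\<^sup>2))"
      using K(1) by (simp add: exp_minus field_simps)
  qed
qed

text \<open>As 1/|Gamma(2it)|^2 is a constant multiple of t sinh(2 pi t), this is up to that
  constant the continuous dual Hahn weight with parameters a, a, b.\<close>

definition gamma_weight :: "real \<Rightarrow> real \<Rightarrow> real \<Rightarrow> real" where
  "gamma_weight a b t = norm (Gamma (Complex a t)) ^ 4 * norm (Gamma (Complex b t)) ^ 2 * (t * sinh (2 * pi * t))"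

lemma t_sinh_nonneg: "0 \<le> t * sinh (2 * pi * t)"
proof (cases "t \<ge> 0")
  case False
  hence "2 * pi * t \<le> 0" by (simp add: mult_nonneg_nonpos)
  thus ?thesis using False by (intro mult_nonpos_nonpos) auto
qed auto

lemma gamma_weight_nonneg: "gamma_weight a b t \<ge> 0"
  using t_sinh_nonneg[of t] by (simp add: gamma_weight_def)

lemma gamma_weight_pos: "0 < a \<Longrightarrow> 0 < b \<Longrightarrow> t \<noteq> 0 \<Longrightarrow> gamma_weight a b t > 0"
proof -
  assume "0 < a" "0 < b" "t \<noteq> 0"
  moreover have "Gamma (Complex c t) \<noteq> 0" if "c > 0" for c
    using that by (intro Gamma_nonzero) (auto simp: complex_eq_iff elim!: nonpos_Ints_cases)
  moreover have "t * sinh (2 * pi * t) > 0" if "t \<noteq> 0"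
    using that t_sinh_nonneg[of t] by (simp add: less_le)
  ultimately show ?thesis by (simp add: gamma_weight_def)
qed

lemma continuous_on_gamma_weight:
  assumes "0 < a" "0 < b"
  shows "continuous_on A (gamma_weight a b)"
proof -
  have "continuous_on A (\<lambda>t. Gamma (Complex c t))" if "c > 0" for c
  proof (rule continuous_on_compose2[of "{z. Re z > 0}" Gamma A "Complex c"])
    show "continuous_on {z. Re z > 0} (Gamma :: complex \<Rightarrow> complex)"
      by (intro continuous_on_Gamma) (auto elim!: nonpos_Ints_cases)
  qed (use that in \<open>auto intro!: continuous_intros\<close>)
  thus ?thesis using assms unfolding gamma_weight_def
    by (intro continuous_intros) auto
qed

lemma gamma_weight_measurable [measurable]:
  assumes "0 < a" "0 < b"
  shows "gamma_weight a b \<in> borel_measurable borel"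
  by (intro borel_measurable_continuous_onI continuous_on_gamma_weight assms)

lemma gamma_weight_Suc:
  assumes "0 < b"
  shows "gamma_weight a (b + 1) t = (b\<^sup>2 + t\<^sup>2) * gamma_weight a b t"
proof -
  have "Complex b t \<notin> \<int>\<^sub>\<le>\<^sub>0" using assms by (auto simp: complex_eq_iff elim!: nonpos_Ints_cases)
  from Gamma_plus1[OF this] have "Gamma (Complex (b + 1) t) = Complex b t * Gamma (Complex b t)"
    by (simp add: Complex_eq add_ac)
  moreover have "(norm (Complex b t))\<^sup>2 = b\<^sup>2 + t\<^sup>2" by (simp add: cmod_power2)
  ultimately show ?thesis by (simp add: gamma_weight_def norm_mult power_mult_distrib)
qed

lemma abs_sinh_le: "\<bar>sinh x\<bar> \<le> exp \<bar>x :: real\<bar>"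
proof -
  have "\<bar>sinh x\<bar> \<le> (exp x + exp (- x)) / 2"
    unfolding sinh_field_def abs_le_iff using exp_gt_zero[of x] exp_gt_zero[of "-x"] by (simp add: field_simps)
  also have "\<dots> \<le> exp \<bar>x\<bar>"
    by (cases "x \<ge> 0") auto
  finally show ?thesis .
qed

lemma norm_sin_le_exp: "norm (sin (z :: complex)) \<le> exp \<bar>Im z\<bar>"
proof -
  have "norm (sin z) \<le> (norm (exp (\<i> * z)) + norm (exp (- (\<i> * z)))) / 2"
    unfolding sin_exp_eq using norm_triangle_ineq4[of "exp (\<i> * z)" "exp (- (\<i> * z))"]
    by (simp add: norm_divide norm_mult)
  also have "\<dots> \<le> exp \<bar>Im z\<bar>"
    by (cases "Im z \<ge> 0") auto
  finally show ?thesis .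
qed

lemma exp_power_6: "exp (- (pi / 2) * x) ^ 6 * exp (2 * pi * x) = exp (- pi * x)"
proof -
  have "exp (- (pi / 2) * x) ^ 6 = exp (6 * (- (pi / 2) * x))"
    using exp_of_nat_mult[of 6 "- (pi / 2) * x"] by simp
  moreover have "6 * (- (pi / 2) * x) + 2 * pi * x = - pi * x" by simp
  ultimately show ?thesis by (simp only: exp_add[symmetric])
qed

text \<open>Six Gamma factors of rate pi/2 against the growth rate 2 pi of sinh leave a net rate pi;
  the polynomial factors cost an arbitrarily small part of it.\<close>

lemma gamma_weight_bound:
  assumes "0 < a" "0 < b" "\<kappa> < pi"
  shows "\<exists>C>0. \<forall>t. gamma_weight a b t \<le> C * exp (- \<kappa> * \<bar>t\<bar>)"
proof -
  obtain C1 n1 where C1: "C1 > 0" "\<And>t. norm (Gamma (Complex a t)) \<le> C1 * (1 + \<bar>t\<bar>) ^ n1 * exp (- (pi / 2) * \<bar>t\<bar>)"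
    using norm_Gamma_strip_bound[OF assms(1), of a] by auto
  obtain C2 n2 where C2: "C2 > 0" "\<And>t. norm (Gamma (Complex b t)) \<le> C2 * (1 + \<bar>t\<bar>) ^ n2 * exp (- (pi / 2) * \<bar>t\<bar>)"
    using norm_Gamma_strip_bound[OF assms(2), of b] by auto
  have \<kappa>: "0 < pi - \<kappa>" using assms by simp
  obtain K where K: "K > 0" "\<And>t::real. (1 + \<bar>t\<bar>) ^ (n1 * 4 + n2 * 2 + 1) \<le> K * exp ((pi - \<kappa>) * \<bar>t\<bar>)"
    using poly_le_exp[OF \<kappa>] by blast
  show ?thesis
  proof (intro exI[of _ "C1 ^ 4 * C2 ^ 2 * K"] conjI allI)
    fix t :: real
    have "gamma_weight a b t = norm (Gamma (Complex a t)) ^ 4 * norm (Gamma (Complex b t)) ^ 2 * \<bar>t * sinh (2 * pi * t)\<bar>"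
      using t_sinh_nonneg[of t] by (simp add: gamma_weight_def)
    also have "\<dots> \<le> (C1 * (1 + \<bar>t\<bar>) ^ n1 * exp (- (pi / 2) * \<bar>t\<bar>)) ^ 4 * (C2 * (1 + \<bar>t\<bar>) ^ n2 * exp (- (pi / 2) * \<bar>t\<bar>)) ^ 2
        * ((1 + \<bar>t\<bar>) * exp (2 * pi * \<bar>t\<bar>))"
      unfolding abs_mult using C1 C2 abs_sinh_le[of "2 * pi * t"]
      by (intro mult_mono power_mono) (auto simp: abs_mult)
    also have "\<dots> = C1 ^ 4 * C2 ^ 2 * (1 + \<bar>t\<bar>) ^ (n1 * 4 + n2 * 2 + 1) * (exp (- (pi / 2) * \<bar>t\<bar>) ^ 6 * exp (2 * pi * \<bar>t\<bar>))"
      unfolding power_mult power_add power_one_right by algebra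
    also have "\<dots> = C1 ^ 4 * C2 ^ 2 * (1 + \<bar>t\<bar>) ^ (n1 * 4 + n2 * 2 + 1) * exp (- pi * \<bar>t\<bar>)"
      by (simp only: exp_power_6)
    also have "\<dots> \<le> C1 ^ 4 * C2 ^ 2 * (K * exp ((pi - \<kappa>) * \<bar>t\<bar>)) * exp (- pi * \<bar>t\<bar>)"
      using C1 C2 less_imp_le[OF K(1)] by (intro mult_mono K) auto
    also have "\<dots> = C1 ^ 4 * C2 ^ 2 * K * exp (- \<kappa> * \<bar>t\<bar>)"
      by (simp add: algebra_simps flip: exp_add)
    finally show "gamma_weight a b t \<le> C1 ^ 4 * C2 ^ 2 * K * exp (- \<kappa> * \<bar>t\<bar>)" .
  qed (use C1 C2 K in auto)
qed

lemma integrable_gamma_weight: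
  assumes "0 < a" "0 < b"
  shows "integrable lborel (gamma_weight a b)"
proof -
  obtain C where C: "C > 0" "\<And>t. gamma_weight a b t \<le> C * exp (- 1 * \<bar>t\<bar>)"
    using gamma_weight_bound[OF assms, of 1] pi_gt3 by auto
  have "integrable lborel (\<lambda>t. C * exp (- 1 * \<bar>t\<bar>))"
    by (intro integrable_mult_right integrable_exp_abs) auto
  thus ?thesis
    by (rule Bochner_Integration.integrable_bound)
       (use assms C gamma_weight_nonneg[of a b] in \<open>auto intro!: AE_I2\<close>)
qed

lemma tendsto_integral_symmetric:
  fixes f :: "real \<Rightarrow> real"
  assumes "integrable lborel f"
  shows "(\<lambda>n. LINT t:{- real n..real n}|lborel. f t) \<longlonglongrightarrow> (LINT t|lborel. f t)"
  unfolding set_lebesgue_integral_def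
proof (rule integral_dominated_convergence)
  show "integrable lborel (\<lambda>t. norm (f t))" using assms by simp
  show "AE t in lborel. (\<lambda>n. indicat_real {- real n..real n} t *\<^sub>R f t) \<longlonglongrightarrow> f t"
  proof (intro AE_I2 tendsto_eventually)
    fix t :: real
    obtain N :: nat where "real N \<ge> \<bar>t\<bar>" using real_arch_simple by blast
    thus "eventually (\<lambda>n. indicat_real {- real n..real n} t *\<^sub>R f t = f t) sequentially"
      by (intro eventually_sequentiallyI[of N]) (auto simp: indicator_def)
  qed
qed (use assms in \<open>auto simp: indicator_def intro!: AE_I2\<close>)

text \<open>The integrand below is odd about the line \<open>Re s = 1/2\<close>, so its integral over that line
  vanishes; moving the line to \<open>Re s = 0\<close> gives a linear relation between two integrals.\<close>

lemma gamma_weight_shift: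
  assumes a: "0 < a" and b: "0 < b"
  shows "(LINT t|lborel. gamma_weight a (b + 1) t) = (a + b)\<^sup>2 * (LINT t|lborel. gamma_weight a b t)"
proof -
  \<comment> \<open>The strip 0 \<le> Re s \<le> 1 can be widened by this amount without meeting a
    pole of the Gamma factors.\<close>
  define \<mu> where "\<mu> = min a b"
  define S where "S = {s :: complex. Re s > - \<mu>} \<inter> {s. Re s < 1 + \<mu>}"
  \<comment> \<open>Under s -> 1 - s the Gamma factors of each pair swap and the sine changes sign.
    On Re s = 0 the functional equation splits off (a - s)^2 (b - s), and what remains is the weight
    up to the factor t.\<close>
  define \<Theta> where "\<Theta> = (\<lambda>s::complex. sin (2 * of_real pi * s) * (Gamma (of_real a + s) * Gamma (of_real (a + 1) - s)) ^ 2
     * (Gamma (of_real b + s) * Gamma (of_real (b + 1) - s)))"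
  have \<mu>: "\<mu> > 0" "\<mu> \<le> a" "\<mu> \<le> b" using a b by (auto simp: \<mu>_def)
  have S: "open S" "convex S"
    unfolding S_def by (intro open_Int convex_Int open_halfspace_Re_gt open_halfspace_Re_lt convex_halfspace_Re_gt convex_halfspace_Re_lt)+
  have hol: "\<Theta> holomorphic_on S"
  proof -
    have np: "z \<notin> \<int>\<^sub>\<le>\<^sub>0" if "Re z > 0" for z :: complex
      using that by (auto elim!: nonpos_Ints_cases)
    have h1: "(\<lambda>s. Gamma (of_real c + s)) holomorphic_on S" if "c \<ge> \<mu>" for c
      using that by (intro holomorphic_Gamma' holomorphic_intros np) (auto simp: S_def)
    have h2: "(\<lambda>s. Gamma (of_real (c + 1) - s)) holomorphic_on S" if "c \<ge> \<mu>" for c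
      using that by (intro holomorphic_Gamma' holomorphic_intros np) (auto simp: S_def)
    have h3: "(\<lambda>s. sin (2 * of_real pi * s)) holomorphic_on S" by (intro holomorphic_intros)
    show ?thesis unfolding \<Theta>_def by (intro holomorphic_on_mult holomorphic_on_power h1 h2 h3 \<mu>)
  qed
  \<comment> \<open>A primitive on the convex strip replaces contour integrals: integrals along
    paths become differences of F.\<close>
  obtain F where F0: "\<And>s. s \<in> S \<Longrightarrow> (F has_field_derivative \<Theta> s) (at s within S)"
    using holomorphic_convex_primitive'[OF S(2,1) hol] by metis
  have F: "(F has_field_derivative \<Theta> s) (at s)" if "s \<in> S" for s
    using F0[OF that] at_within_open[OF that S(1)] by simp
  \<comment> \<open>Oddness of \<Theta> makes F s - F (1 - s) constant, and the fixed point s = 1/2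
    shows that the constant is 0.\<close>
  have F_sym: "F (1 - s) = F s" if s: "s \<in> S" for s
  proof -
    have "\<exists>c. \<forall>s\<in>S. F s - F (1 - s) = c"
    proof (rule has_field_derivative_zero_constant)
      fix s assume s: "s \<in> S"
      hence s': "1 - s \<in> S" by (auto simp: S_def)
      have "\<Theta> (1 - s) = - \<Theta> s"
      proof -
        have "sin (2 * of_real pi * (1 - s)) = sin (of_real (2 * pi) - 2 * of_real pi * s)" by (simp add: algebra_simps)
        also have "\<dots> = - sin (2 * of_real pi * s)" unfolding sin_diff sin_of_real cos_of_real by simp
        finally have 1: "sin (2 * of_real pi * (1 - s)) = - sin (2 * of_real pi * s)" .
        have 2: "of_real (c + 1) - (1 - s) = of_real c + s" "of_real c + (1 - s) = of_real (c + 1) - s" for c :: real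
          by simp_all
        show ?thesis
          unfolding \<Theta>_def 1 2 by (simp only: mult_ac mult_minus_left mult_minus_right)
      qed
      moreover have "((\<lambda>s. F (1 - s)) has_field_derivative \<Theta> (1 - s) * (0 - 1)) (at s)"
        by (rule DERIV_chain2[where f = F and g = "\<lambda>s. 1 - s"], rule F[OF s']) (intro derivative_intros)
      ultimately have "((\<lambda>s. F s - F (1 - s)) has_field_derivative \<Theta> s - \<Theta> s) (at s)"
        by (intro DERIV_diff F s) simp
      thus "((\<lambda>s. F s - F (1 - s)) has_field_derivative 0) (at s within S)"
        by (simp add: has_field_derivative_at_within)
    qed (use S in auto)
    then obtain c where c: "\<And>s. s \<in> S \<Longrightarrow> F s - F (1 - s) = c" by auto
    have "F (1/2) - F (1 - 1/2) = c" using \<mu> by (intro c) (auto simp: S_def)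
    thus ?thesis using c[OF s] by simp
  qed
  obtain C n where C: "C > 0" "\<And>x t. x \<in> {\<mu>..a+b+1} \<Longrightarrow> norm (Gamma (Complex x t)) \<le> C * (1 + \<bar>t\<bar>) ^ n * exp (- (pi / 2) * \<bar>t\<bar>)"
    using norm_Gamma_strip_bound[OF \<mu>(1), of "a+b+1"] by metis
  obtain K where K: "K > 0" "\<And>t::real. (1 + \<bar>t\<bar>) ^ (6 * n) \<le> K * exp (1 * \<bar>t\<bar>)"
    using poly_le_exp[of 1] by auto
  have \<Theta>_bound: "norm (\<Theta> s) \<le> C ^ 6 * K * exp (- \<bar>Im s\<bar>)" if "Re s \<in> {0..1/2}" for s
  proof -
    define g where "g = C * (1 + \<bar>Im s\<bar>) ^ n * exp (- (pi / 2) * \<bar>Im s\<bar>)"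
    have g: "norm (Gamma z) \<le> g" if "Re z \<in> {\<mu>..a+b+1}" "\<bar>Im z\<bar> = \<bar>Im s\<bar>" for z
      using C(2)[of "Re z" "Im z"] that by (simp add: g_def)
    have "g \<ge> 0" using C by (simp add: g_def)
    have "norm (\<Theta> s) = norm (sin (2 * of_real pi * s)) * (norm (Gamma (of_real a + s)) * norm (Gamma (of_real (a + 1) - s))) ^ 2
     * (norm (Gamma (of_real b + s)) * norm (Gamma (of_real (b + 1) - s)))"
      by (simp add: \<Theta>_def norm_mult norm_power)
    also have "\<dots> \<le> exp (2 * pi * \<bar>Im s\<bar>) * (g * g) ^ 2 * (g * g)"
    proof -
      have sin: "norm (sin (2 * of_real pi * s)) \<le> exp (2 * pi * \<bar>Im s\<bar>)"
        using norm_sin_le_exp[of "2 * of_real pi * s"] by (simp add: abs_mult)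
      have "norm (Gamma (of_real a + s)) \<le> g" "norm (Gamma (of_real (a + 1) - s)) \<le> g"
        "norm (Gamma (of_real b + s)) \<le> g" "norm (Gamma (of_real (b + 1) - s)) \<le> g"
        using that \<mu> a b by (intro g; simp)+
      thus ?thesis using sin \<open>g \<ge> 0\<close>
        by (intro mult_mono power_mono mult_nonneg_nonneg zero_le_power norm_ge_zero exp_ge_zero) assumption+
    qed
    also have "\<dots> = exp (2 * pi * \<bar>Im s\<bar>) * g ^ 6" by algebra
    also have "\<dots> = C ^ 6 * (1 + \<bar>Im s\<bar>) ^ (6 * n) * (exp (- (pi / 2) * \<bar>Im s\<bar>) ^ 6 * exp (2 * pi * \<bar>Im s\<bar>))"
      unfolding g_def power_mult_distrib mult.commute[of 6 n] power_mult by simp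
    also have "\<dots> = C ^ 6 * (1 + \<bar>Im s\<bar>) ^ (6 * n) * exp (- pi * \<bar>Im s\<bar>)"
      by (simp only: exp_power_6)
    also have "\<dots> \<le> C ^ 6 * (K * exp (1 * \<bar>Im s\<bar>)) * exp (- 2 * \<bar>Im s\<bar>)"
      using C K(1) pi_gt3 by (intro mult_mono K) (auto intro!: mult_right_mono)
    also have "\<dots> = C ^ 6 * K * exp (- \<bar>Im s\<bar>)"
      by (simp flip: exp_add)
    finally show ?thesis .
  qed
  define D where "D = (\<lambda>T::real. F (\<i> * of_real T) - F (- \<i> * of_real T))"
  \<comment> \<open>D T is the integral over the segment from -iT to iT. On the line Re s = 1/2 the
    corresponding endpoints are exchanged by s -> 1 - s, where F agrees, so only the two horizontal
    pieces of length 1/2 contribute.\<close>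
  have D_bound: "norm (D T) \<le> C ^ 6 * K * exp (- \<bar>T\<bar>)" for T
  proof -
    have hor: "norm (F (1 / 2 + \<i> * of_real t) - F (\<i> * of_real t)) \<le> C ^ 6 * K * exp (- \<bar>t\<bar>) * norm (1 / 2 + \<i> * of_real t - \<i> * of_real t)" for t
    proof (rule field_differentiable_bound)
      show "convex ({s. Re s \<ge> 0} \<inter> {s. Re s \<le> 1 / 2} \<inter> {s. Im s \<ge> t} \<inter> {s. Im s \<le> t})"
        by (intro convex_Int convex_halfspace_Re_ge convex_halfspace_Re_le convex_halfspace_Im_ge convex_halfspace_Im_le)
    next
      fix s assume "s \<in> {s. Re s \<ge> 0} \<inter> {s. Re s \<le> 1 / 2} \<inter> {s. Im s \<ge> t} \<inter> {s. Im s \<le> t}"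
      thus "(F has_field_derivative \<Theta> s) (at s within {s. Re s \<ge> 0} \<inter> {s. Re s \<le> 1 / 2} \<inter> {s. Im s \<ge> t} \<inter> {s. Im s \<le> t})"
        "norm (\<Theta> s) \<le> C ^ 6 * K * exp (- \<bar>t\<bar>)"
        using \<mu> \<Theta>_bound[of s] by (auto intro!: has_field_derivative_at_within[OF F] simp: S_def)
    qed auto
    have "F (1 - (1 / 2 + \<i> * of_real T)) = F (1 / 2 + \<i> * of_real T)"
      using \<mu> by (intro F_sym) (auto simp: S_def)
    hence eq: "F (1 / 2 + \<i> * of_real (- T)) = F (1 / 2 + \<i> * of_real T)" by (simp add: algebra_simps)
    have "D T = (F (1 / 2 + \<i> * of_real (-T)) - F (\<i> * of_real (-T))) - (F (1 / 2 + \<i> * of_real T) - F (\<i> * of_real T))"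
      unfolding eq by (simp add: D_def)
    hence "norm (D T) \<le> norm (F (1 / 2 + \<i> * of_real (-T)) - F (\<i> * of_real (-T))) + norm (F (1 / 2 + \<i> * of_real T) - F (\<i> * of_real T))"
      by (simp only: norm_triangle_ineq4 order_refl)
    also have "\<dots> \<le> C ^ 6 * K * exp (- \<bar>T\<bar>)" using hor[of T] hor[of "-T"] by simp
    finally show ?thesis .
  qed
  define w where "w = gamma_weight a b"
  \<comment> \<open>Im ((a - it)^2 (b - it)) = t (t^2 - e), and t^2 - e = (b^2 + t^2) - (a + b)^2:
    the first summand raises b by one, the second is the factor claimed.\<close>
  define e where "e = a\<^sup>2 + 2 * a * b"
  define h where "h = (\<lambda>t. w t * (t\<^sup>2 - e))"
  have Im_\<Theta>: "Im (\<i> * \<Theta> (\<i> * of_real t)) = - h t" for t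
  proof -
    define Ga Gb where "Ga = Gamma (Complex a t)" and "Gb = Gamma (Complex b t)"
    have 1: "Gamma (of_real (c + 1) - \<i> * of_real t) = Complex c (- t) * cnj (Gamma (Complex c t))" if "c > 0" for c
    proof -
      have cnj: "cnj (Complex c t) = Complex c (- t)" by (simp add: complex_eq_iff)
      have "Complex c (- t) \<notin> \<int>\<^sub>\<le>\<^sub>0" using that by (auto simp: complex_eq_iff elim!: nonpos_Ints_cases)
      hence "Gamma (Complex c (-t) + 1) = Complex c (- t) * Gamma (Complex c (- t))" by (rule Gamma_plus1)
      also have "Complex c (-t) + 1 = of_real (c + 1) - \<i> * of_real t" by (simp add: complex_eq_iff)
      finally show ?thesis by (simp add: cnj_Gamma cnj)
    qed
    have 2: "of_real c + \<i> * of_real t = Complex c t" for c by (simp add: complex_eq_iff)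
    have 3: "sin (2 * of_real pi * (\<i> * of_real t)) = \<i> * of_real (sinh (2 * pi * t))"
      using sin_i_times_of_real[of "2 * pi * t"] by (simp add: mult_ac)
    have "\<Theta> (\<i> * of_real t) = \<i> * of_real (sinh (2 * pi * t)) * (Ga * (Complex a (-t) * cnj Ga)) ^ 2 * (Gb * (Complex b (-t) * cnj Gb))"
      unfolding \<Theta>_def 1[OF a] 1[OF b] 2 3 Ga_def Gb_def ..
    also have "\<dots> = \<i> * of_real (sinh (2 * pi * t)) * ((Ga * cnj Ga) ^ 2 * (Gb * cnj Gb)) * (Complex a (-t) ^ 2 * Complex b (-t))"
      by (simp add: power_mult_distrib mult_ac)
    also have "\<dots> = \<i> * of_real (sinh (2 * pi * t) * (norm Ga ^ 4 * norm Gb ^ 2)) * (Complex a (-t) ^ 2 * Complex b (-t))"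
      unfolding complex_norm_square[symmetric] by (simp flip: power_mult)
    finally have "\<i> * \<Theta> (\<i> * of_real t) = - of_real (sinh (2 * pi * t) * (norm Ga ^ 4 * norm Gb ^ 2)) * (Complex a (-t) ^ 2 * Complex b (-t))"
      by (metis (no_types, lifting) i_squared mult.assoc mult_minus1)
    hence "Im (\<i> * \<Theta> (\<i> * of_real t)) = - (sinh (2 * pi * t) * (norm Ga ^ 4 * norm Gb ^ 2)) * Im (Complex a (-t) ^ 2 * Complex b (-t))"
      by (simp only: Im_complex_of_real Re_complex_of_real uminus_complex.sel times_complex.sel)
    also have "Im (Complex a (-t) ^ 2 * Complex b (-t)) = t * (t\<^sup>2 - e)"
      by (simp add: e_def power2_eq_square algebra_simps)
    finally show ?thesis by (simp add: h_def w_def gamma_weight_def Ga_def Gb_def mult_ac)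
  qed
  have int_w: "integrable lborel w" unfolding w_def by (intro integrable_gamma_weight a b)
  have int_w1: "integrable lborel (gamma_weight a (b + 1))" using a b by (intro integrable_gamma_weight) auto
  have h_eq: "h t = gamma_weight a (b + 1) t - (a + b)\<^sup>2 * w t" for t
    unfolding gamma_weight_Suc[OF b] by (simp add: h_def w_def e_def power2_eq_square algebra_simps)
  have int_h: "integrable lborel h"
    unfolding h_eq[abs_def] using int_w int_w1 by auto
  have ImD: "Im (D T) = - (LINT t:{-T..T}|lborel. h t)" if "T \<ge> 0" for T
  proof -
    have "((\<lambda>t. \<i> * \<Theta> (\<i> * of_real t)) has_integral (F (\<i> * of_real T) - F (\<i> * of_real (-T)))) {-T..T}"
    proof (rule fundamental_theorem_of_calculus)
      fix t assume "t \<in> {-T..T}"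
      have "\<i> * of_real t \<in> S" using \<mu> by (auto simp: S_def)
      hence "((\<lambda>z. F (\<i> * z)) has_field_derivative \<Theta> (\<i> * of_real t) * (\<i> * 1)) (at (of_real t))"
        by (intro DERIV_chain2[where f = F and g = "\<lambda>z. \<i> * z"] F DERIV_cmult DERIV_ident)
      hence "((\<lambda>t. F (\<i> * of_real t)) has_vector_derivative (\<Theta> (\<i> * of_real t) * (\<i> * 1))) (at t within {-T..T})"
        by (rule has_vector_derivative_real_field)
      thus "((\<lambda>t. F (\<i> * of_real t)) has_vector_derivative (\<i> * \<Theta> (\<i> * of_real t))) (at t within {-T..T})"
        by (simp add: mult.commute)
    qed (use that in auto)
    from has_integral_Im[OF this] have "((\<lambda>t. - h t) has_integral Im (D T)) {-T..T}"
      unfolding Im_\<Theta> by (simp add: D_def)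
    hence "(h has_integral - Im (D T)) {-T..T}"
      using has_integral_neg[of "\<lambda>t. - h t"] by simp
    moreover have "set_integrable lborel {-T..T} h" 
      unfolding set_integrable_def by (intro integrable_mult_indicator int_h) auto
    ultimately show ?thesis
      using set_borel_integral_eq_integral[of "{-T..T}" h] by (simp add: has_integral_integrable_integral)
  qed
  have "(\<lambda>n. D (real n)) \<longlonglongrightarrow> 0"
  proof (rule Lim_null_comparison)
    show "(\<lambda>n. C ^ 6 * K * exp (- \<bar>real n\<bar>)) \<longlonglongrightarrow> 0"
      by real_asymp
    show "eventually (\<lambda>n. norm (D (real n)) \<le> C ^ 6 * K * exp (- \<bar>real n\<bar>)) sequentially"
      by (intro always_eventually allI D_bound)
  qed
  hence lim1: "(\<lambda>n. - Im (D (real n))) \<longlonglongrightarrow> - Im 0" by (intro tendsto_intros)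
  have lim2: "(\<lambda>n. - Im (D (real n))) \<longlonglongrightarrow> (LINT t|lborel. h t)"
    using tendsto_integral_symmetric[OF int_h] by (simp add: ImD)
  have "(LINT t|lborel. h t) = 0"
    using LIMSEQ_unique[OF lim2 lim1] by simp
  moreover have "(LINT t|lborel. h t) = (LINT t|lborel. gamma_weight a (b + 1) t) - (a + b)\<^sup>2 * (LINT t|lborel. w t)"
    unfolding h_eq using int_w int_w1 by simp
  ultimately show ?thesis by (simp add: w_def)
qed

section \<open>The moment functional\<close>

definition wmass :: "real \<Rightarrow> nat \<Rightarrow> real" where
  "wmass \<beta> k = (LINT t|lborel. gamma_weight (2 * \<beta> - 1 / 2) (3 / 2 - \<beta> + real k) t)"

text \<open>The denominator turns |Gamma(3/2 - \<beta> + it)|^2 into |Gamma(1/2 - \<beta> + it)|^2,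
  so this is the continuous dual Hahn weight with third parameter 1/2 - \<beta> < 0. The constant in
  front makes the first Newton moment \<beta>^2.\<close>

definition dens :: "real \<Rightarrow> real \<Rightarrow> real" where
  "dens \<beta> t = \<beta>\<^sup>2 / wmass \<beta> 0 * gamma_weight (2 * \<beta> - 1 / 2) (3 / 2 - \<beta>) t / (t\<^sup>2 + (\<beta> - 1 / 2)\<^sup>2)"

lemma wmass_Suc:
  assumes "1 / 2 < \<beta>" "\<beta> < 1"
  shows "wmass \<beta> (Suc k) = (\<beta> + real (Suc k))\<^sup>2 * wmass \<beta> k"
  using gamma_weight_shift[of "2 * \<beta> - 1 / 2" "3 / 2 - \<beta> + real k"] assms
  by (simp add: wmass_def algebra_simps)

lemma wmass_0_pos:
  assumes "1 / 2 < \<beta>" "\<beta> < 1"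
  shows "wmass \<beta> 0 > 0"
proof -
  define w where "w = gamma_weight (2 * \<beta> - 1 / 2) (3 / 2 - \<beta>)"
  have int: "integrable lborel w" unfolding w_def using assms by (intro integrable_gamma_weight) auto
  have "wmass \<beta> 0 \<ge> 0"
    unfolding wmass_def by (intro integral_nonneg_AE) (auto simp: gamma_weight_nonneg)
  moreover have "wmass \<beta> 0 \<noteq> 0"
  proof
    assume "wmass \<beta> 0 = 0"
    hence "integral\<^sup>L lborel w = 0" by (simp add: wmass_def w_def)
    hence "AE t in lborel. w t = 0"
      using integral_nonneg_eq_0_iff_AE[OF int] by (auto simp: w_def gamma_weight_nonneg)
    moreover have "AE t in lborel. t \<noteq> (0 :: real)" by (rule AE_lborel_singleton)
    ultimately have "AE t in lborel. w t = 0 \<and> t \<noteq> 0" by (rule eventually_conj)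
    moreover have "ae_filter lborel \<noteq> (bot :: real filter)"
      by (simp add: ae_filter_eq_bot_iff emeasure_lborel_UNIV)
    ultimately obtain t where "w t = 0" "t \<noteq> 0" using eventually_happens' by blast
    thus False using gamma_weight_pos[of "2 * \<beta> - 1 / 2" "3 / 2 - \<beta>" t] assms by (simp add: w_def)
  qed
  ultimately show ?thesis by linarith
qed

lemma wmass_pochhammer:
  assumes "1 / 2 < \<beta>" "\<beta> < 1"
  shows "\<beta>\<^sup>2 * wmass \<beta> k = (pochhammer \<beta> (Suc k))\<^sup>2 * wmass \<beta> 0"
proof (induction k)
  case (Suc k)
  have "\<beta>\<^sup>2 * wmass \<beta> (Suc k) = (\<beta> + real (Suc k))\<^sup>2 * (\<beta>\<^sup>2 * wmass \<beta> k)"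
    unfolding wmass_Suc[OF assms] by (simp add: mult_ac)
  also have "\<dots> = ((\<beta> + real (Suc k)) * pochhammer \<beta> (Suc k))\<^sup>2 * wmass \<beta> 0"
    unfolding Suc by (simp add: power_mult_distrib)
  also have "(\<beta> + real (Suc k)) * pochhammer \<beta> (Suc k) = pochhammer \<beta> (Suc (Suc k))"
    unfolding pochhammer_Suc[of _ "Suc k"] by (rule mult.commute)
  finally show ?case .
qed auto

lemma denom_pos: "1 / 2 < \<beta> \<Longrightarrow> t\<^sup>2 + (\<beta> - 1 / 2)\<^sup>2 > (0 :: real)"
  by (intro add_nonneg_pos) auto

text \<open>The first Newton factor cancels the denominator of \<open>dens\<close>; each further one
  is b^2 + t^2 for the current third parameter b and raises b by one. Newton moments thus become
  total masses of shifted weights.\<close>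

lemma newton_poly_spec_dens:
  assumes "1 / 2 < \<beta>" "\<beta> < 1"
  shows "newton_poly \<beta> (Suc k) (spec \<beta> t) * dens \<beta> t =
    \<beta>\<^sup>2 / wmass \<beta> 0 * gamma_weight (2 * \<beta> - 1 / 2) (3 / 2 - \<beta> + real k) t"
proof (induction k)
  case 0
  define d where "d = t\<^sup>2 + (\<beta> - 1 / 2)\<^sup>2"
  have "d > 0" unfolding d_def by (rule denom_pos[OF assms(1)])
  moreover have "newton_poly \<beta> (Suc 0) (spec \<beta> t) = d"
    by (simp add: newton_poly_def spec_def d_def)
  ultimately show ?case by (simp add: dens_def d_def[symmetric])
next
  case (Suc k)
  define b where "b = 3 / 2 - \<beta> + real k"
  have b: "b > 0" using assms by (simp add: b_def)
  have "real (Suc k) * (real (Suc k) + 1 - 2 * \<beta>) - spec \<beta> t = b\<^sup>2 + t\<^sup>2"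
    by (simp add: spec_def b_def power2_eq_square field_simps)
  hence "newton_poly \<beta> (Suc (Suc k)) (spec \<beta> t) * dens \<beta> t =
    (b\<^sup>2 + t\<^sup>2) * (newton_poly \<beta> (Suc k) (spec \<beta> t) * dens \<beta> t)"
    by (simp add: newton_poly_Suc[of \<beta> "Suc k"])
  also have "\<dots> = \<beta>\<^sup>2 / wmass \<beta> 0 * gamma_weight (2 * \<beta> - 1 / 2) (b + 1) t"
    unfolding Suc gamma_weight_Suc[OF b] by (simp add: b_def)
  also have "b + 1 = 3 / 2 - \<beta> + real (Suc k)" by (simp add: b_def)
  finally show ?case .
qed

lemma dens_nonneg: "1 / 2 < \<beta> \<Longrightarrow> \<beta> < 1 \<Longrightarrow> dens \<beta> t \<ge> 0"
  unfolding dens_def using wmass_0_pos[of \<beta>] gamma_weight_nonneg[of "2 * \<beta> - 1 / 2" "3 / 2 - \<beta>" t] denom_pos[of \<beta> t]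
  by (intro divide_nonneg_pos mult_nonneg_nonneg) auto

lemma dens_measurable:
  assumes "1 / 2 < \<beta>" "\<beta> < 1"
  shows "dens \<beta> \<in> borel_measurable borel"
proof -
  have "gamma_weight (2 * \<beta> - 1 / 2) (3 / 2 - \<beta>) \<in> borel_measurable borel"
    using assms by (intro gamma_weight_measurable) auto
  thus ?thesis unfolding dens_def[abs_def] by measurable
qed

lemma dens_bound:
  assumes "1 / 2 < \<beta>" "\<beta> < 1" "\<kappa> < pi"
  shows "\<exists>C>0. \<forall>t. dens \<beta> t \<le> C * exp (- \<kappa> * \<bar>t\<bar>)"
proof -
  obtain C where C: "C > 0" "\<And>t. gamma_weight (2 * \<beta> - 1 / 2) (3 / 2 - \<beta>) t \<le> C * exp (- \<kappa> * \<bar>t\<bar>)"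
    using gamma_weight_bound[of "2 * \<beta> - 1 / 2" "3 / 2 - \<beta>" \<kappa>] assms by auto
  define d where "d = (\<beta> - 1 / 2)\<^sup>2"
  have d: "d > 0" using assms by (simp add: d_def)
  have W: "wmass \<beta> 0 > 0" using assms by (intro wmass_0_pos)
  show ?thesis
  proof (intro exI[of _ "\<beta>\<^sup>2 / wmass \<beta> 0 * C / d"] conjI allI)
    fix t :: real
    have "dens \<beta> t \<le> \<beta>\<^sup>2 / wmass \<beta> 0 * (C * exp (- \<kappa> * \<bar>t\<bar>)) / d"
      unfolding dens_def d_def[symmetric] using W C d gamma_weight_nonneg
      by (intro frac_le mult_left_mono mult_nonneg_nonneg) auto
    thus "dens \<beta> t \<le> \<beta>\<^sup>2 / wmass \<beta> 0 * C / d * exp (- \<kappa> * \<bar>t\<bar>)" by (simp add: mult_ac)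
  qed (use W C d assms in auto)
qed

text \<open>The class of functions to be integrated against \<open>dens\<close>. Every positive rate
  is demanded, rather than one fixed rate, so that halving the rate shows closure under
  products.\<close>

definition subexp :: "(real \<Rightarrow> real) \<Rightarrow> bool" where
  "subexp g \<longleftrightarrow> g \<in> borel_measurable borel \<and> (\<forall>e>0. \<exists>C. \<forall>t. \<bar>g t\<bar> \<le> C * exp (e * \<bar>t\<bar>))"

lemma subexpI:
  assumes "g \<in> borel_measurable borel" "\<And>e. e > 0 \<Longrightarrow> \<exists>C. \<forall>t. \<bar>g t\<bar> \<le> C * exp (e * \<bar>t\<bar>)"
  shows "subexp g"
  using assms by (auto simp: subexp_def)

lemma subexp_bounded:
  assumes "g \<in> borel_measurable borel" "\<And>t. \<bar>g t\<bar> \<le> C"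
  shows "subexp g"
proof (rule subexpI)
  fix e :: real assume "e > 0"
  show "\<exists>C. \<forall>t. \<bar>g t\<bar> \<le> C * exp (e * \<bar>t\<bar>)"
  proof (intro exI allI)
    fix t
    have "C \<ge> 0" using assms(2)[of t] by linarith
    have "\<bar>g t\<bar> \<le> C * 1" using assms(2)[of t] by simp
    also have "\<dots> \<le> C * exp (e * \<bar>t\<bar>)" using \<open>C \<ge> 0\<close> \<open>e > 0\<close> by (intro mult_left_mono) auto
    finally show "\<bar>g t\<bar> \<le> C * exp (e * \<bar>t\<bar>)" .
  qed
qed fact

lemma subexp_const [intro]: "subexp (\<lambda>_. c)"
  by (rule subexp_bounded) auto

lemma subexp_square [intro]: "subexp (\<lambda>t. t\<^sup>2)"
proof (rule subexpI)
  fix e :: real assume e: "e > 0"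
  obtain K where K: "\<And>t::real. (1 + \<bar>t\<bar>) ^ 2 \<le> K * exp (e * \<bar>t\<bar>)" using poly_le_exp[OF e] by blast
  have "\<bar>t\<^sup>2\<bar> \<le> K * exp (e * \<bar>t\<bar>)" for t
    using K[of t] by (simp add: power2_eq_square algebra_simps)
  thus "\<exists>C. \<forall>t. \<bar>t\<^sup>2\<bar> \<le> C * exp (e * \<bar>t\<bar>)" by blast
qed auto

lemma subexp_add [intro]:
  assumes "subexp f" "subexp g"
  shows "subexp (\<lambda>t. f t + g t)"
proof (rule subexpI)
  show "(\<lambda>t. f t + g t) \<in> borel_measurable borel" using assms by (auto simp: subexp_def)
  fix e :: real assume "e > 0"
  then obtain C D where "\<And>t. \<bar>f t\<bar> \<le> C * exp (e * \<bar>t\<bar>)" "\<And>t. \<bar>g t\<bar> \<le> D * exp (e * \<bar>t\<bar>)"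
    using assms by (auto simp: subexp_def) metis
  hence "\<bar>f t + g t\<bar> \<le> (C + D) * exp (e * \<bar>t\<bar>)" for t
    unfolding distrib_right using abs_triangle_ineq[of "f t" "g t"] add_mono order_trans by blast
  thus "\<exists>C. \<forall>t. \<bar>f t + g t\<bar> \<le> C * exp (e * \<bar>t\<bar>)" by blast
qed

lemma subexp_mult [intro]:
  assumes "subexp f" "subexp g"
  shows "subexp (\<lambda>t. f t * g t)"
proof (rule subexpI)
  show "(\<lambda>t. f t * g t) \<in> borel_measurable borel" using assms by (auto simp: subexp_def)
  fix e :: real assume "e > 0"
  hence "e / 2 > 0" by simp
  then obtain C D where CD: "\<And>t. \<bar>f t\<bar> \<le> C * exp (e / 2 * \<bar>t\<bar>)" "\<And>t. \<bar>g t\<bar> \<le> D * exp (e / 2 * \<bar>t\<bar>)"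
    using assms unfolding subexp_def by metis
  have "\<bar>f t * g t\<bar> \<le> (C * D) * exp (e * \<bar>t\<bar>)" for t
  proof -
    have "\<bar>f t * g t\<bar> \<le> (C * exp (e / 2 * \<bar>t\<bar>)) * (D * exp (e / 2 * \<bar>t\<bar>))"
      unfolding abs_mult by (intro mult_mono CD order_trans[OF abs_ge_zero CD(1)]) auto
    also have "\<dots> = (C * D) * (exp (e / 2 * \<bar>t\<bar>) * exp (e / 2 * \<bar>t\<bar>))" by (simp only: mult_ac)
    also have "exp (e / 2 * \<bar>t\<bar>) * exp (e / 2 * \<bar>t\<bar>) = exp (e * \<bar>t\<bar>)" by (simp flip: exp_add)
    finally show ?thesis .
  qed
  thus "\<exists>C. \<forall>t. \<bar>f t * g t\<bar> \<le> C * exp (e * \<bar>t\<bar>)" by blast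
qed

lemma subexp_sum [intro]:
  assumes "\<And>i. i \<in> A \<Longrightarrow> subexp (f i)"
  shows "subexp (\<lambda>t. \<Sum>i\<in>A. f i t)"
  using assms by (induction A rule: infinite_finite_induct) auto

lemma subexp_spec [intro]: "subexp (spec \<beta>)"
proof -
  have "subexp (\<lambda>t. - 1 * t\<^sup>2 + - (\<beta> - 1 / 2)\<^sup>2)"
    by (intro subexp_add subexp_mult subexp_const subexp_square)
  also have "(\<lambda>t. - 1 * t\<^sup>2 + - (\<beta> - 1 / 2)\<^sup>2) = spec \<beta>" by (auto simp: spec_def)
  finally show ?thesis .
qed

lemma subexp_newton_poly: "subexp (\<lambda>t. newton_poly \<beta> k (spec \<beta> t))"
proof (induction k)
  case (Suc k)
  have "subexp (\<lambda>t. (real k * (real k + 1 - 2 * \<beta>) + - 1 * spec \<beta> t) * newton_poly \<beta> k (spec \<beta> t))"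
    by (intro subexp_mult subexp_add subexp_const subexp_spec Suc)
  thus ?case by (simp add: newton_poly_Suc)
qed auto

lemma subexp_hahn_poly [intro]: "subexp (\<lambda>t. hahn_poly \<beta> k (spec \<beta> t))"
  unfolding hahn_poly_def by (intro subexp_mult subexp_const subexp_sum subexp_newton_poly)

lemma integrable_subexp_dens:
  assumes "1 / 2 < \<beta>" "\<beta> < 1" "subexp g"
  shows "integrable lborel (\<lambda>t. g t * dens \<beta> t)"
proof -
  obtain C where C: "C > 0" "\<And>t. dens \<beta> t \<le> C * exp (- 3 * \<bar>t\<bar>)"
    using dens_bound[OF assms(1,2), of 3] pi_gt3 by auto
  obtain D where D: "\<And>t. \<bar>g t\<bar> \<le> D * exp (1 * \<bar>t\<bar>)"
    using assms(3) unfolding subexp_def by (metis zero_less_one)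
  have "integrable lborel (\<lambda>t. D * C * exp (- 2 * \<bar>t\<bar>))"
    by (intro integrable_mult_right integrable_exp_abs) auto
  thus ?thesis
  proof (rule Bochner_Integration.integrable_bound)
    show "(\<lambda>t. g t * dens \<beta> t) \<in> borel_measurable lborel"
      using assms(3) dens_measurable[OF assms(1,2)] by (auto simp: subexp_def)
    show "AE t in lborel. norm (g t * dens \<beta> t) \<le> norm (D * C * exp (- 2 * \<bar>t\<bar>))"
    proof (intro AE_I2)
      fix t
      have "norm (g t * dens \<beta> t) = \<bar>g t\<bar> * dens \<beta> t" using dens_nonneg[OF assms(1,2), of t] by (simp add: abs_mult)
      also have "\<dots> \<le> (D * exp (1 * \<bar>t\<bar>)) * (C * exp (- 3 * \<bar>t\<bar>))"
        by (intro mult_mono D C dens_nonneg assms order_trans[OF abs_ge_zero D])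
      also have "\<dots> = D * C * (exp (1 * \<bar>t\<bar>) * exp (- 3 * \<bar>t\<bar>))" by (simp only: mult_ac)
      also have "exp (1 * \<bar>t\<bar>) * exp (- 3 * \<bar>t\<bar>) = exp (- 2 * \<bar>t\<bar>)" by (simp flip: exp_add)
      also have "D * C * exp (- 2 * \<bar>t\<bar>) \<le> norm (D * C * exp (- 2 * \<bar>t\<bar>))" by (metis abs_ge_self real_norm_def)
      finally show "norm (g t * dens \<beta> t) \<le> norm (D * C * exp (- 2 * \<bar>t\<bar>))" .
    qed
  qed
qed

text \<open>The point mass c, fixed only by total mass 1. Its value is never computed by itself: the
  product with \<open>f_beta \<beta> 1\<close> is read off later from the Gauss sum.\<close>

definition mass0 :: "real \<Rightarrow> real" where
  "mass0 \<beta> = 1 - (LINT t|lborel. dens \<beta> t)"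

text \<open>For k = 0 this is the normalisation in \<open>mass0\<close>. For positive k the Newton
  polynomial vanishes at 0, so the point mass is invisible and the shifted total masses give the
  value.\<close>

lemma newton_poly_moment:
  assumes "1 / 2 < \<beta>" "\<beta> < 1"
  shows "mass0 \<beta> * newton_poly \<beta> k 0 + (LINT t|lborel. newton_poly \<beta> k (spec \<beta> t) * dens \<beta> t) = (pochhammer \<beta> k)\<^sup>2"
proof (cases k)
  case 0
  thus ?thesis by (simp add: mass0_def)
next
  case (Suc j)
  have "(LINT t|lborel. newton_poly \<beta> k (spec \<beta> t) * dens \<beta> t) = \<beta>\<^sup>2 / wmass \<beta> 0 * wmass \<beta> j"
    unfolding Suc newton_poly_spec_dens[OF assms] wmass_def[of \<beta> j] by simp
  also have "\<dots> = (\<beta>\<^sup>2 * wmass \<beta> j) / wmass \<beta> 0" by simp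
  also have "\<dots> = (pochhammer \<beta> k)\<^sup>2"
    unfolding wmass_pochhammer[OF assms] Suc using wmass_0_pos[OF assms] by simp
  finally show ?thesis by (simp add: newton_poly_at_0 Suc)
qed

text \<open>The coefficients of A on a coordinate axis, that is, the Taylor coefficients of
  2F1(\<beta>, 1 - 2\<beta>; 2\<beta>; x).\<close>

definition axis_coeff :: "real \<Rightarrow> nat \<Rightarrow> real" where
  "axis_coeff \<beta> n = pochhammer \<beta> n * pochhammer (1 - 2 * \<beta>) n / (pochhammer (2 * \<beta>) n * fact n)"

lemma hahn_poly_dens_moment:
  assumes "1 / 2 < \<beta>" "\<beta> < 1"
  shows "mass0 \<beta> * hyp_coeff \<beta> n + (LINT t|lborel. hahn_poly \<beta> n (spec \<beta> t) * dens \<beta> t) = axis_coeff \<beta> n"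
proof -
  define d where "d = (\<lambda>k. pochhammer (- real n) k / (pochhammer \<beta> k * pochhammer (1 - \<beta>) k * fact k))"
  have int: "integrable lborel (\<lambda>t. newton_poly \<beta> k (spec \<beta> t) * dens \<beta> t)" for k
    by (intro integrable_subexp_dens assms subexp_newton_poly)
  have "(LINT t|lborel. hahn_poly \<beta> n (spec \<beta> t) * dens \<beta> t) =
     (LINT t|lborel. (\<Sum>k\<le>n. hyp_coeff \<beta> n * d k * (newton_poly \<beta> k (spec \<beta> t) * dens \<beta> t)))"
    by (intro Bochner_Integration.integral_cong refl) (simp add: hahn_poly_def d_def sum_distrib_left sum_distrib_right mult_ac)
  also have "\<dots> = (\<Sum>k\<le>n. hyp_coeff \<beta> n * d k * (LINT t|lborel. newton_poly \<beta> k (spec \<beta> t) * dens \<beta> t))"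
    using int by simp
  finally have 1: "(LINT t|lborel. hahn_poly \<beta> n (spec \<beta> t) * dens \<beta> t) =
     (\<Sum>k\<le>n. hyp_coeff \<beta> n * d k * (LINT t|lborel. newton_poly \<beta> k (spec \<beta> t) * dens \<beta> t))" .
  have "mass0 \<beta> * hyp_coeff \<beta> n = mass0 \<beta> * hahn_poly \<beta> n 0" by (simp only: hahn_poly_at_0)
  also have "\<dots> = (\<Sum>k\<le>n. hyp_coeff \<beta> n * d k * (mass0 \<beta> * newton_poly \<beta> k 0))"
    unfolding hahn_poly_def d_def sum_distrib_left by (intro sum.cong refl) (simp only: mult_ac)
  finally have 2: "mass0 \<beta> * hyp_coeff \<beta> n = (\<Sum>k\<le>n. hyp_coeff \<beta> n * d k * (mass0 \<beta> * newton_poly \<beta> k 0))" .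
  have "mass0 \<beta> * hyp_coeff \<beta> n + (LINT t|lborel. hahn_poly \<beta> n (spec \<beta> t) * dens \<beta> t) =
     hyp_coeff \<beta> n * (\<Sum>k\<le>n. d k * (pochhammer \<beta> k)\<^sup>2)"
    unfolding 1 2 sum.distrib[symmetric] distrib_left[symmetric] newton_poly_moment[OF assms]
    by (simp only: sum_distrib_left mult.assoc)
  also have "\<dots> = axis_coeff \<beta> n"
    unfolding d_def axis_coeff_def using assms by (intro hahn_poly_moment) auto
  finally show ?thesis .
qed

lemma subexp_hahn_fun:
  assumes "1 / 2 < \<beta>" "\<beta> < 1" "0 \<le> x" "x < 1"
  shows "subexp (\<lambda>t. hahn_fun \<beta> t x)"
proof -
  obtain C where C: "C > 0" "\<And>t. \<bar>hahn_fun \<beta> t x\<bar> \<le> C * (1 - x) powr ((\<beta> - 1 / 2) / 2)"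
    using hahn_fun_bound[OF assms(1,2)] assms(3,4) by (meson atLeastLessThan_iff)
  show ?thesis
  proof (rule subexp_bounded[OF _ C(2)])
    have "(\<lambda>t. hahn_poly \<beta> n (spec \<beta> t)) \<in> borel_measurable borel" for n
      using subexp_hahn_poly[of \<beta> n] by (simp add: subexp_def)
    thus "(\<lambda>t. hahn_fun \<beta> t x) \<in> borel_measurable borel"
      unfolding hahn_fun_def by measurable
  qed
qed

text \<open>One factor P_n grows in t at a rate below pi/2 and \<open>dens\<close> decays at every
  rate below pi, so a subexponential companion g leaves room for dominated termwise
  integration.\<close>

lemma hahn_series_integral:
  assumes \<beta>: "1 / 2 < \<beta>" "\<beta> < 1" and g: "subexp g" and x: "0 \<le> x" "x < 1"
  shows "(\<lambda>n. (LINT t|lborel. g t * hahn_poly \<beta> n (spec \<beta> t) * dens \<beta> t) * x ^ n) sums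
     (LINT t|lborel. g t * hahn_fun \<beta> t x * dens \<beta> t)"
proof -
  \<comment> \<open>A radius strictly between x and 1, so that the bound on the P_n leaves the
    geometric factor (x/R)^n.\<close>
  define R where "R = (1 + x) / 2"
  have R: "0 < R" "R < 1" "x < R" using x by (auto simp: R_def)
  obtain C \<kappa> where C: "C > 0" "0 \<le> \<kappa>" "\<kappa> < pi / 2" "\<And>t n. \<bar>hahn_poly \<beta> n (spec \<beta> t)\<bar> * R ^ n \<le> C * exp (\<kappa> * \<bar>t\<bar>)"
    using hahn_poly_bound[OF \<beta> R(1,2)] by blast
  \<comment> \<open>The slack is shared by g, by the loss in \<open>dens\<close> and by the
    remaining decay: 3\<delta> + \<kappa> < 3 pi/8 + pi/2 < pi.\<close>
  define \<delta> where "\<delta> = pi / 8"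
  have \<delta>: "\<delta> > 0" by (simp add: \<delta>_def)
  obtain D where D: "\<And>t. \<bar>g t\<bar> \<le> D * exp (\<delta> * \<bar>t\<bar>)" using g \<delta> unfolding subexp_def by metis
  have "pi - \<delta> < pi" using \<delta> by simp
  then obtain K where K: "K > 0" "\<And>t. dens \<beta> t \<le> K * exp (- (pi - \<delta>) * \<bar>t\<bar>)"
    using dens_bound[OF \<beta>] by blast
  define f where "f = (\<lambda>n t. g t * hahn_poly \<beta> n (spec \<beta> t) * dens \<beta> t * x ^ n)"
  have D0: "D \<ge> 0" using order_trans[OF abs_ge_zero D[of 0]] by simp
  have int: "integrable lborel (f n)" for n
    unfolding f_def using g by (intro integrable_mult_left integrable_subexp_dens \<beta>) auto
  have bound: "norm (f n t) \<le> D * C * K * exp (- \<delta> * \<bar>t\<bar>) * (x / R) ^ n" for n t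
  proof -
    have P: "\<bar>hahn_poly \<beta> n (spec \<beta> t)\<bar> \<le> C * exp (\<kappa> * \<bar>t\<bar>) / R ^ n"
      using C(4)[of n t] R by (simp add: field_simps)
    have "norm (f n t) = \<bar>g t\<bar> * \<bar>hahn_poly \<beta> n (spec \<beta> t)\<bar> * dens \<beta> t * x ^ n"
      using dens_nonneg[OF \<beta>, of t] x by (simp add: f_def abs_mult)
    also have "\<dots> \<le> (D * exp (\<delta> * \<bar>t\<bar>)) * (C * exp (\<kappa> * \<bar>t\<bar>) / R ^ n) * (K * exp (- (pi - \<delta>) * \<bar>t\<bar>)) * x ^ n"
      using D0 less_imp_le[OF C(1)] less_imp_le[OF K(1)] R(1) x dens_nonneg[OF \<beta>, of t]
      by (intro mult_mono D P K order_refl) auto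
    also have "\<dots> = D * C * K * (exp (\<delta> * \<bar>t\<bar>) * exp (\<kappa> * \<bar>t\<bar>) * exp (- (pi - \<delta>) * \<bar>t\<bar>)) * (x / R) ^ n"
      by (simp add: power_divide mult_ac)
    also have "\<dots> \<le> D * C * K * exp (- \<delta> * \<bar>t\<bar>) * (x / R) ^ n"
    proof -
      have "\<delta> + \<kappa> + - (pi - \<delta>) \<le> - \<delta>" using C by (simp add: \<delta>_def)
      hence "(\<delta> + \<kappa> + - (pi - \<delta>)) * \<bar>t\<bar> \<le> - \<delta> * \<bar>t\<bar>" by (intro mult_right_mono) auto
      hence "exp (\<delta> * \<bar>t\<bar>) * exp (\<kappa> * \<bar>t\<bar>) * exp (- (pi - \<delta>) * \<bar>t\<bar>) \<le> exp (- \<delta> * \<bar>t\<bar>)"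
        by (simp only: exp_add[symmetric] exp_le_cancel_iff distrib_right)
      thus ?thesis using D0 C(1) K(1) x R(1)
        by (intro mult_right_mono mult_left_mono) auto
    qed
    finally show ?thesis .
  qed
  have int_exp: "integrable lborel (\<lambda>t. exp (- \<delta> * \<bar>t\<bar>))" by (rule integrable_exp_abs[OF \<delta>])
  define E where "E = (LINT t|lborel. exp (- \<delta> * \<bar>t\<bar>))"
  have geom: "summable (\<lambda>n. (x / R) ^ n)" using x R by (intro summable_geometric) auto
  have "(\<lambda>n. integral\<^sup>L lborel (f n)) sums (LINT t|lborel. (\<Sum>n. f n t))"
  proof (rule sums_integral[OF int])
    show "AE t in lborel. summable (\<lambda>n. norm (f n t))"
    proof (rule AE_I2)
      fix t
      have "summable (\<lambda>n. D * C * K * exp (- \<delta> * \<bar>t\<bar>) * (x / R) ^ n)"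
        by (intro summable_mult geom)
      thus "summable (\<lambda>n. norm (f n t))"
        by (rule summable_comparison_test'[where N = 0]) (use bound in simp)
    qed
    show "summable (\<lambda>n. LINT t|lborel. norm (f n t))"
    proof (rule summable_comparison_test'[where N = 0])
      show "summable (\<lambda>n. D * C * K * E * (x / R) ^ n)" by (intro summable_mult geom)
      fix n
      have "(LINT t|lborel. norm (f n t)) \<le> (LINT t|lborel. D * C * K * exp (- \<delta> * \<bar>t\<bar>) * (x / R) ^ n)"
        by (intro integral_mono bound integrable_norm int integrable_mult_left integrable_mult_right int_exp)
      also have "\<dots> = D * C * K * E * (x / R) ^ n" by (simp add: E_def)
      finally show "norm (LINT t|lborel. norm (f n t)) \<le> D * C * K * E * (x / R) ^ n" by simp
    qed
  qed
  also have "(\<lambda>n. integral\<^sup>L lborel (f n)) = (\<lambda>n. (LINT t|lborel. g t * hahn_poly \<beta> n (spec \<beta> t) * dens \<beta> t) * x ^ n)"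
    by (simp add: f_def)
  also have "(\<lambda>t. \<Sum>n. f n t) = (\<lambda>t. g t * hahn_fun \<beta> t x * dens \<beta> t)"
  proof
    fix t
    have "(\<lambda>n. (g t * dens \<beta> t) * (hahn_poly \<beta> n (spec \<beta> t) * x ^ n)) sums ((g t * dens \<beta> t) * hahn_fun \<beta> t x)"
      by (intro sums_mult hahn_fun_sums \<beta> x)
    thus "(\<Sum>n. f n t) = g t * hahn_fun \<beta> t x * dens \<beta> t"
      by (simp add: f_def sums_iff mult_ac)
  qed
  finally show ?thesis .
qed

section \<open>Uniqueness of the coefficients\<close>

definition hahn_functional :: "real \<Rightarrow> (real \<Rightarrow> real) \<Rightarrow> real" where
  "hahn_functional \<beta> g = mass0 \<beta> * g 0 + (LINT t|lborel. g (spec \<beta> t) * dens \<beta> t)"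

lemma hahn_functional_diff:
  assumes "1 / 2 < \<beta>" "\<beta> < 1" "subexp (\<lambda>t. f (spec \<beta> t))" "subexp (\<lambda>t. g (spec \<beta> t))"
  shows "hahn_functional \<beta> (\<lambda>l. c * f l - d * g l) = c * hahn_functional \<beta> f - d * hahn_functional \<beta> g"
proof -
  have int: "integrable lborel (\<lambda>t. f (spec \<beta> t) * dens \<beta> t)" "integrable lborel (\<lambda>t. g (spec \<beta> t) * dens \<beta> t)"
    using assms by (auto intro: integrable_subexp_dens)
  have "(LINT t|lborel. (c * f (spec \<beta> t) - d * g (spec \<beta> t)) * dens \<beta> t) =
     (LINT t|lborel. c * (f (spec \<beta> t) * dens \<beta> t) - d * (g (spec \<beta> t) * dens \<beta> t))"
    by (intro Bochner_Integration.integral_cong refl) (simp add: left_diff_distrib)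
  also have "\<dots> = c * (LINT t|lborel. f (spec \<beta> t) * dens \<beta> t) - d * (LINT t|lborel. g (spec \<beta> t) * dens \<beta> t)"
    using int by simp
  finally show ?thesis by (simp add: hahn_functional_def algebra_simps)
qed

lemma hahn_functional_sum:
  assumes "1 / 2 < \<beta>" "\<beta> < 1" "\<And>i. i \<in> I \<Longrightarrow> subexp (\<lambda>t. f i (spec \<beta> t))" "finite I"
  shows "hahn_functional \<beta> (\<lambda>l. \<Sum>i\<in>I. f i l) = (\<Sum>i\<in>I. hahn_functional \<beta> (f i))"
proof -
  have int: "integrable lborel (\<lambda>t. f i (spec \<beta> t) * dens \<beta> t)" if "i \<in> I" for i
    using assms that by (auto intro: integrable_subexp_dens)
  have "(LINT t|lborel. (\<Sum>i\<in>I. f i (spec \<beta> t)) * dens \<beta> t) = (\<Sum>i\<in>I. LINT t|lborel. f i (spec \<beta> t) * dens \<beta> t)"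
    unfolding sum_distrib_right using int by (rule Bochner_Integration.integral_sum)
  thus ?thesis by (simp add: hahn_functional_def sum.distrib sum_distrib_left)
qed

section \<open>Separation of variables for arrays indexed by triples\<close>

definition ladder :: "real \<Rightarrow> (nat \<Rightarrow> real) \<Rightarrow> nat \<Rightarrow> real" where
  "ladder \<beta> F n = (real n + 1) * (real n + 2 * \<beta>) * F (Suc n) - (real n + \<beta>) * (real n + 1 - \<beta>) * F n"

text \<open>One array Q serves all three directions. For A it is the mixed third difference of B;
  for \<open>hahn_coeff\<close> it is L[\<lambda> P_a P_b P_c], where the common eigenvalue
  \<lambda> is the separation constant.\<close>

definition separated :: "real \<Rightarrow> (nat \<Rightarrow> nat \<Rightarrow> nat \<Rightarrow> real) \<Rightarrow> bool" where
  "separated \<beta> X \<longleftrightarrow> (\<exists>Q. \<forall>a b c. ladder \<beta> (\<lambda>i. X i b c) a = (\<Sum>i\<le>a. Q i b c) \<and>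
     ladder \<beta> (\<lambda>j. X a j c) b = (\<Sum>j\<le>b. Q a j c) \<and> ladder \<beta> (\<lambda>k. X a b k) c = (\<Sum>k\<le>c. Q a b k))"

definition hahn_coeff :: "real \<Rightarrow> nat \<Rightarrow> nat \<Rightarrow> nat \<Rightarrow> real" where
  "hahn_coeff \<beta> a b c = hahn_functional \<beta> (\<lambda>l. hahn_poly \<beta> a l * (hahn_poly \<beta> b l * hahn_poly \<beta> c l))"

lemma hahn_coeff_perm: "hahn_coeff \<beta> a b c = hahn_coeff \<beta> b a c" "hahn_coeff \<beta> a b c = hahn_coeff \<beta> c a b"
  by (simp_all add: hahn_coeff_def mult_ac)

lemma separated_hahn_coeff:
  assumes "1 / 2 < \<beta>" "\<beta> < 1"
  shows "separated \<beta> (hahn_coeff \<beta>)"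
proof -
  define Q where "Q = (\<lambda>a b c. hahn_functional \<beta> (\<lambda>l. l * (hahn_poly \<beta> a l * (hahn_poly \<beta> b l * hahn_poly \<beta> c l))))"
  have main: "ladder \<beta> (\<lambda>i. hahn_coeff \<beta> i b c) a = (\<Sum>i\<le>a. Q i b c)" for a b c
  proof -
    let ?p = "\<lambda>i l. hahn_poly \<beta> i l * (hahn_poly \<beta> b l * hahn_poly \<beta> c l)"
    have se: "subexp (\<lambda>t. ?p i (spec \<beta> t))" for i by (intro subexp_mult subexp_hahn_poly)
    have "ladder \<beta> (\<lambda>i. hahn_coeff \<beta> i b c) a =
      hahn_functional \<beta> (\<lambda>l. ((real a + 1) * (real a + 2 * \<beta>)) * ?p (Suc a) l - ((real a + \<beta>) * (real a + 1 - \<beta>)) * ?p a l)"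
      unfolding ladder_def hahn_coeff_def by (rule hahn_functional_diff[OF assms se se, symmetric])
    also have "(\<lambda>l. ((real a + 1) * (real a + 2 * \<beta>)) * ?p (Suc a) l - ((real a + \<beta>) * (real a + 1 - \<beta>)) * ?p a l) =
       (\<lambda>l. hahn_ladder \<beta> a l * (hahn_poly \<beta> b l * hahn_poly \<beta> c l))"
      by (rule ext) (simp only: hahn_ladder_def left_diff_distrib mult.assoc)
    also have "\<dots> = (\<lambda>l. \<Sum>i\<le>a. l * ?p i l)"
      using assms by (intro ext) (simp add: hahn_ladder_sum sum_distrib_left sum_distrib_right mult_ac)
    also have "hahn_functional \<beta> \<dots> = (\<Sum>i\<le>a. Q i b c)"
      unfolding Q_def by (intro hahn_functional_sum assms subexp_mult subexp_spec se) auto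
    finally show ?thesis .
  qed
  have Q: "Q a b c = Q b a c" "Q a b c = Q c a b" for a b c by (simp_all add: Q_def mult_ac)
  show ?thesis unfolding separated_def
  proof (intro exI allI conjI)
    fix a b c
    show "ladder \<beta> (\<lambda>i. hahn_coeff \<beta> i b c) a = (\<Sum>i\<le>a. Q i b c)" by (rule main)
    show "ladder \<beta> (\<lambda>j. hahn_coeff \<beta> a j c) b = (\<Sum>j\<le>b. Q a j c)"
      using main[of a c b] by (simp only: hahn_coeff_perm(1)[of \<beta> a] Q(1)[of a])
    show "ladder \<beta> (\<lambda>k. hahn_coeff \<beta> a b k) c = (\<Sum>k\<le>c. Q a b k)"
      using main[of a b c] by (simp only: hahn_coeff_perm(2)[of \<beta> a b] Q(2)[of a b])
  qed
qed

lemma hahn_coeff_axis: "1 / 2 < \<beta> \<Longrightarrow> \<beta> < 1 \<Longrightarrow> hahn_coeff \<beta> 0 0 n = axis_coeff \<beta> n"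
  using hahn_poly_dens_moment[of \<beta> n] by (simp add: hahn_coeff_def hahn_functional_def hahn_poly_at_0)

lemma ladder_diff: "ladder \<beta> (\<lambda>n. F n - G n) n = ladder \<beta> F n - ladder \<beta> G n"
  by (simp add: ladder_def algebra_simps)

lemma ladder_zero_imp:
  assumes "\<beta> > 0" "ladder \<beta> F n = 0" "F n = 0"
  shows "F (Suc n) = 0"
proof -
  have "(real n + 1) * (real n + 2 * \<beta>) \<noteq> 0" using assms(1) by auto
  moreover have "(real n + 1) * (real n + 2 * \<beta>) * F (Suc n) = 0" using assms(2,3) by (simp add: ladder_def)
  ultimately show ?thesis by (simp only: mult_eq_0_iff) blast
qed

lemma partial_sums_zero:
  fixes Q :: "nat \<Rightarrow> real"
  assumes "\<And>n. (\<Sum>i\<le>n. Q i) = (0 :: real)"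
  shows "Q n = 0"
proof (cases n)
  case (Suc m)
  thus ?thesis using assms[of "Suc m"] assms[of m] by simp
qed (use assms[of 0] in simp)

text \<open>The difference Z of the two arrays starts from a vanishing row (0, 0, c). The relation
  in c makes Q vanish along any vanishing row, the relation in b then transports the zeros to b + 1,
  and that in a to a + 1.\<close>

lemma separated_unique:
  assumes \<beta>: "\<beta> > 0" and X: "separated \<beta> X" and Y: "separated \<beta> Y" and eq: "\<And>c. X 0 0 c = Y 0 0 c"
  shows "X a b c = Y a b c"
proof -
  obtain Q R where Q: "\<And>a b c. ladder \<beta> (\<lambda>i. X i b c) a = (\<Sum>i\<le>a. Q i b c)"
     "\<And>a b c. ladder \<beta> (\<lambda>j. X a j c) b = (\<Sum>j\<le>b. Q a j c)" "\<And>a b c. ladder \<beta> (\<lambda>k. X a b k) c = (\<Sum>k\<le>c. Q a b k)"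
   and R: "\<And>a b c. ladder \<beta> (\<lambda>i. Y i b c) a = (\<Sum>i\<le>a. R i b c)"
     "\<And>a b c. ladder \<beta> (\<lambda>j. Y a j c) b = (\<Sum>j\<le>b. R a j c)" "\<And>a b c. ladder \<beta> (\<lambda>k. Y a b k) c = (\<Sum>k\<le>c. R a b k)"
    using X Y unfolding separated_def by metis
  define Z S where "Z = (\<lambda>a b c. X a b c - Y a b c)" and "S = (\<lambda>a b c. Q a b c - R a b c)"
  have Z1: "ladder \<beta> (\<lambda>i. Z i b c) a = (\<Sum>i\<le>a. S i b c)" for a b c
    by (simp add: Z_def S_def ladder_diff Q R sum_subtractf)
  have Z2: "ladder \<beta> (\<lambda>j. Z a j c) b = (\<Sum>j\<le>b. S a j c)" for a b c
    by (simp add: Z_def S_def ladder_diff Q R sum_subtractf)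
  have Z3: "ladder \<beta> (\<lambda>k. Z a b k) c = (\<Sum>k\<le>c. S a b k)" for a b c
    by (simp add: Z_def S_def ladder_diff Q R sum_subtractf)
  \<comment> \<open>If Z vanishes along a row in c, so does its ladder there, hence all partial sums
    of S, hence S.\<close>
  have S0: "S a b c = 0" if "\<And>c. Z a b c = 0" for a b c
    by (rule partial_sums_zero[of "S a b"]) (simp add: Z3[symmetric] that ladder_def)
  have Z0: "\<forall>c. Z 0 b c = 0" for b
  proof (induction b rule: less_induct)
    case (less b)
    show ?case
    proof (cases b)
      case 0
      thus ?thesis by (simp add: Z_def eq)
    next
      case (Suc m)
      have "Z 0 (Suc m) c = 0" for c
      proof (rule ladder_zero_imp[OF \<beta>])
        show "ladder \<beta> (\<lambda>j. Z 0 j c) m = 0"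
          unfolding Z2 using less Suc by (intro sum.neutral ballI S0) auto
      qed (use less Suc in auto)
      thus ?thesis by (simp add: Suc)
    qed
  qed
  have "\<forall>b c. Z a b c = 0"
  proof (induction a rule: less_induct)
    case (less a)
    show ?case
    proof (cases a)
      case 0
      thus ?thesis using Z0 by simp
    next
      case (Suc m)
      have "Z (Suc m) b c = 0" for b c
      proof (rule ladder_zero_imp[OF \<beta>])
        show "ladder \<beta> (\<lambda>i. Z i b c) m = 0"
          unfolding Z1 using less Suc by (intro sum.neutral ballI S0) auto
      qed (use less Suc in auto)
      thus ?thesis by (simp add: Suc)
    qed
  qed
  thus ?thesis by (simp add: Z_def)
qed

section \<open>Identification of the neighbor coefficients with the moments of L\<close>

definition ix :: "int \<Rightarrow> int \<Rightarrow> int \<Rightarrow> int ^ 3" where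
  "ix a b c = vector [a, b, c]"

lemma ix_nth [simp]: "ix a b c $ 1 = a" "ix a b c $ 2 = b" "ix a b c $ 3 = c"
  by (simp_all add: ix_def)

lemma ix_shift [simp]:
  "ix a b c + axis 1 1 = ix (1 + a) b c" "ix a b c + axis 2 1 = ix a (1 + b) c" "ix a b c + axis 3 1 = ix a b (1 + c)"
  "ix a b c - axis 1 1 = ix (a - 1) b c" "ix a b c - axis 2 1 = ix a (b - 1) c" "ix a b c - axis 3 1 = ix a b (c - 1)"
  by (simp_all add: vec_eq_iff forall_3 axis_def)

lemma ix_in_nat_index: "ix a b c \<in> nat_index \<longleftrightarrow> 0 \<le> a \<and> 0 \<le> b \<and> 0 \<le> c"
  by (auto simp: nat_index_def forall_3)

lemma UNIV_3_perm: "{2, 3, 1} = (UNIV :: 3 set)" "{1, 3, 2} = (UNIV :: 3 set)" "{1, 2, 3} = (UNIV :: 3 set)"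
  by (auto simp: UNIV_3)

lemma sum_telescope_int:
  fixes f :: "int \<Rightarrow> real"
  assumes "f (- 1) = 0"
  shows "(\<Sum>i\<le>n. f (int i) - f (int i - 1)) = f (int n)"
  by (induction n) (use assms in auto)

lemma neighbor_coeffs_eq_hahn_coeff:
  assumes \<beta>: "1 / 2 < \<beta>" "\<beta> < 1" and AB: "neighbor_coeffs \<beta> A B"
  shows "A (ix (int a) (int b) (int c)) = hahn_coeff \<beta> a b c"
proof -
  define X where "X = (\<lambda>a b c. A (ix (int a) (int b) (int c)))"
  define b where "b = (\<lambda>x y z. B (ix x y z))"
  have zero: "A (ix x y z) = 0" "b x y z = 0" if "x < 0 \<or> y < 0 \<or> z < 0" for x y z
    using AB that unfolding neighbor_coeffs_def b_def by (auto simp: ix_in_nat_index)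
  have Bb: "B (ix x y z) = b x y z" for x y z by (simp add: b_def)
  have A0: "A (ix 0 0 0) = 1"
  proof -
    have "ix 0 0 0 = 0" by (simp add: vec_eq_iff forall_3)
    thus ?thesis using AB by (simp add: neighbor_coeffs_def)
  qed
  have eqs: "(of_int (n $ l) + 1) * (of_int (n $ l) + 2 * \<beta>) * A (n + axis l 1)
          - (of_int (n $ l) + \<beta>) * (of_int (n $ l) + 1 - \<beta>) * A n
        = B n - B (n - axis j 1) - B (n - axis k 1) + B (n - axis j 1 - axis k 1)"
       "(2 * of_int (n $ j) * of_int (n $ k)
           + \<beta> * of_int (n $ j) + \<beta> * of_int (n $ k) + \<beta> * of_int (n $ l) + \<beta>\<^sup>2) * A n
        = B (n - axis l 1 - axis j 1) + B (n - axis l 1 - axis k 1)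
          - B n - B (n - axis j 1 - axis k 1)" if "{j, k, l} = (UNIV :: 3 set)" for n j k l
    using AB that unfolding neighbor_coeffs_def by blast+
  \<comment> \<open>The mixed third difference of B. Summing it in one direction telescopes, as B
    vanishes at index -1, and returns the right-hand side of the first recurrence in that
    direction.\<close>
  define Q where "Q = (\<lambda>x y z. b x y z - b (x - 1) y z - b x (y - 1) z - b x y (z - 1) + b (x - 1) (y - 1) z
     + b (x - 1) y (z - 1) + b x (y - 1) (z - 1) - b (x - 1) (y - 1) (z - 1))"
  have sepX: "separated \<beta> X" unfolding separated_def
  proof (intro exI[of _ "\<lambda>i j k. Q (int i) (int j) (int k)"] allI conjI)
    fix i j k :: nat
    have "ladder \<beta> (\<lambda>i. X i j k) i = b (int i) (int j) (int k) - b (int i) (int j - 1) (int k)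
       - b (int i) (int j) (int k - 1) + b (int i) (int j - 1) (int k - 1)"
      using eqs(1)[OF UNIV_3_perm(1), of "ix (int i) (int j) (int k)"] by (simp add: ladder_def X_def b_def)
    also have "\<dots> = (\<Sum>i\<le>i. (b (int i) (int j) (int k) - b (int i) (int j - 1) (int k)
       - b (int i) (int j) (int k - 1) + b (int i) (int j - 1) (int k - 1)) -
       (b (int i - 1) (int j) (int k) - b (int i - 1) (int j - 1) (int k)
       - b (int i - 1) (int j) (int k - 1) + b (int i - 1) (int j - 1) (int k - 1)))"
      by (rule sum_telescope_int[symmetric]) (simp add: zero)
    finally show "ladder \<beta> (\<lambda>i. X i j k) i = (\<Sum>i\<le>i. Q (int i) (int j) (int k))"
      by (simp add: Q_def algebra_simps)
    have "ladder \<beta> (\<lambda>j. X i j k) j = b (int i) (int j) (int k) - b (int i - 1) (int j) (int k)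
       - b (int i) (int j) (int k - 1) + b (int i - 1) (int j) (int k - 1)"
      using eqs(1)[OF UNIV_3_perm(2), of "ix (int i) (int j) (int k)"] by (simp add: ladder_def X_def b_def)
    also have "\<dots> = (\<Sum>j\<le>j. (b (int i) (int j) (int k) - b (int i - 1) (int j) (int k)
       - b (int i) (int j) (int k - 1) + b (int i - 1) (int j) (int k - 1)) -
       (b (int i) (int j - 1) (int k) - b (int i - 1) (int j - 1) (int k)
       - b (int i) (int j - 1) (int k - 1) + b (int i - 1) (int j - 1) (int k - 1)))"
      by (rule sum_telescope_int[symmetric]) (simp add: zero)
    finally show "ladder \<beta> (\<lambda>j. X i j k) j = (\<Sum>j\<le>j. Q (int i) (int j) (int k))"
      by (simp add: Q_def algebra_simps)
    have "ladder \<beta> (\<lambda>k. X i j k) k = b (int i) (int j) (int k) - b (int i - 1) (int j) (int k)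
       - b (int i) (int j - 1) (int k) + b (int i - 1) (int j - 1) (int k)"
      using eqs(1)[OF UNIV_3_perm(3), of "ix (int i) (int j) (int k)"] by (simp add: ladder_def X_def b_def)
    also have "\<dots> = (\<Sum>k\<le>k. (b (int i) (int j) (int k) - b (int i - 1) (int j) (int k)
       - b (int i) (int j - 1) (int k) + b (int i - 1) (int j - 1) (int k)) -
       (b (int i) (int j) (int k - 1) - b (int i - 1) (int j) (int k - 1)
       - b (int i) (int j - 1) (int k - 1) + b (int i - 1) (int j - 1) (int k - 1)))"
      by (rule sum_telescope_int[symmetric]) (simp add: zero)
    finally show "ladder \<beta> (\<lambda>k. X i j k) k = (\<Sum>k\<le>k. Q (int i) (int j) (int k))"
      by (simp add: Q_def algebra_simps)
  qed
  have X00: "X 0 0 c = axis_coeff \<beta> c" for c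
  proof (induction c)
    case 0
    show ?case using A0 by (simp add: X_def axis_coeff_def)
  next
    case (Suc c)
    \<comment> \<open>At n = (0, 0, c) every shifted B in either recurrence has a negative index, so
      B_n alone remains; eliminating it gives the two-term recurrence of
      \<open>axis_coeff\<close>.\<close>
    have "(\<beta> * real c + \<beta>\<^sup>2) * X 0 0 c = - b 0 0 (int c)"
      using eqs(2)[OF UNIV_3_perm(3), of "ix 0 0 (int c)"] by (simp add: X_def Bb zero)
    moreover have "(real c + 1) * (real c + 2 * \<beta>) * X 0 0 (Suc c) - (real c + \<beta>) * (real c + 1 - \<beta>) * X 0 0 c = b 0 0 (int c)"
      using eqs(1)[OF UNIV_3_perm(3), of "ix 0 0 (int c)"] by (simp add: X_def Bb zero)
    ultimately have rec: "(real c + 1) * (real c + 2 * \<beta>) * X 0 0 (Suc c) = (real c + \<beta>) * (real c + 1 - 2 * \<beta>) * X 0 0 c"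
      by (simp add: algebra_simps power2_eq_square)
    have nz: "real c + 1 \<noteq> 0" "real c + 2 * \<beta> \<noteq> 0" "pochhammer (2 * \<beta>) c \<noteq> 0"
      using \<beta> pochhammer_pos[of "2 * \<beta>" c] by auto
    have "axis_coeff \<beta> (Suc c) = axis_coeff \<beta> c * ((real c + \<beta>) * (real c + 1 - 2 * \<beta>)) / ((real c + 1) * (real c + 2 * \<beta>))"
      using nz by (simp add: axis_coeff_def pochhammer_Suc add_ac mult_ac)
    hence "(real c + 1) * (real c + 2 * \<beta>) * axis_coeff \<beta> (Suc c) = (real c + \<beta>) * (real c + 1 - 2 * \<beta>) * axis_coeff \<beta> c"
      using nz by simp
    hence "((real c + 1) * (real c + 2 * \<beta>)) * X 0 0 (Suc c) = ((real c + 1) * (real c + 2 * \<beta>)) * axis_coeff \<beta> (Suc c)"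
      using rec Suc by simp
    thus ?case using nz by (simp only: mult_cancel_left mult_eq_0_iff) blast
  qed
  have "X i j k = hahn_coeff \<beta> i j k" for i j k
  proof (rule separated_unique[where X = X and Y = "hahn_coeff \<beta>", OF _ sepX separated_hahn_coeff[OF \<beta>]])
    show "\<beta> > 0" using \<beta> by simp
    show "X 0 0 n = hahn_coeff \<beta> 0 0 n" for n
      by (simp only: X00 hahn_coeff_axis[OF \<beta>])
  qed
  thus ?thesis by (simp add: X_def)
qed

section \<open>Continuity up to the boundary\<close>

lemma hyp_coeff_pos: "0 < \<beta> \<Longrightarrow> \<beta> < 1 \<Longrightarrow> hyp_coeff \<beta> n > 0"
  by (auto simp: hyp_coeff_def intro!: divide_pos_pos mult_pos_pos pochhammer_pos)

text \<open>Raabe's quantity tends to 2\<beta>, which exceeds 1; the coefficients decay like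
  n^(-2\<beta>).\<close>

lemma summable_hyp_coeff:
  assumes "1 / 2 < \<beta>" "\<beta> < 1"
  shows "summable (hyp_coeff \<beta>)"
proof (rule raabes_test_convergence)
  show "eventually (\<lambda>n. hyp_coeff \<beta> n > 0) sequentially"
    using assms by (intro always_eventually allI hyp_coeff_pos) auto
  have ratio: "hyp_coeff \<beta> n / hyp_coeff \<beta> (Suc n) = (real n + 1) * (real n + 2 * \<beta>) / ((real n + \<beta>) * (real n + 1 - \<beta>))" for n
  proof -
    have "hyp_coeff \<beta> (Suc n) > 0" using assms by (intro hyp_coeff_pos) auto
    moreover have "(real n + \<beta>) * (real n + 1 - \<beta>) \<noteq> 0" using assms by auto
    ultimately show ?thesis using hyp_coeff_Suc[of \<beta> n] assms by (simp add: frac_eq_eq mult.commute)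
  qed
  have "(\<lambda>n. real n * ((real n + 1) * (real n + 2 * \<beta>) / ((real n + \<beta>) * (real n + 1 - \<beta>)) - 1)) \<longlonglongrightarrow> 2 * \<beta>"
    using assms by real_asymp
  hence "(\<lambda>n. ereal (real n * (hyp_coeff \<beta> n / hyp_coeff \<beta> (Suc n) - 1))) \<longlonglongrightarrow> ereal (2 * \<beta>)"
    by (simp add: ratio)
  hence "liminf (\<lambda>n. ereal (real n * (hyp_coeff \<beta> n / hyp_coeff \<beta> (Suc n) - 1))) = ereal (2 * \<beta>)"
    by (intro lim_imp_Liminf) auto
  thus "liminf (\<lambda>n. ereal (real n * (hyp_coeff \<beta> n / hyp_coeff \<beta> (Suc n) - 1))) > 1"
    using assms by simp
qed

lemma f_beta_sums:
  assumes "1 / 2 < \<beta>" "\<beta> < 1" "0 \<le> x" "x \<le> 1"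
  shows "(\<lambda>n. hyp_coeff \<beta> n * x ^ n) sums f_beta \<beta> x"
proof -
  have "summable (\<lambda>n. hyp_coeff \<beta> n * x ^ n)"
  proof (rule summable_comparison_test'[OF summable_hyp_coeff[OF assms(1,2)], of 0])
    fix n
    have "hyp_coeff \<beta> n * x ^ n \<le> hyp_coeff \<beta> n * 1"
      using assms hyp_coeff_pos[of \<beta> n] by (intro mult_left_mono power_le_one) auto
    thus "norm (hyp_coeff \<beta> n * x ^ n) \<le> hyp_coeff \<beta> n"
      using assms hyp_coeff_pos[of \<beta> n] by (simp add: abs_mult)
  qed
  thus ?thesis by (simp add: f_beta_def hyp2F1_def hyp_coeff_def summable_sums)
qed

text \<open>Absolute summability is assumed instead of a sign, because the lemma must also serve
  \<open>axis_coeff\<close>, whose terms are negative after the first.\<close>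

lemma continuous_on_nonneg_power_series:
  fixes c :: "nat \<Rightarrow> real"
  assumes "summable (\<lambda>n. \<bar>c n\<bar>)"
  shows "continuous_on {0..1} (\<lambda>x. \<Sum>n. c n * x ^ n)"
proof (rule uniform_limit_theorem[OF always_eventually])
  show "uniform_limit {0..1} (\<lambda>n x. \<Sum>i<n. c i * x ^ i) (\<lambda>x. \<Sum>n. c n * x ^ n) sequentially"
  proof (rule Weierstrass_m_test[OF _ assms])
    fix n x assume "x \<in> {0..1 :: real}"
    hence "\<bar>c n\<bar> * \<bar>x ^ n\<bar> \<le> \<bar>c n\<bar> * 1" by (intro mult_left_mono) (auto simp: power_le_one)
    thus "norm (c n * x ^ n) \<le> \<bar>c n\<bar>" by (simp add: abs_mult)
  qed
qed (auto intro!: continuous_intros)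

lemma continuous_on_f_beta:
  assumes "1 / 2 < \<beta>" "\<beta> < 1"
  shows "continuous_on {0..1} (f_beta \<beta>)"
proof -
  have "continuous_on {0..1} (\<lambda>x. \<Sum>n. hyp_coeff \<beta> n * x ^ n)"
    using summable_hyp_coeff[OF assms] hyp_coeff_pos[of \<beta>] assms
    by (intro continuous_on_nonneg_power_series) (simp add: abs_of_pos)
  thus ?thesis by (simp add: f_beta_def[abs_def] hyp2F1_def hyp_coeff_def)
qed

text \<open>The value 0 at x = 1 is the limit forced by \<open>hahn_fun_bound\<close>, whereas
  \<open>hahn_fun\<close> there would be a series whose convergence is not established.\<close>

definition hahn_ext :: "real \<Rightarrow> real \<Rightarrow> real \<Rightarrow> real" where
  "hahn_ext \<beta> t x = (if x < 1 then hahn_fun \<beta> t x else 0)"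

lemma hahn_ext_bound:
  assumes "1 / 2 < \<beta>" "\<beta> < 1"
  shows "\<exists>C>0. \<forall>t. \<forall>x\<in>{0..1}. \<bar>hahn_ext \<beta> t x\<bar> \<le> C * (1 - x) powr ((\<beta> - 1 / 2) / 2)"
proof -
  obtain C where C: "C > 0" "\<And>t x. x \<in> {0..<1} \<Longrightarrow> \<bar>hahn_fun \<beta> t x\<bar> \<le> C * (1 - x) powr ((\<beta> - 1 / 2) / 2)"
    using hahn_fun_bound[OF assms] by blast
  have "\<bar>hahn_ext \<beta> t x\<bar> \<le> C * (1 - x) powr ((\<beta> - 1 / 2) / 2)" if "x \<in> {0..1}" for t x
    using that C(1) C(2)[of x t] by (auto simp: hahn_ext_def)
  thus ?thesis using C(1) by blast
qed

lemma hahn_ext_bounded: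
  assumes "1 / 2 < \<beta>" "\<beta> < 1"
  obtains C where "C > 0" "\<And>t x. x \<in> {0..1} \<Longrightarrow> \<bar>hahn_ext \<beta> t x\<bar> \<le> C"
proof -
  obtain C where C: "C > 0" "\<And>t x. x \<in> {0..1} \<Longrightarrow> \<bar>hahn_ext \<beta> t x\<bar> \<le> C * (1 - x) powr ((\<beta> - 1 / 2) / 2)"
    using hahn_ext_bound[OF assms] by blast
  have "\<bar>hahn_ext \<beta> t x\<bar> \<le> C" if x: "x \<in> {0..1}" for t x
  proof -
    have "(1 - x) powr ((\<beta> - 1 / 2) / 2) \<le> 1 powr ((\<beta> - 1 / 2) / 2)"
      using x assms by (intro powr_mono2) auto
    hence "C * (1 - x) powr ((\<beta> - 1 / 2) / 2) \<le> C * 1" using C(1) by (intro mult_left_mono) auto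
    thus ?thesis using C(2)[OF x, of t] by simp
  qed
  thus ?thesis using that C(1) by blast
qed

lemma continuous_on_hahn_ext:
  assumes "1 / 2 < \<beta>" "\<beta> < 1"
  shows "continuous_on {0..1} (hahn_ext \<beta> t)"
proof -
  have "((hahn_ext \<beta> t) \<longlongrightarrow> hahn_ext \<beta> t x) (at x within {0..1})" if x: "x \<in> {0..1}" for x
  proof (cases "x = 1")
    case True
    obtain C where C: "C > 0" "\<And>t x. x \<in> {0..1} \<Longrightarrow> \<bar>hahn_ext \<beta> t x\<bar> \<le> C * (1 - x) powr ((\<beta> - 1 / 2) / 2)"
      using hahn_ext_bound[OF assms] by blast
    have "((hahn_ext \<beta> t) \<longlongrightarrow> 0) (at 1 within {0..1})"
    proof (rule Lim_null_comparison)
      show "eventually (\<lambda>y. norm (hahn_ext \<beta> t y) \<le> C * (1 - y) powr ((\<beta> - 1 / 2) / 2)) (at 1 within {0..1})"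
        using C(2) by (auto simp: eventually_at_filter)
      have "continuous_on {0..1} (\<lambda>y. C * (1 - y) powr ((\<beta> - 1 / 2) / 2))"
        using assms by (intro continuous_on_mult continuous_on_const continuous_on_powr' continuous_on_diff continuous_on_id) auto
      from this[unfolded continuous_on_def, rule_format, of 1]
      show "((\<lambda>y. C * (1 - y) powr ((\<beta> - 1 / 2) / 2)) \<longlongrightarrow> 0) (at 1 within {0..1})" by simp
    qed
    thus ?thesis by (simp add: True hahn_ext_def)
  next
    case False
    hence x1: "x < 1" "0 \<le> x" using x by auto
    define K where "K = (x + 1) / 2"
    have K: "0 \<le> K" "K < 1" "x < K" using x1 by (auto simp: K_def)
    have "isCont (\<lambda>x. \<Sum>n. hahn_poly \<beta> n (spec \<beta> t) * x ^ n) x"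
      by (rule isCont_powser[OF sums_summable[OF hahn_fun_sums(1)[OF assms K(1,2)]]]) (use K x1 in auto)
    hence "(hahn_fun \<beta> t \<longlongrightarrow> hahn_fun \<beta> t x) (at x within {0..1})"
      unfolding hahn_fun_def isCont_def by (rule tendsto_within_subset) auto
    moreover have "eventually (\<lambda>y. hahn_fun \<beta> t y = hahn_ext \<beta> t y) (at x within {0..1})"
    proof -
      have "eventually (\<lambda>y. y < 1) (at x within {0..1})"
        using x1 by (intro order_tendstoD(2)[OF tendsto_ident_at])
      thus ?thesis by eventually_elim (simp add: hahn_ext_def)
    qed
    ultimately show ?thesis using x1
      by (simp add: hahn_ext_def Lim_transform_eventually)
  qed
  thus ?thesis by (simp add: continuous_on_def)
qed

lemma measurable_hahn_ext:
  assumes "1 / 2 < \<beta>" "\<beta> < 1" "x \<in> {0..1}"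
  shows "(\<lambda>t. hahn_ext \<beta> t x) \<in> borel_measurable borel"
  using subexp_hahn_fun[OF assms(1,2), of x] assms(3)
  by (cases "x < 1") (auto simp: hahn_ext_def subexp_def)

lemma subexp_hahn_ext:
  assumes "1 / 2 < \<beta>" "\<beta> < 1" "x \<in> {0..1}"
  shows "subexp (\<lambda>t. hahn_ext \<beta> t x)"
  using subexp_hahn_fun[OF assms(1,2), of x] assms(3)
  by (cases "x < 1") (auto simp: hahn_ext_def)

section \<open>The continuous extension to the closed cube\<close>

definition nbr :: "real \<Rightarrow> real \<Rightarrow> real \<Rightarrow> real \<Rightarrow> real" where
  "nbr \<beta> x y z = mass0 \<beta> * (f_beta \<beta> x * f_beta \<beta> y * f_beta \<beta> z) +
     (LINT t|lborel. hahn_ext \<beta> t x * hahn_ext \<beta> t y * hahn_ext \<beta> t z * dens \<beta> t)"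

lemma nbr_perm: "nbr \<beta> x y z = nbr \<beta> y x z" "nbr \<beta> x y z = nbr \<beta> x z y" "nbr \<beta> x y z = nbr \<beta> z x y"
  by (simp_all add: nbr_def mult_ac)

text \<open>The factor \<open>hahn_ext \<beta> t 1\<close> is 0 for every t, which removes the whole
  integral.\<close>

lemma nbr_face: "nbr \<beta> x y 1 = mass0 \<beta> * f_beta \<beta> 1 * (f_beta \<beta> x * f_beta \<beta> y)"
  by (simp add: nbr_def hahn_ext_def mult_ac)

text \<open>Dominated convergence with majorant C^3 \<open>dens\<close>. It is the uniformity in t
  of the bound on \<open>hahn_ext\<close> that provides C.\<close>

lemma nbr_tendsto:
  assumes \<beta>: "1 / 2 < \<beta>" "\<beta> < 1"
    and lim: "X \<longlonglongrightarrow> x" "Y \<longlonglongrightarrow> y" "Z \<longlonglongrightarrow> z"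
    and X: "\<And>n. X n \<in> {0..1}" and Y: "\<And>n. Y n \<in> {0..1}" and Z: "\<And>n. Z n \<in> {0..1}"
    and xyz: "x \<in> {0..1}" "y \<in> {0..1}" "z \<in> {0..1}"
  shows "(\<lambda>n. nbr \<beta> (X n) (Y n) (Z n)) \<longlonglongrightarrow> nbr \<beta> x y z"
proof -
  obtain C where C: "C > 0" "\<And>t x. x \<in> {0..1} \<Longrightarrow> \<bar>hahn_ext \<beta> t x\<bar> \<le> C"
    using hahn_ext_bounded[OF \<beta>] by blast
  have f: "(\<lambda>n. f_beta \<beta> (U n)) \<longlonglongrightarrow> f_beta \<beta> u" if "U \<longlonglongrightarrow> u" "\<And>n. U n \<in> {0..1}" "u \<in> {0..1}" for U u
    using continuous_on_f_beta[OF \<beta>] that unfolding continuous_on_sequentially by (auto simp: o_def)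
  have e: "(\<lambda>n. hahn_ext \<beta> t (U n)) \<longlonglongrightarrow> hahn_ext \<beta> t u" if "U \<longlonglongrightarrow> u" "\<And>n. U n \<in> {0..1}" "u \<in> {0..1}" for U u t
    using continuous_on_hahn_ext[OF \<beta>] that unfolding continuous_on_sequentially by (auto simp: o_def)
  note m = measurable_hahn_ext[OF \<beta>] dens_measurable[OF \<beta>]
  have "(\<lambda>n. LINT t|lborel. hahn_ext \<beta> t (X n) * hahn_ext \<beta> t (Y n) * hahn_ext \<beta> t (Z n) * dens \<beta> t) \<longlonglongrightarrow>
      (LINT t|lborel. hahn_ext \<beta> t x * hahn_ext \<beta> t y * hahn_ext \<beta> t z * dens \<beta> t)"
  proof (rule integral_dominated_convergence)
    have "integrable lborel (\<lambda>t. C * C * C * dens \<beta> t)"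
      by (rule integrable_subexp_dens[OF \<beta>]) auto
    thus "integrable lborel (\<lambda>t. C * C * C * dens \<beta> t)" .
    show "(\<lambda>t. hahn_ext \<beta> t x * hahn_ext \<beta> t y * hahn_ext \<beta> t z * dens \<beta> t) \<in> borel_measurable lborel"
      using m xyz by auto
    show "(\<lambda>t. hahn_ext \<beta> t (X n) * hahn_ext \<beta> t (Y n) * hahn_ext \<beta> t (Z n) * dens \<beta> t) \<in> borel_measurable lborel" for n
      using m X Y Z by auto
    show "AE t in lborel. (\<lambda>n. hahn_ext \<beta> t (X n) * hahn_ext \<beta> t (Y n) * hahn_ext \<beta> t (Z n) * dens \<beta> t) \<longlonglongrightarrow>
        hahn_ext \<beta> t x * hahn_ext \<beta> t y * hahn_ext \<beta> t z * dens \<beta> t"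
      by (intro AE_I2 tendsto_mult tendsto_const e lim X Y Z xyz)
    show "AE t in lborel. norm (hahn_ext \<beta> t (X n) * hahn_ext \<beta> t (Y n) * hahn_ext \<beta> t (Z n) * dens \<beta> t) \<le> C * C * C * dens \<beta> t" for n
    proof (rule AE_I2)
      fix t
      have "\<bar>hahn_ext \<beta> t (X n)\<bar> * \<bar>hahn_ext \<beta> t (Y n)\<bar> * \<bar>hahn_ext \<beta> t (Z n)\<bar> * dens \<beta> t \<le> C * C * C * dens \<beta> t"
        using C(1) dens_nonneg[OF \<beta>, of t] by (intro mult_mono C(2) X Y Z) auto
      thus "norm (hahn_ext \<beta> t (X n) * hahn_ext \<beta> t (Y n) * hahn_ext \<beta> t (Z n) * dens \<beta> t) \<le> C * C * C * dens \<beta> t"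
        using dens_nonneg[OF \<beta>, of t] by (simp add: abs_mult)
    qed
  qed
  thus ?thesis unfolding nbr_def
    by (intro tendsto_add tendsto_mult tendsto_const f lim X Y Z xyz)
qed

text \<open>The three power series are summed one variable at a time, because only one factor with
  complex argument is compatible with the decay of \<^const>\<open>dens\<close>.\<close>

lemma hahn_coeff_sums_3:
  assumes \<beta>: "1 / 2 < \<beta>" "\<beta> < 1" and x: "0 \<le> x" "x < 1"
  shows "(\<lambda>n. hahn_coeff \<beta> a b n * x ^ n) sums (mass0 \<beta> * (hyp_coeff \<beta> a * hyp_coeff \<beta> b * f_beta \<beta> x) +
     (LINT t|lborel. hahn_poly \<beta> a (spec \<beta> t) * hahn_poly \<beta> b (spec \<beta> t) * hahn_fun \<beta> t x * dens \<beta> t))"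
proof -
  have "subexp (\<lambda>t. hahn_poly \<beta> a (spec \<beta> t) * hahn_poly \<beta> b (spec \<beta> t))" by auto
  from hahn_series_integral[OF \<beta> this x]
  have 1: "(\<lambda>n. (LINT t|lborel. hahn_poly \<beta> a (spec \<beta> t) * hahn_poly \<beta> b (spec \<beta> t) * hahn_poly \<beta> n (spec \<beta> t) * dens \<beta> t) * x ^ n) sums
     (LINT t|lborel. hahn_poly \<beta> a (spec \<beta> t) * hahn_poly \<beta> b (spec \<beta> t) * hahn_fun \<beta> t x * dens \<beta> t)" .
  have 2: "(\<lambda>n. (mass0 \<beta> * (hyp_coeff \<beta> a * hyp_coeff \<beta> b)) * (hyp_coeff \<beta> n * x ^ n)) sums
     ((mass0 \<beta> * (hyp_coeff \<beta> a * hyp_coeff \<beta> b)) * f_beta \<beta> x)"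
    using x by (intro sums_mult f_beta_sums \<beta>) auto
  show ?thesis
    using sums_add[OF 2 1] by (simp add: hahn_coeff_def hahn_functional_def hahn_poly_at_0 mult.assoc distrib_right)
qed

lemma hahn_coeff_sums_2:
  assumes \<beta>: "1 / 2 < \<beta>" "\<beta> < 1" and x: "0 \<le> x" "x < 1" and y: "0 \<le> y" "y < 1"
  shows "(\<lambda>n. (mass0 \<beta> * (hyp_coeff \<beta> a * hyp_coeff \<beta> n * f_beta \<beta> x) +
     (LINT t|lborel. hahn_poly \<beta> a (spec \<beta> t) * hahn_poly \<beta> n (spec \<beta> t) * hahn_fun \<beta> t x * dens \<beta> t)) * y ^ n) sums
     (mass0 \<beta> * (hyp_coeff \<beta> a * f_beta \<beta> y * f_beta \<beta> x) +
     (LINT t|lborel. hahn_poly \<beta> a (spec \<beta> t) * hahn_fun \<beta> t y * hahn_fun \<beta> t x * dens \<beta> t))"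
proof -
  have "subexp (\<lambda>t. hahn_poly \<beta> a (spec \<beta> t) * hahn_fun \<beta> t x)"
    using subexp_hahn_fun[OF \<beta> x] by auto
  from hahn_series_integral[OF \<beta> this y]
  have 1: "(\<lambda>n. (LINT t|lborel. hahn_poly \<beta> a (spec \<beta> t) * hahn_poly \<beta> n (spec \<beta> t) * hahn_fun \<beta> t x * dens \<beta> t) * y ^ n) sums
     (LINT t|lborel. hahn_poly \<beta> a (spec \<beta> t) * hahn_fun \<beta> t y * hahn_fun \<beta> t x * dens \<beta> t)"
    by (simp add: mult_ac)
  have 2: "(\<lambda>n. (mass0 \<beta> * (hyp_coeff \<beta> a * f_beta \<beta> x)) * (hyp_coeff \<beta> n * y ^ n)) sums
     ((mass0 \<beta> * (hyp_coeff \<beta> a * f_beta \<beta> x)) * f_beta \<beta> y)"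
    using y by (intro sums_mult f_beta_sums \<beta>) auto
  show ?thesis
    using sums_add[OF 2 1] by (simp add: distrib_left distrib_right mult_ac)
qed

text \<open>Besides ending the triple summation, this exhibits \<open>nbr\<close> in one variable as
  a power series convergent on [0, 1), as the analytic continuation requires.\<close>

lemma nbr_sums:
  assumes \<beta>: "1 / 2 < \<beta>" "\<beta> < 1" and x: "0 \<le> x" "x \<le> 1" and y: "0 \<le> y" "y \<le> 1" and z: "0 \<le> z" "z < 1"
  shows "(\<lambda>n. (mass0 \<beta> * (hyp_coeff \<beta> n * f_beta \<beta> y * f_beta \<beta> x) +
     (LINT t|lborel. hahn_poly \<beta> n (spec \<beta> t) * hahn_ext \<beta> t y * hahn_ext \<beta> t x * dens \<beta> t)) * z ^ n) sums nbr \<beta> x y z"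
proof -
  have "subexp (\<lambda>t. hahn_ext \<beta> t y * hahn_ext \<beta> t x)"
    using subexp_hahn_ext[OF \<beta>] x y by auto
  from hahn_series_integral[OF \<beta> this z]
  have 1: "(\<lambda>n. (LINT t|lborel. hahn_poly \<beta> n (spec \<beta> t) * hahn_ext \<beta> t y * hahn_ext \<beta> t x * dens \<beta> t) * z ^ n) sums
     (LINT t|lborel. hahn_ext \<beta> t x * hahn_ext \<beta> t y * hahn_ext \<beta> t z * dens \<beta> t)"
    using z by (simp add: mult_ac hahn_ext_def[of \<beta> _ z])
  have 2: "(\<lambda>n. (mass0 \<beta> * (f_beta \<beta> y * f_beta \<beta> x)) * (hyp_coeff \<beta> n * z ^ n)) sums
     ((mass0 \<beta> * (f_beta \<beta> y * f_beta \<beta> x)) * f_beta \<beta> z)"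
    using z by (intro sums_mult f_beta_sums \<beta>) auto
  show ?thesis
    using sums_add[OF 2 1] by (simp add: nbr_def distrib_left distrib_right mult_ac)
qed

section \<open>The Gauss sum and analytic continuation\<close>

definition binom_coeff :: "real \<Rightarrow> nat \<Rightarrow> real" where
  "binom_coeff \<beta> n = pochhammer (1 - 2 * \<beta>) n / fact n"

lemma binom_coeff_sums:
  assumes "\<bar>t\<bar> < 1"
  shows "(\<lambda>n. binom_coeff \<beta> n * t ^ n) sums (1 - t) powr (2 * \<beta> - 1)"
proof -
  have "(\<lambda>n. ((2 * \<beta> - 1) gchoose n) * (- t) ^ n) sums (1 + - t) powr (2 * \<beta> - 1)"
    using assms by (intro gen_binomial_real) auto
  also have "(\<lambda>n. ((2 * \<beta> - 1) gchoose n) * (- t) ^ n) = (\<lambda>n. binom_coeff \<beta> n * t ^ n)"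
  proof
    fix n
    have "(- 1) ^ n * (- 1) ^ n = (1 :: real)" by (simp flip: power_mult_distrib)
    thus "((2 * \<beta> - 1) gchoose n) * (- t) ^ n = binom_coeff \<beta> n * t ^ n"
      by (simp add: gbinomial_pochhammer binom_coeff_def power_minus[of t])
  qed
  finally show ?thesis by simp
qed

text \<open>Partial sums divide the generating function (1 - t)^(2\<beta> - 1) by 1 - t, which
  lowers the exponent by one.\<close>

lemma binom_coeff_partial_sum: "(\<Sum>n\<le>N. binom_coeff \<beta> n) = pochhammer (2 - 2 * \<beta>) N / fact N"
proof (induction N)
  case (Suc N)
  have "pochhammer (1 - 2 * \<beta>) (Suc N) = (1 - 2 * \<beta>) * pochhammer (2 - 2 * \<beta>) N"
    by (simp add: pochhammer_rec algebra_simps)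
  moreover have "1 + real N \<noteq> 0" by linarith
  ultimately show ?case using Suc
    by (simp add: binom_coeff_def pochhammer_Suc divide_simps) (simp add: algebra_simps)
qed (simp add: binom_coeff_def)

text \<open>All terms after the zeroth are nonpositive, so the partial sums of absolute values are 2
  minus the plain partial sums, which are nonnegative.\<close>

lemma summable_binom_coeff:
  assumes "1 / 2 < \<beta>" "\<beta> < 1"
  shows "summable (\<lambda>n. \<bar>binom_coeff \<beta> n\<bar>)"
proof (rule summableI_nonneg_bounded)
  have neg: "binom_coeff \<beta> (Suc n) \<le> 0" for n
  proof -
    have "pochhammer (1 - 2 * \<beta>) (Suc n) = (1 - 2 * \<beta>) * pochhammer (2 - 2 * \<beta>) n"
      by (simp add: pochhammer_rec algebra_simps)
    moreover have "pochhammer (2 - 2 * \<beta>) n > 0" using assms by (intro pochhammer_pos) auto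
    ultimately show ?thesis using assms by (simp add: binom_coeff_def divide_nonpos_pos mult_nonpos_nonneg)
  qed
  fix n
  have "(\<Sum>i<n. \<bar>binom_coeff \<beta> i\<bar>) \<le> (\<Sum>i\<le>n. \<bar>binom_coeff \<beta> i\<bar>)"
    by (intro sum_mono2) auto
  also have "\<dots> = 2 - (\<Sum>i\<le>n. binom_coeff \<beta> i)"
  proof (induction n)
    case (Suc n)
    thus ?case using neg[of n] by simp
  qed (simp add: binom_coeff_def)
  also have "\<dots> \<le> 2"
  proof -
    have "(\<Sum>i\<le>n. binom_coeff \<beta> i) \<ge> 0"
      unfolding binom_coeff_partial_sum using assms by (intro divide_nonneg_pos pochhammer_nonneg) auto
    thus ?thesis by simp
  qed
  finally show "(\<Sum>i<n. \<bar>binom_coeff \<beta> i\<bar>) \<le> 2" .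
qed auto

lemma LINT_Beta:
  assumes "a > 0" "b > (0 :: real)"
  shows "integrable lborel (\<lambda>t. indicator {0..1} t * (t powr (a - 1) * (1 - t) powr (b - 1)))"
    "(LINT t|lborel. indicator {0..1} t * (t powr (a - 1) * (1 - t) powr (b - 1))) = Beta a b"
proof -
  have si: "set_integrable lborel {0..1} (\<lambda>t. t powr (a - 1) * (1 - t) powr (b - 1))"
    by (rule integrable_Beta[OF assms])
  thus "integrable lborel (\<lambda>t. indicator {0..1} t * (t powr (a - 1) * (1 - t) powr (b - 1)))"
    by (simp add: set_integrable_def)
  have "(LINT t:{0..1}|lborel. t powr (a - 1) * (1 - t) powr (b - 1)) = Beta a b"
    using set_borel_integral_eq_integral(2)[OF si] has_integral_Beta_real[OF assms] by (simp add: integral_unique)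
  thus "(LINT t|lborel. indicator {0..1} t * (t powr (a - 1) * (1 - t) powr (b - 1))) = Beta a b"
    by (simp add: set_lebesgue_integral_def)
qed

lemma pochhammer_quotient_Beta:
  assumes "\<beta> > (0 :: real)"
  shows "pochhammer \<beta> n / pochhammer (2 * \<beta>) n = Beta (\<beta> + real n) \<beta> / Beta \<beta> \<beta>"
proof -
  have np: "x \<notin> \<int>\<^sub>\<le>\<^sub>0" if "x > 0" for x :: real using that by (auto elim!: nonpos_Ints_cases)
  have "Gamma \<beta> > 0" "Gamma (2 * \<beta>) > 0" "Gamma (2 * \<beta> + real n) > 0" using assms by auto
  thus ?thesis
    using assms by (simp add: Beta_def pochhammer_Gamma np divide_simps)
qed

lemma axis_coeff_conv_binom:
  assumes "\<beta> > 0"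
  shows "axis_coeff \<beta> n = binom_coeff \<beta> n * (Beta (\<beta> + real n) \<beta> / Beta \<beta> \<beta>)"
  unfolding pochhammer_quotient_Beta[OF assms, symmetric] by (simp add: axis_coeff_def binom_coeff_def mult_ac)

lemma summable_axis_coeff:
  assumes "1 / 2 < \<beta>" "\<beta> < 1"
  shows "summable (\<lambda>n. \<bar>axis_coeff \<beta> n\<bar>)"
proof (rule summable_comparison_test'[OF summable_binom_coeff[OF assms], of 0])
  fix n
  have pos: "pochhammer \<beta> n > 0" "pochhammer (2 * \<beta>) n > 0" using assms by (auto intro!: pochhammer_pos)
  have "pochhammer \<beta> n \<le> pochhammer (2 * \<beta>) n"
    unfolding pochhammer_prod using assms by (intro prod_mono) auto
  hence "pochhammer \<beta> n / pochhammer (2 * \<beta>) n \<le> 1" using pos by simp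
  hence "\<bar>binom_coeff \<beta> n\<bar> * (pochhammer \<beta> n / pochhammer (2 * \<beta>) n) \<le> \<bar>binom_coeff \<beta> n\<bar> * 1"
    by (intro mult_left_mono) auto
  thus "norm \<bar>axis_coeff \<beta> n\<bar> \<le> \<bar>binom_coeff \<beta> n\<bar>"
    using pos by (simp add: axis_coeff_def binom_coeff_def abs_mult mult_ac)
qed

text \<open>Euler's integral: (\<beta>)_n/(2\<beta>)_n is the n-th moment of the Beta(\<beta>,
  \<beta>) density. Summing the binomial series inside adds 2\<beta> - 1 to the exponent of 1 - t,
  which yields B(\<beta>, 3\<beta> - 1)/B(\<beta>, \<beta>).\<close>

lemma axis_coeff_suminf:
  assumes \<beta>: "1 / 2 < \<beta>" "\<beta> < 1"
  shows "(\<Sum>n. axis_coeff \<beta> n) = Gamma (2 * \<beta>) * Gamma (3 * \<beta> - 1) / (Gamma \<beta> * Gamma (4 * \<beta> - 1))"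
proof -
  define b where "b = (\<lambda>t. indicator {0..1} t * (t powr (\<beta> - 1) * (1 - t) powr (\<beta> - 1)) :: real)"
  define f where "f = (\<lambda>n t. binom_coeff \<beta> n * (t ^ n * b t))"
  have tb: "t ^ n * b t = indicator {0..1} t * (t powr (\<beta> + real n - 1) * (1 - t) powr (\<beta> - 1))" for n t
  proof (cases "t > 0")
    case True
    hence "t powr (\<beta> + real n - 1) = t ^ n * t powr (\<beta> - 1)"
      by (simp add: powr_realpow[symmetric] flip: powr_add) (simp add: algebra_simps)
    thus ?thesis by (simp add: b_def)
  qed (auto simp: b_def indicator_def)
  have b0: "b t \<ge> 0" for t by (simp add: b_def indicator_def)
  have int: "integrable lborel (\<lambda>t. t ^ n * b t)" "(LINT t|lborel. t ^ n * b t) = Beta (\<beta> + real n) \<beta>" for n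
    unfolding tb using LINT_Beta[of "\<beta> + real n" \<beta>] \<beta> by auto
  have f_int: "integrable lborel (f n)" for n unfolding f_def by (intro integrable_mult_right int)
  have tn: "t ^ n * b t \<le> b t" for n t
  proof (cases "t \<in> {0..1}")
    case True
    thus ?thesis using b0[of t] mult_right_mono[of "t ^ n" 1 "b t"] by (simp add: power_le_one)
  qed (simp add: b_def)
  have tn0: "t ^ n * b t \<ge> 0" for n t by (simp add: tb indicator_def)
  have bound: "norm (f n t) \<le> \<bar>binom_coeff \<beta> n\<bar> * b t" for n t
    unfolding f_def norm_mult using tn[of t n] tn0[of t n] by (simp add: mult_left_mono abs_of_nonneg flip: abs_mult)
  have b_int: "integrable lborel b" using int(1)[of 0] by simp
  have "(\<lambda>n. integral\<^sup>L lborel (f n)) sums (LINT t|lborel. (\<Sum>n. f n t))"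
  proof (rule sums_integral[OF f_int])
    show "AE t in lborel. summable (\<lambda>n. norm (f n t))"
    proof (rule AE_I2)
      fix t
      have "summable (\<lambda>n. \<bar>binom_coeff \<beta> n\<bar> * b t)" by (intro summable_mult2 summable_binom_coeff \<beta>)
      thus "summable (\<lambda>n. norm (f n t))"
        by (rule summable_comparison_test'[where N = 0]) (use bound in simp)
    qed
    have "summable (\<lambda>n. \<bar>binom_coeff \<beta> n\<bar> * integral\<^sup>L lborel b)" by (intro summable_mult2 summable_binom_coeff \<beta>)
    thus "summable (\<lambda>n. LINT t|lborel. norm (f n t))"
    proof (rule summable_comparison_test'[where N = 0])
      fix n
      have "(LINT t|lborel. norm (f n t)) \<le> (LINT t|lborel. \<bar>binom_coeff \<beta> n\<bar> * b t)"
        by (intro integral_mono bound integrable_norm f_int integrable_mult_right b_int)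
      thus "norm (LINT t|lborel. norm (f n t)) \<le> \<bar>binom_coeff \<beta> n\<bar> * integral\<^sup>L lborel b" by simp
    qed
  qed
  also have "(\<lambda>t. \<Sum>n. f n t) = (\<lambda>t. indicator {0..1} t * (t powr (\<beta> - 1) * (1 - t) powr (3 * \<beta> - 1 - 1)))"
  proof
    fix t :: real
    show "(\<Sum>n. f n t) = indicator {0..1} t * (t powr (\<beta> - 1) * (1 - t) powr (3 * \<beta> - 1 - 1))"
    proof (cases "0 \<le> t \<and> t < 1")
      case True
      hence "(\<lambda>n. (binom_coeff \<beta> n * t ^ n) * b t) sums ((1 - t) powr (2 * \<beta> - 1) * b t)"
        by (intro sums_mult2 binom_coeff_sums) auto
      moreover have "(1 - t) powr (3 * \<beta> - 1 - 1) = (1 - t) powr (2 * \<beta> - 1) * (1 - t) powr (\<beta> - 1)"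
        by (simp flip: powr_add)
      ultimately show ?thesis using True by (simp add: f_def b_def sums_iff mult_ac)
    next
      case False
      \<comment> \<open>This includes t = 1, where b vanishes because 0 \<open>powr\<close> any
        exponent is 0; both sides are then 0.\<close>
      hence "b t = 0" by (auto simp: b_def indicator_def)
      thus ?thesis using False by (auto simp: f_def indicator_def)
    qed
  qed
  also have "(LINT t|lborel. indicator {0..1} t * (t powr (\<beta> - 1) * (1 - t) powr (3 * \<beta> - 1 - 1))) = Beta \<beta> (3 * \<beta> - 1)"
    using \<beta> by (intro LINT_Beta) auto
  finally have "(\<lambda>n. binom_coeff \<beta> n * Beta (\<beta> + real n) \<beta>) sums Beta \<beta> (3 * \<beta> - 1)"
    by (simp add: f_def int)
  hence "(\<lambda>n. binom_coeff \<beta> n * Beta (\<beta> + real n) \<beta> / Beta \<beta> \<beta>) sums (Beta \<beta> (3 * \<beta> - 1) / Beta \<beta> \<beta>)"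
    by (rule sums_divide)
  hence "(\<Sum>n. axis_coeff \<beta> n) = Beta \<beta> (3 * \<beta> - 1) / Beta \<beta> \<beta>"
    using \<beta> by (simp add: axis_coeff_conv_binom sums_iff)
  also have "\<dots> = Gamma (2 * \<beta>) * Gamma (3 * \<beta> - 1) / (Gamma \<beta> * Gamma (4 * \<beta> - 1))"
  proof -
    have "Gamma \<beta> > 0" "Gamma (2 * \<beta>) > 0" "Gamma (4 * \<beta> - 1) > 0" using \<beta> by auto
    moreover have "\<beta> + (3 * \<beta> - 1) = 4 * \<beta> - 1" "\<beta> + \<beta> = 2 * \<beta>" by simp_all
    ultimately show ?thesis by (simp add: Beta_def divide_simps)
  qed
  finally show ?thesis .
qed

section \<open>The constant on the faces\<close>

lemma hahn_ext_0: "hahn_ext \<beta> t 0 = 1"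
  unfolding hahn_ext_def hahn_fun_def powser_zero by simp

lemma f_beta_0: "f_beta \<beta> 0 = 1"
  unfolding f_beta_def hyp2F1_def powser_zero by simp

text \<open>Let z tend to 1 along the axis (0, 0, z). Continuity of \<open>nbr\<close> kills the
  integral and leaves this product; continuity of the axis series, which converges absolutely at 1,
  gives the Gauss sum.\<close>

lemma mass0_f_beta_1:
  assumes \<beta>: "1 / 2 < \<beta>" "\<beta> < 1"
  shows "mass0 \<beta> * f_beta \<beta> 1 = Gamma (2 * \<beta>) * Gamma (3 * \<beta> - 1) / (Gamma \<beta> * Gamma (4 * \<beta> - 1))"
proof -
  define Z where "Z = (\<lambda>n. 1 - 1 / real (n + 2))"
  have Z01: "Z n \<in> {0..1}" "Z n < 1" for n by (auto simp: Z_def)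
  have Z: "Z \<longlonglongrightarrow> 1" unfolding Z_def by real_asymp
  have "nbr \<beta> 0 0 z = (\<Sum>n. axis_coeff \<beta> n * z ^ n)" if "0 \<le> z" "z < 1" for z
  proof -
    have "(\<lambda>n. hahn_coeff \<beta> 0 0 n * z ^ n) sums nbr \<beta> 0 0 z"
      using hahn_coeff_sums_3[OF \<beta> that, of 0 0] that
      by (simp add: nbr_def hahn_ext_0 f_beta_0 hyp_coeff_def hahn_ext_def[of \<beta> _ z])
    thus ?thesis by (simp add: hahn_coeff_axis[OF \<beta>] sums_iff)
  qed
  hence eq: "nbr \<beta> 0 0 (Z n) = (\<Sum>k. axis_coeff \<beta> k * Z n ^ k)" for n using Z01[of n] by auto
  have 1: "(\<lambda>n. nbr \<beta> 0 0 (Z n)) \<longlonglongrightarrow> nbr \<beta> 0 0 1"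
    by (rule nbr_tendsto[OF \<beta> tendsto_const tendsto_const Z]) (use Z01 in auto)
  have "continuous_on {0..1} (\<lambda>x. \<Sum>n. axis_coeff \<beta> n * x ^ n)"
    by (rule continuous_on_nonneg_power_series[OF summable_axis_coeff[OF \<beta>]])
  hence "(\<lambda>n. \<Sum>k. axis_coeff \<beta> k * Z n ^ k) \<longlonglongrightarrow> (\<Sum>k. axis_coeff \<beta> k * 1 ^ k)"
    by (rule continuous_on_tendsto_compose[OF _ Z]) (use Z01(1) in \<open>auto intro!: always_eventually\<close>)
  hence 2: "(\<lambda>n. nbr \<beta> 0 0 (Z n)) \<longlonglongrightarrow> (\<Sum>k. axis_coeff \<beta> k * 1 ^ k)"
    unfolding eq .
  have "nbr \<beta> 0 0 1 = (\<Sum>k. axis_coeff \<beta> k)" using LIMSEQ_unique[OF 1 2] by simp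
  thus ?thesis by (simp add: nbr_face f_beta_0 axis_coeff_suminf[OF \<beta>])
qed

text \<open>The power series of H defines a holomorphic function on the unit disc that agrees with g
  on (0, e), a set accumulating at 0. The identity theorem then carries the equality along the
  segment [0, 1).\<close>

lemma real_analytic_continuation:
  fixes g :: "complex \<Rightarrow> complex" and H :: "real \<Rightarrow> real"
  assumes U: "open U" "of_real ` {0..<1} \<subseteq> U" and g: "g holomorphic_on U"
    and H: "\<And>x. 0 \<le> x \<Longrightarrow> x < 1 \<Longrightarrow> (\<lambda>n. h n * x ^ n) sums H x"
    and e: "0 < e" "e < 1" and eq: "\<And>x. 0 \<le> x \<Longrightarrow> x < e \<Longrightarrow> g (of_real x) = of_real (H x)"
    and x: "0 \<le> x" "x < 1"
  shows "g (of_real x) = of_real (H x)"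
proof -
  define P where "P = (\<lambda>w. \<Sum>n. complex_of_real (h n) * w ^ n)"
  have P_sums: "(\<lambda>n. complex_of_real (h n) * (w - 0) ^ n) sums P w" if "w \<in> ball 0 1" for w
  proof -
    define K where "K = (norm w + 1) / 2"
    have K: "0 \<le> K" "K < 1" "norm w < K" using that by (auto simp: K_def)
    have "summable (\<lambda>n. complex_of_real (h n * K ^ n))"
      by (intro summable_of_real sums_summable[OF H] K)
    hence "summable (\<lambda>n. complex_of_real (h n) * of_real K ^ n)" by simp
    hence "summable (\<lambda>n. complex_of_real (h n) * w ^ n)"
      by (rule powser_inside) (use K in auto)
    thus ?thesis unfolding P_def by (simp add: summable_sums)
  qed
  have P_hol: "P holomorphic_on ball 0 1" by (rule power_series_holomorphic[OF P_sums])
  have P_real: "P (of_real x) = of_real (H x)" if "0 \<le> x" "x < 1" for x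
  proof -
    have "(\<lambda>n. complex_of_real (h n * x ^ n)) sums of_real (H x)" by (intro sums_of_real H that)
    thus ?thesis by (simp add: P_def sums_iff)
  qed
  define S where "S = U \<inter> ball 0 1"
  have S: "open S" using U by (auto simp: S_def)
  define I where "I = (of_real ` {0..<1} :: complex set)"
  have I: "I \<subseteq> S" using U by (auto simp: S_def I_def)
  have "connected I" unfolding I_def by (intro connected_continuous_image continuous_intros) auto
  \<comment> \<open>The intersection of U with the disc may be disconnected; the component of 0
    still contains the connected segment [0, 1).\<close>
  define T where "T = connected_component_set S 0"
  have "0 \<in> I" by (auto simp: I_def image_iff)
  hence IT: "I \<subseteq> T" unfolding T_def using \<open>connected I\<close> I by (intro connected_component_maximal)
  have T: "open T" "connected T" "T \<subseteq> S"
    unfolding T_def by (rule open_connected_component[OF S], rule connected_connected_component, rule connected_component_subset)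
  have "(\<lambda>w. g w - P w) (of_real x) = 0"
  proof (rule analytic_continuation[where f = "\<lambda>w. g w - P w" and S = T and U = "of_real ` {0<..<e}" and \<xi> = 0])
    show "(\<lambda>w. g w - P w) holomorphic_on T"
      using T by (intro holomorphic_on_diff holomorphic_on_subset[OF g] holomorphic_on_subset[OF P_hol]) (auto simp: S_def)
    show "of_real ` {0<..<e} \<subseteq> T" using IT e by (force simp: I_def)
    show "0 \<in> T" using IT \<open>0 \<in> I\<close> by auto
    show "(0 :: complex) islimpt of_real ` {0<..<e}"
      unfolding islimpt_approachable
    proof (intro allI impI)
      fix d :: real assume d: "d > 0"
      define y where "y = min d e / 2"
      have "0 < y" "y < e" "y < d" using d e by (auto simp: y_def)
      thus "\<exists>x'\<in>of_real ` {0<..<e}. x' \<noteq> (0 :: complex) \<and> dist x' 0 < d"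
        by (intro bexI[of _ "of_real y"]) auto
    qed
    show "g z - P z = 0" if "z \<in> of_real ` {0<..<e}" for z
      using that eq P_real e by auto
    show "of_real x \<in> T" using IT x by (auto simp: I_def)
  qed (use T in auto)
  thus ?thesis using P_real[OF x] by simp
qed

section \<open>Holomorphic slices and continuation in one variable at a time\<close>

lemma analytic_on_vec_slice:
  fixes G :: "complex ^ 3 \<Rightarrow> complex"
  assumes "analytic_on_vec G D"
  shows "open {w. u + w *s axis l 1 \<in> D}" "(\<lambda>w. G (u + w *s axis l 1)) holomorphic_on {w. u + w *s axis l 1 \<in> D}"
proof -
  have bl: "bounded_linear (\<lambda>w::complex. w *s (axis l 1 :: complex ^ 3))"
    by (intro linear_conv_bounded_linear[THEN iffD1] linearI) (auto simp: vec_eq_iff algebra_simps)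
  have der: "((\<lambda>w. u + w *s axis l 1) has_derivative (\<lambda>h. h *s axis l 1)) (at w)" for w :: complex
    using bounded_linear.has_derivative[OF bl has_derivative_ident] by (auto intro!: derivative_eq_intros)
  have cont: "continuous_on UNIV (\<lambda>w::complex. u + w *s axis l 1)"
    by (intro continuous_on_add continuous_on_const linear_continuous_on bl)
  have D: "open D" using assms by (simp add: analytic_on_vec_def)
  have "open ((\<lambda>w::complex. u + w *s axis l 1) -` D)" by (rule open_vimage[OF D cont])
  thus "open {w. u + w *s axis l 1 \<in> D}" by (simp add: vimage_def)
  show "(\<lambda>w. G (u + w *s axis l 1)) holomorphic_on {w. u + w *s axis l 1 \<in> D}"
  proof (rule holomorphic_onI, rule field_differentiable_at_within)
    fix w assume "w \<in> {w. u + w *s axis l 1 \<in> D}"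
    then obtain L where L: "(G has_derivative L) (at (u + w *s axis l 1))" "\<And>c v. L (c *s v) = c * L v"
      using assms by (auto simp: analytic_on_vec_def)
    have "((\<lambda>w. G (u + w *s axis l 1)) has_derivative (\<lambda>h. L (h *s axis l 1))) (at w)"
      by (rule has_derivative_compose[OF der L(1)])
    also have "(\<lambda>h. L (h *s axis l 1)) = (*) (L (axis l 1))"
      by (simp add: L(2) fun_eq_iff mult.commute)
    finally show "(\<lambda>w. G (u + w *s axis l 1)) field_differentiable at w"
      unfolding field_differentiable_def has_field_derivative_def by blast
  qed
qed

definition rvec :: "real \<Rightarrow> real \<Rightarrow> real \<Rightarrow> complex ^ 3" where
  "rvec x y z = vector [of_real x, of_real y, of_real z]"

lemma rvec_nth [simp]: "rvec x y z $ 1 = of_real x" "rvec x y z $ 2 = of_real y" "rvec x y z $ 3 = of_real z"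
  by (simp_all add: rvec_def)

lemma cvec_conv_rvec: "cvec r = rvec (r $ 1) (r $ 2) (r $ 3)"
  by (simp add: vec_eq_iff forall_3 cvec_def)

lemma rvec_slice:
  "rvec x y z = rvec 0 y z + of_real x *s axis 1 1"
  "rvec x y z = rvec x 0 z + of_real y *s axis 2 1"
  "rvec x y z = rvec x y 0 + of_real z *s axis 3 1"
  by (simp_all add: vec_eq_iff forall_3 axis_def)

lemma rvec_in_cube:
  assumes "cvec ` half_open_cube \<subseteq> D" "0 \<le> x" "x < 1" "0 \<le> y" "y < 1" "0 \<le> z" "z < 1"
  shows "rvec x y z \<in> D"
proof -
  have "rvec x y z = cvec (vector [x, y, z])" by (simp add: cvec_conv_rvec)
  moreover have "vector [x, y, z] \<in> half_open_cube" using assms by (simp add: half_open_cube_def forall_3)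
  ultimately show ?thesis using assms(1) by blast
qed

text \<open>Absolute convergence of the triple series is part of the hypothesis on S, so iterated
  summation is legitimate; only the values of the inner sums must be found. These come from the
  \<open>sums\<close> lemmas, matched with \<open>has_sum\<close> by uniqueness of limits.\<close>

lemma neighbor_series_value:
  assumes \<beta>: "1 / 2 < \<beta>" "\<beta> < 1" and AB: "neighbor_coeffs \<beta> A B"
    and xyz: "0 \<le> x" "x < 1" "0 \<le> y" "y < 1" "0 \<le> z" "z < 1"
    and S: "((\<lambda>n. complex_of_real (A n) * vmonom n (rvec x y z)) has_sum S) nat_index"
  shows "S = of_real (nbr \<beta> x y z)"
proof -
  define F where "F = (\<lambda>(a, b, c). complex_of_real (hahn_coeff \<beta> a b c * x ^ a * y ^ b * z ^ c))"
  define j where "j = (\<lambda>p :: nat \<times> nat \<times> nat. ix (int (fst p)) (int (fst (snd p))) (int (snd (snd p))))"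
  define i where "i = (\<lambda>n :: int ^ 3. (nat (n $ 1), nat (n $ 2), nat (n $ 3)))"
  have "vmonom (ix (int a) (int b) (int c)) (rvec x y z) = of_real (x ^ a * y ^ b * z ^ c)" for a b c
  proof -
    have "(\<Prod>i\<in>UNIV. f i) = f 1 * f 2 * f 3" for f :: "3 \<Rightarrow> complex"
      unfolding UNIV_3 by simp
    thus ?thesis unfolding vmonom_def by simp
  qed
  hence summand: "complex_of_real (A (j p)) * vmonom (j p) (rvec x y z) = F p" for p
    by (simp add: j_def F_def neighbor_coeffs_eq_hahn_coeff[OF \<beta> AB] case_prod_unfold mult_ac)
  have "(F has_sum S) (UNIV \<times> UNIV \<times> UNIV) \<longleftrightarrow> ((\<lambda>n. complex_of_real (A n) * vmonom n (rvec x y z)) has_sum S) nat_index"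
  proof (rule has_sum_reindex_bij_witness[where j = j and i = i])
    show "i (j p) = p" for p by (simp add: i_def j_def)
    show "j p \<in> nat_index" for p by (simp add: j_def ix_in_nat_index)
    show "j (i n) = n" if "n \<in> nat_index" for n
      using that by (simp add: i_def j_def nat_index_def vec_eq_iff forall_3)
    show "complex_of_real (A (j p)) * vmonom (j p) (rvec x y z) = F p" for p by (rule summand)
  qed auto
  hence F: "(F has_sum S) (UNIV \<times> UNIV \<times> UNIV)" using S by simp
  \<comment> \<open>k2 is the value of the innermost sum over c and k1 that of the double sum over b
    and c, each without the powers of the outer variables.\<close>
  define k1 where "k1 = (\<lambda>a. mass0 \<beta> * (hyp_coeff \<beta> a * f_beta \<beta> y * f_beta \<beta> z) +
     (LINT t|lborel. hahn_poly \<beta> a (spec \<beta> t) * hahn_fun \<beta> t y * hahn_fun \<beta> t z * dens \<beta> t))"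
  define k2 where "k2 = (\<lambda>a b. mass0 \<beta> * (hyp_coeff \<beta> a * hyp_coeff \<beta> b * f_beta \<beta> z) +
     (LINT t|lborel. hahn_poly \<beta> a (spec \<beta> t) * hahn_poly \<beta> b (spec \<beta> t) * hahn_fun \<beta> t z * dens \<beta> t))"
  have s1: "(\<lambda>p. F (a, p)) summable_on UNIV \<times> UNIV" for a
    using summable_on_SigmaD1[of "\<lambda>a p. F (a, p)" UNIV "\<lambda>_. UNIV \<times> UNIV" a] F by (auto dest: has_sum_imp_summable)
  have s2: "(\<lambda>c. F (a, b, c)) summable_on UNIV" for a b
    using summable_on_SigmaD1[of "\<lambda>b c. F (a, b, c)" UNIV "\<lambda>_. UNIV" b] s1[of a] by (auto simp: case_prod_unfold)
  have c: "((\<lambda>c. F (a, b, c)) has_sum of_real (k2 a b * x ^ a * y ^ b)) UNIV" for a b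
  proof -
    have h: "((\<lambda>c. F (a, b, c)) has_sum infsum (\<lambda>c. F (a, b, c)) UNIV) UNIV" using s2 by (rule has_sum_infsum)
    have "(\<lambda>c. of_real ((x ^ a * y ^ b) * (hahn_coeff \<beta> a b c * z ^ c)) :: complex) sums of_real ((x ^ a * y ^ b) * k2 a b)"
      unfolding k2_def by (intro sums_of_real sums_mult hahn_coeff_sums_3 \<beta> xyz)
    hence "(\<lambda>c. F (a, b, c)) sums of_real (k2 a b * x ^ a * y ^ b)" by (simp add: F_def mult_ac)
    with has_sum_imp_sums[OF h] have "infsum (\<lambda>c. F (a, b, c)) UNIV = of_real (k2 a b * x ^ a * y ^ b)"
      using sums_unique2 by blast
    with h show ?thesis by simp
  qed
  have b: "((\<lambda>p. F (a, p)) has_sum of_real (k1 a * x ^ a)) (UNIV \<times> UNIV)" for a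
  proof -
    have h: "((\<lambda>p. F (a, p)) has_sum infsum (\<lambda>p. F (a, p)) (UNIV \<times> UNIV)) (UNIV \<times> UNIV)" using s1 by (rule has_sum_infsum)
    have "((\<lambda>b. complex_of_real (k2 a b * x ^ a * y ^ b)) has_sum infsum (\<lambda>p. F (a, p)) (UNIV \<times> UNIV)) UNIV"
      by (rule has_sum_SigmaD[OF h]) (rule c)
    note h' = has_sum_imp_sums[OF this]
    have "(\<lambda>b. of_real (x ^ a * (k2 a b * y ^ b)) :: complex) sums of_real (x ^ a * k1 a)"
      unfolding k1_def k2_def by (intro sums_of_real sums_mult hahn_coeff_sums_2 \<beta> xyz)
    hence "(\<lambda>b. complex_of_real (k2 a b * x ^ a * y ^ b)) sums of_real (k1 a * x ^ a)" by (simp add: mult_ac)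
    with h' have "infsum (\<lambda>p. F (a, p)) (UNIV \<times> UNIV) = of_real (k1 a * x ^ a)"
      using sums_unique2 by blast
    with h show ?thesis by simp
  qed
  have "((\<lambda>a. complex_of_real (k1 a * x ^ a)) has_sum S) UNIV"
    by (rule has_sum_SigmaD[OF F]) (rule b)
  hence 1: "(\<lambda>a. complex_of_real (k1 a * x ^ a)) sums S" by (rule has_sum_imp_sums)
  have "(\<lambda>a. k1 a * x ^ a) sums nbr \<beta> z y x"
    unfolding k1_def using nbr_sums[OF \<beta>, of z y x] xyz by (simp add: hahn_ext_def)
  hence "(\<lambda>a. complex_of_real (k1 a * x ^ a)) sums of_real (nbr \<beta> z y x)" by (rule sums_of_real)
  hence "S = of_real (nbr \<beta> z y x)" using 1 sums_unique2 by blast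
  also have "nbr \<beta> z y x = nbr \<beta> x y z" by (simp add: nbr_def mult_ac)
  finally show ?thesis .
qed

lemma nbr_rotate: "nbr \<beta> x y z = nbr \<beta> y z x"
  by (simp add: nbr_def mult_ac)

text \<open>The equality spreads from the small polydisc to the cube in z, then y, then x. At each
  stage the slice of D contains the segment [0, 1) because the other two coordinates lie in the
  half-open cube.\<close>

lemma neighbor_function_eq_nbr:
  assumes \<beta>: "1 / 2 < \<beta>" "\<beta> < 1" and AB: "neighbor_coeffs \<beta> A B"
    and D: "small_polydisc \<subseteq> D" "cvec ` half_open_cube \<subseteq> D" and G: "analytic_on_vec G D"
    and sum: "\<And>z. z \<in> small_polydisc \<Longrightarrow> ((\<lambda>n. complex_of_real (A n) * vmonom n z) has_sum G z) nat_index"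
    and xyz: "0 \<le> x" "x < 1" "0 \<le> y" "y < 1" "0 \<le> z" "z < 1"
  shows "G (rvec x y z) = of_real (nbr \<beta> x y z)"
proof -
  have base: "G (rvec x y z) = of_real (nbr \<beta> x y z)"
    if "0 \<le> x" "x < 1 / 10" "0 \<le> y" "y < 1 / 10" "0 \<le> z" "z < 1 / 10" for x y z
    using that by (intro neighbor_series_value[OF \<beta> AB] sum) (auto simp: small_polydisc_def forall_3)
  note slice = analytic_on_vec_slice[OF G]
  have step3: "G (rvec x y z) = of_real (nbr \<beta> x y z)"
    if "0 \<le> x" "x < 1 / 10" "0 \<le> y" "y < 1 / 10" "0 \<le> z" "z < 1" for x y z
    unfolding rvec_slice(3)[of x y z]
  proof (rule real_analytic_continuation[OF slice(1) _ slice(2), where e = "1 / 10" and x = z])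
    show "of_real ` {0..<1} \<subseteq> {w. rvec x y 0 + w *s axis 3 1 \<in> D}"
      using that by (auto simp flip: rvec_slice(3) intro!: rvec_in_cube[OF D(2)])
    show "G (rvec x y 0 + of_real w *s axis 3 1) = of_real (nbr \<beta> x y w)" if "0 \<le> w" "w < 1 / 10" for w
      using that \<open>0 \<le> x\<close> \<open>x < 1 / 10\<close> \<open>0 \<le> y\<close> \<open>y < 1 / 10\<close> by (simp flip: rvec_slice(3) add: base)
  qed (use that in \<open>auto intro!: nbr_sums[OF \<beta>]\<close>)
  have step2: "G (rvec x y z) = of_real (nbr \<beta> x y z)"
    if "0 \<le> x" "x < 1 / 10" "0 \<le> y" "y < 1" "0 \<le> z" "z < 1" for x y z
    unfolding rvec_slice(2)[of x y z] nbr_perm(2)[of \<beta> x y z]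
  proof (rule real_analytic_continuation[OF slice(1) _ slice(2), where e = "1 / 10" and x = y])
    show "of_real ` {0..<1} \<subseteq> {w. rvec x 0 z + w *s axis 2 1 \<in> D}"
      using that by (auto simp flip: rvec_slice(2) intro!: rvec_in_cube[OF D(2)])
    show "G (rvec x 0 z + of_real w *s axis 2 1) = of_real (nbr \<beta> x z w)" if "0 \<le> w" "w < 1 / 10" for w
      using that \<open>0 \<le> x\<close> \<open>x < 1 / 10\<close> \<open>0 \<le> z\<close> \<open>z < 1\<close> by (simp flip: rvec_slice(2) add: step3 nbr_perm(2)[of \<beta> x z w])
  qed (use that in \<open>auto intro!: nbr_sums[OF \<beta>]\<close>)
  show ?thesis
    unfolding rvec_slice(1)[of x y z] nbr_rotate[of \<beta> x y z]
  proof (rule real_analytic_continuation[OF slice(1) _ slice(2), where e = "1 / 10" and x = x])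
    show "of_real ` {0..<1} \<subseteq> {w. rvec 0 y z + w *s axis 1 1 \<in> D}"
      using xyz by (auto simp flip: rvec_slice(1) intro!: rvec_in_cube[OF D(2)])
    show "G (rvec 0 y z + of_real w *s axis 1 1) = of_real (nbr \<beta> y z w)" if "0 \<le> w" "w < 1 / 10" for w
      using that xyz by (simp flip: rvec_slice(1) add: step2 nbr_rotate[of \<beta> w y z])
  qed (use xyz in \<open>auto intro!: nbr_sums[OF \<beta>]\<close>)
qed

theorem theorem6p13:
  fixes \<beta> :: real and F :: "real ^ 3 \<Rightarrow> complex"
  assumes "1 / 2 < \<beta>" and "\<beta> < 2 / 3"
    and "is_neighbor_function \<beta> F"
  shows "\<exists>Fbar :: real ^ 3 \<Rightarrow> complex.
           continuous_on closed_cube Fbar \<and>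
           (\<forall>r\<in>half_open_cube. Fbar r = F r) \<and>
           (\<forall>l. \<forall>r\<in>closed_cube. r $ l = 1 \<longrightarrow>
              Fbar r = complex_of_real
                (Gamma (2 * \<beta>) * Gamma (3 * \<beta> - 1) / (Gamma \<beta> * Gamma (4 * \<beta> - 1))
                  * (\<Prod>j\<in>UNIV - {l}. f_beta \<beta> (r $ j))))"
proof -
  have \<beta>: "1 / 2 < \<beta>" "\<beta> < 1" using assms by auto
  obtain A B G D where AB: "neighbor_coeffs \<beta> A B" and D: "small_polydisc \<subseteq> D" "cvec ` half_open_cube \<subseteq> D"
    and G: "analytic_on_vec G D" "\<And>z. z \<in> small_polydisc \<Longrightarrow> ((\<lambda>n. complex_of_real (A n) * vmonom n z) has_sum G z) nat_index"
    and F: "\<And>r. r \<in> half_open_cube \<Longrightarrow> F r = G (cvec r)"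
    using assms(3) unfolding is_neighbor_function_def by blast
  define Fbar where "Fbar = (\<lambda>r :: real ^ 3. complex_of_real (nbr \<beta> (r $ 1) (r $ 2) (r $ 3)))"
  have "continuous_on closed_cube Fbar"
    unfolding continuous_on_sequentially
  proof (intro allI ballI impI, elim conjE)
    fix X :: "nat \<Rightarrow> real ^ 3" and r :: "real ^ 3"
    assume r: "r \<in> closed_cube" and X: "\<forall>n. X n \<in> closed_cube" "X \<longlonglongrightarrow> r"
    have lim: "(\<lambda>n. X n $ i) \<longlonglongrightarrow> r $ i" for i using X(2) by (intro tendsto_vec_nth)
    have "(\<lambda>n. nbr \<beta> (X n $ 1) (X n $ 2) (X n $ 3)) \<longlonglongrightarrow> nbr \<beta> (r $ 1) (r $ 2) (r $ 3)"
      using r X(1) by (intro nbr_tendsto \<beta> lim) (auto simp: closed_cube_def)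
    thus "(Fbar \<circ> X) \<longlonglongrightarrow> Fbar r" unfolding Fbar_def o_def by (rule tendsto_of_real)
  qed
  moreover have "\<forall>r\<in>half_open_cube. Fbar r = F r"
  proof
    fix r :: "real ^ 3" assume r: "r \<in> half_open_cube"
    have "G (rvec (r $ 1) (r $ 2) (r $ 3)) = of_real (nbr \<beta> (r $ 1) (r $ 2) (r $ 3))"
      using r by (intro neighbor_function_eq_nbr[OF \<beta> AB D G]) (auto simp: half_open_cube_def)
    thus "Fbar r = F r" unfolding F[OF r] cvec_conv_rvec Fbar_def by (rule sym)
  qed
  moreover have "\<forall>l. \<forall>r\<in>closed_cube. r $ l = 1 \<longrightarrow>
              Fbar r = complex_of_real
                (Gamma (2 * \<beta>) * Gamma (3 * \<beta> - 1) / (Gamma \<beta> * Gamma (4 * \<beta> - 1))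
                  * (\<Prod>j\<in>UNIV - {l}. f_beta \<beta> (r $ j)))"
  proof (intro allI ballI impI)
    fix l :: 3 and r :: "real ^ 3" assume l: "r $ l = 1"
    have ne: "(1 :: 3) \<noteq> 2" "(1 :: 3) \<noteq> 3" "(2 :: 3) \<noteq> 3" by simp_all
    have U: "UNIV - {1 :: 3} = {2, 3}" "UNIV - {2 :: 3} = {1, 3}" "UNIV - {3 :: 3} = {1, 2}"
      unfolding UNIV_3 using ne ne[symmetric] by blast+
    have P: "(\<Prod>j\<in>{a, b}. f_beta \<beta> (r $ j)) = f_beta \<beta> (r $ a) * f_beta \<beta> (r $ b)" if "a \<noteq> b" for a b
      using that by simp
    have "l = 1 \<or> l = 2 \<or> l = 3" by (rule exhaust_3)
    \<comment> \<open>By symmetry of \<open>nbr\<close> the coordinate equal to 1 can be moved to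
      the last slot, where \<open>nbr_face\<close> applies.\<close>
    hence "nbr \<beta> (r $ 1) (r $ 2) (r $ 3) = mass0 \<beta> * f_beta \<beta> 1 * (\<Prod>j\<in>UNIV - {l}. f_beta \<beta> (r $ j))"
    proof (elim disjE)
      assume 1: "l = 1"
      have "nbr \<beta> (r $ 1) (r $ 2) (r $ 3) = nbr \<beta> (r $ 2) (r $ 3) (r $ 1)" by (rule nbr_rotate)
      also have "\<dots> = nbr \<beta> (r $ 2) (r $ 3) 1" using l unfolding 1 by simp
      finally show ?thesis unfolding 1 U P[OF ne(3)] nbr_face by simp
    next
      assume 2: "l = 2"
      have "nbr \<beta> (r $ 1) (r $ 2) (r $ 3) = nbr \<beta> (r $ 1) (r $ 3) (r $ 2)" by (rule nbr_perm(2))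
      also have "\<dots> = nbr \<beta> (r $ 1) (r $ 3) 1" using l unfolding 2 by simp
      finally show ?thesis unfolding 2 U P[OF ne(2)] nbr_face by simp
    next
      assume 3: "l = 3"
      have "nbr \<beta> (r $ 1) (r $ 2) (r $ 3) = nbr \<beta> (r $ 1) (r $ 2) 1" using l unfolding 3 by simp
      thus ?thesis unfolding 3 U P[OF ne(1)] nbr_face by simp
    qed
    thus "Fbar r = complex_of_real
                (Gamma (2 * \<beta>) * Gamma (3 * \<beta> - 1) / (Gamma \<beta> * Gamma (4 * \<beta> - 1))
                  * (\<Prod>j\<in>UNIV - {l}. f_beta \<beta> (r $ j)))"
      unfolding mass0_f_beta_1[OF \<beta>] Fbar_def by (rule arg_cong)
  qed
  ultimately show ?thesis by blast
qed

end
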